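(* Let $(R,\mathfrak{m},K)$ be a regular local ring of prime characteristic $p>0$ (with maximal ideal $\mathfrak m$ and residue field $K$) containing a quasi-coefficient field $k$. Suppose that $R$ has a $p$-basis over $k$. Then $\mathrm{Der}_k(R)=\mathrm{IDer}_k(R)$.
   Context: Rings are commutative with unit. A quasi-coefficient field of a local ring $(R,\mathfrak m,K)$ is a subfield $k\subset R$ such that the residue field $K$ is formally étale (i.e. $0$-étale) over $k$ via the map $k\to R\to K$. $p$-basis: $R^{p}=\{r^{p}\mid r\in R\}$, and $R^{p}[k]$ is the subring of $R$ generated by $R^{p}$ and $k$. A subset $B\subset R$ (possibly infinite) is a $p$-basis of $R$ over $k$ if $R=R^p[k][B]$ and the family of monomials $\{b_1^{\alpha_1}\cdots b_m^{\alpha_m}\mid b_i\in B,\ b_i\neq b_j \text{ for } i\ne j,\ 0\leq \alpha_i<p\}$ (indexed by the finitely supported exponent functions) is linearly independent over $R^{p}[k]$. Integrable derivations: an HS-derivation of $R$ over $k$ of length $\infty$ is a sequence $D=(D_0,D_1,D_2,\ldots)$ of $k$-linear maps $D_\alpha:R\to R$ with $D_0=\mathrm{Id}_R$ and $D_\alpha(xy)=\sum_{i+j=\alpha}D_i(x)D_j(y)$ for all $x,y\in R$ and all $\alpha$. $\mathrm{Der}_k(R)$ is the module of $k$-derivations $R\to R$, and $\mathrm{IDer}_k(R)$ is the set of $\delta\in\mathrm{Der}_k(R)$ for which there is an HS-derivation $D$ of $R$ over $k$ of length $\infty$ with $D_1=\delta$. *)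

theory Defs
  imports
    "HOL-Algebra.Algebra"
    "HOL-Library.Countable"
    "HOL-Library.Extended_Nat"
    "HOL-Computational_Algebra.Primes"
begin

definition krull_dim :: "('a, 'r) ring_scheme \<Rightarrow> enat" where
  "krull_dim R = Sup {enat n | n. \<exists>P :: nat \<Rightarrow> 'a set.
     (\<forall>i\<le>n. primeideal (P i) R) \<and> (\<forall>i<n. P i \<subset> P (Suc i))}"

definition noetherian_local_ring :: "('a, 'r) ring_scheme \<Rightarrow> 'a set \<Rightarrow> bool" where
  "noetherian_local_ring R m \<longleftrightarrow> cring R \<and> noetherian_ring R \<and>
     maximalideal m R \<and> (\<forall>J. maximalideal J R \<longrightarrow> J = m)"

definition regular_local_ring :: "('a, 'r) ring_scheme \<Rightarrow> 'a set \<Rightarrow> bool" where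
  "regular_local_ring R m \<longleftrightarrow> noetherian_local_ring R m \<and>
     (\<exists>S. S \<subseteq> carrier R \<and> finite S \<and> genideal R S = m \<and> enat (card S) = krull_dim R)"

definition has_characteristic :: "('a, 'r) ring_scheme \<Rightarrow> nat \<Rightarrow> bool" where
  "has_characteristic R p \<longleftrightarrow> (\<forall>n::nat. [n] \<cdot>\<^bsub>R\<^esub> \<one>\<^bsub>R\<^esub> = \<zero>\<^bsub>R\<^esub> \<longleftrightarrow> p dvd n)"

text \<open>
  Let \<open>f\<close> be the structure map of the \<open>A\<close>-algebra \<open>B\<close>.  The following is the infinitesimal
  lifting property of \<open>B\<close> (existence and uniqueness) with respect to a single ring \<open>C\<close>, for all
  \<open>A\<close>-algebra structures \<open>g\<close> on \<open>C\<close> and all ideals \<open>N\<close> of \<open>C\<close> with \<open>N\<^sup>2 = 0\<close>.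
\<close>

definition unique_lifting ::
  "('a, 'r) ring_scheme \<Rightarrow> ('b, 's) ring_scheme \<Rightarrow> ('a \<Rightarrow> 'b) \<Rightarrow> ('c, 't) ring_scheme \<Rightarrow> bool" where
  "unique_lifting A B f C \<longleftrightarrow>
     (\<forall>N g u. ideal N C \<longrightarrow> (\<forall>x\<in>N. \<forall>y\<in>N. x \<otimes>\<^bsub>C\<^esub> y = \<zero>\<^bsub>C\<^esub>) \<longrightarrow>
        g \<in> ring_hom A C \<longrightarrow> u \<in> ring_hom B (C Quot N) \<longrightarrow>
        (\<forall>a\<in>carrier A. u (f a) = N +>\<^bsub>C\<^esub> g a) \<longrightarrow>
        (\<exists>!v. v \<in> ring_hom B C \<and> v \<in> extensional (carrier B) \<and>
           (\<forall>a\<in>carrier A. v (f a) = g a) \<and> (\<forall>b\<in>carrier B. N +>\<^bsub>C\<^esub> v b = u b)))"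

text \<open>
  HOL cannot quantify over all types inside a formula, so the test rings range over one fixed
  type.  It is chosen so large that nothing is lost: every lifting problem descends to the subring
  generated by the images of \<open>A\<close> and of (lifts of) \<open>B\<close>, which embeds into
  \<^typ>\<open>('a + 'b) list\<close>.  The theorem \<open>formally_etale_unique_lifting\<close> below states that the
  lifting property then holds for test rings over arbitrary types.
\<close>

definition formally_etale ::
  "('a, 'r) ring_scheme \<Rightarrow> ('b, 's) ring_scheme \<Rightarrow> ('a \<Rightarrow> 'b) \<Rightarrow> bool" where
  "formally_etale A B f \<longleftrightarrow>
     f \<in> ring_hom A B \<and> (\<forall>C :: ('a + 'b) list ring. cring C \<longrightarrow> unique_lifting A B f C)"

definition quasi_coefficient_field :: "('a, 'r) ring_scheme \<Rightarrow> 'a set \<Rightarrow> 'a set \<Rightarrow> bool" where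
  "quasi_coefficient_field R m k \<longleftrightarrow> subfield k R \<and>
     formally_etale (R\<lparr>carrier := k\<rparr>) (R Quot m) (\<lambda>c. m +>\<^bsub>R\<^esub> c)"

definition Rpk :: "('a, 'r) ring_scheme \<Rightarrow> nat \<Rightarrow> 'a set \<Rightarrow> 'a set" where
  "Rpk R p k = generate_ring R ((\<lambda>r. r [^]\<^bsub>R\<^esub> p) ` carrier R \<union> k)"

definition p_exponents :: "nat \<Rightarrow> 'a set \<Rightarrow> ('a \<Rightarrow> nat) set" where
  "p_exponents p B = {\<alpha>. finite {b. \<alpha> b \<noteq> 0} \<and> {b. \<alpha> b \<noteq> 0} \<subseteq> B \<and> (\<forall>b. \<alpha> b < p)}"

definition monomial :: "('a, 'r) ring_scheme \<Rightarrow> ('a \<Rightarrow> nat) \<Rightarrow> 'a" where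
  "monomial R \<alpha> = finprod R (\<lambda>b. b [^]\<^bsub>R\<^esub> \<alpha> b) {b. \<alpha> b \<noteq> 0}"

definition lin_independent_family ::
  "('a, 'r) ring_scheme \<Rightarrow> 'a set \<Rightarrow> 'i set \<Rightarrow> ('i \<Rightarrow> 'a) \<Rightarrow> bool" where
  "lin_independent_family R S J x \<longleftrightarrow>
     (\<forall>F c. F \<subseteq> J \<longrightarrow> finite F \<longrightarrow> c \<in> F \<rightarrow> S \<longrightarrow>
        (\<Oplus>\<^bsub>R\<^esub>i\<in>F. c i \<otimes>\<^bsub>R\<^esub> x i) = \<zero>\<^bsub>R\<^esub> \<longrightarrow> (\<forall>i\<in>F. c i = \<zero>\<^bsub>R\<^esub>))"

definition p_basis :: "('a, 'r) ring_scheme \<Rightarrow> nat \<Rightarrow> 'a set \<Rightarrow> 'a set \<Rightarrow> bool" where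
  "p_basis R p k B \<longleftrightarrow> B \<subseteq> carrier R \<and>
     generate_ring R (Rpk R p k \<union> B) = carrier R \<and>
     lin_independent_family R (Rpk R p k) (p_exponents p B) (monomial R)"

text \<open>
  Maps \<open>R \<rightarrow> R\<close> are taken extensional (\<open>undefined\<close> outside the carrier), so that
  equality of HOL functions is equality of maps.
\<close>

definition linear_maps :: "('a, 'r) ring_scheme \<Rightarrow> 'a set \<Rightarrow> ('a \<Rightarrow> 'a) set" where
  "linear_maps R k = {h \<in> carrier R \<rightarrow>\<^sub>E carrier R.
     (\<forall>x\<in>carrier R. \<forall>y\<in>carrier R. h (x \<oplus>\<^bsub>R\<^esub> y) = h x \<oplus>\<^bsub>R\<^esub> h y) \<and>
     (\<forall>c\<in>k. \<forall>x\<in>carrier R. h (c \<otimes>\<^bsub>R\<^esub> x) = c \<otimes>\<^bsub>R\<^esub> h x)}"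

definition Der :: "('a, 'r) ring_scheme \<Rightarrow> 'a set \<Rightarrow> ('a \<Rightarrow> 'a) set" where
  "Der R k = {\<delta> \<in> linear_maps R k.
     \<forall>x\<in>carrier R. \<forall>y\<in>carrier R. \<delta> (x \<otimes>\<^bsub>R\<^esub> y) = x \<otimes>\<^bsub>R\<^esub> \<delta> y \<oplus>\<^bsub>R\<^esub> \<delta> x \<otimes>\<^bsub>R\<^esub> y}"

definition HS_derivation :: "('a, 'r) ring_scheme \<Rightarrow> 'a set \<Rightarrow> (nat \<Rightarrow> 'a \<Rightarrow> 'a) \<Rightarrow> bool" where
  "HS_derivation R k D \<longleftrightarrow> (\<forall>n. D n \<in> linear_maps R k) \<and> (\<forall>x\<in>carrier R. D 0 x = x) \<and>
     (\<forall>n. \<forall>x\<in>carrier R. \<forall>y\<in>carrier R.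
        D n (x \<otimes>\<^bsub>R\<^esub> y) = (\<Oplus>\<^bsub>R\<^esub>i\<in>{..n}. D i x \<otimes>\<^bsub>R\<^esub> D (n - i) y))"

definition IDer :: "('a, 'r) ring_scheme \<Rightarrow> 'a set \<Rightarrow> ('a \<Rightarrow> 'a) set" where
  "IDer R k = {\<delta> \<in> Der R k. \<exists>D. HS_derivation R k D \<and> D 1 = \<delta>}"

text \<open>Terms with two kinds of variables; their values exhaust a generated ring.\<close>

datatype 'x rterm = ROne | RVar bool 'x | RNeg "'x rterm"
  | RAdd "'x rterm" "'x rterm" | RMul "'x rterm" "'x rterm"

instance rterm :: (countable) countable
  by countable_datatype

primrec rleaves :: "'x rterm \<Rightarrow> 'x list" where
  "rleaves ROne = []"
| "rleaves (RVar i x) = [x]"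
| "rleaves (RNeg s) = rleaves s"
| "rleaves (RAdd s t) = rleaves s @ rleaves t"
| "rleaves (RMul s t) = rleaves s @ rleaves t"

primrec rval :: "('c, 't) ring_scheme \<Rightarrow> (bool \<Rightarrow> 'x \<Rightarrow> 'c) \<Rightarrow> 'x rterm \<Rightarrow> 'c" where
  "rval C h ROne = \<one>\<^bsub>C\<^esub>"
| "rval C h (RVar i x) = h i x"
| "rval C h (RNeg s) = \<ominus>\<^bsub>C\<^esub> rval C h s"
| "rval C h (RAdd s t) = rval C h s \<oplus>\<^bsub>C\<^esub> rval C h t"
| "rval C h (RMul s t) = rval C h s \<otimes>\<^bsub>C\<^esub> rval C h t"

lemma length_rleaves: "map_rterm (\<lambda>_. ()) s = map_rterm (\<lambda>_. ()) t \<Longrightarrow>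
    length (rleaves s) = length (rleaves t)"
proof (induction s arbitrary: t)
  case ROne then show ?case by (cases t) auto
next
  case (RVar i x) then show ?case by (cases t) auto
next
  case (RNeg s) then show ?case by (cases t) auto
next
  case (RAdd s1 s2) from RAdd.IH RAdd.prems show ?case by (cases t) force+
next
  case (RMul s1 s2) from RMul.IH RMul.prems show ?case by (cases t) force+
qed

lemma rterm_eqI: "map_rterm (\<lambda>_. ()) s = map_rterm (\<lambda>_. ()) t \<Longrightarrow> rleaves s = rleaves t \<Longrightarrow> s = t"
proof (induction s arbitrary: t)
  case ROne then show ?case by (cases t) auto
next
  case (RVar i x) then show ?case by (cases t) auto
next
  case (RNeg s) then show ?case by (cases t) auto
next
  case (RAdd s1 s2) then show ?case
    by (cases t) (auto dest: length_rleaves)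
next
  case (RMul s1 s2) then show ?case
    by (cases t) (auto dest: length_rleaves)
qed

lemma inj_rterm_list: "\<exists>e :: ('a + 'b) rterm \<Rightarrow> ('a + 'b) list. inj e"
proof -
  define mark :: "nat \<Rightarrow> ('a + 'b) list" where
    "mark n = replicate n (Inl undefined) @ [Inr undefined]" for n
  have mark: "mark n @ l = mark n' @ l' \<Longrightarrow> n = n' \<and> l = l'" for n n' l l'
  proof (induction n arbitrary: n')
    case 0 then show ?case by (cases n') (auto simp: mark_def)
  next
    case (Suc n) then show ?case by (cases n') (auto simp: mark_def)
  qed
  define e where "e t = mark (to_nat (map_rterm (\<lambda>_. ()) t)) @ rleaves t" for t :: "('a + 'b) rterm"
  have "inj e"
    by (rule injI) (auto simp: e_def dest!: mark intro: rterm_eqI)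
  then show ?thesis by blast
qed

lemma generate_ring_rval:
  assumes "x \<in> generate_ring C H" "H \<subseteq> {y. \<exists>i z. y = h i z}"
  shows "x \<in> range (rval C h)"
  using assms(1)
proof induction
  case one then show ?case by (metis rangeI rval.simps(1))
next
  case (incl y)
  then obtain i z where "y = h i z" using assms(2) by blast
  then show ?case by (auto intro: range_eqI[where x = "RVar i z"])
next
  case (a_inv y) then show ?case by (auto intro: range_eqI[where x = "RNeg _"])
next
  case (eng_add y z) then show ?case by (auto intro: range_eqI[where x = "RAdd _ _"])
next
  case (eng_mult y z) then show ?case by (auto intro: range_eqI[where x = "RMul _ _"])
qed

lemma inj_generate_ring:
  fixes C :: "('c, 't) ring_scheme" and h :: "bool \<Rightarrow> 'a + 'b \<Rightarrow> 'c"
  assumes "H \<subseteq> {y. \<exists>i z. y = h i z}"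
  shows "\<exists>j :: 'c \<Rightarrow> ('a + 'b) list. inj_on j (generate_ring C H)"
proof -
  obtain e :: "('a + 'b) rterm \<Rightarrow> ('a + 'b) list" where e: "inj e"
    using inj_rterm_list by blast
  have "generate_ring C H \<subseteq> range (rval C h)"
    using generate_ring_rval[OF _ assms] by blast
  then have "inj_on (inv_into UNIV (rval C h)) (generate_ring C H)"
    by (rule inj_on_inv_into)
  then have "inj_on (e \<circ> inv_into UNIV (rval C h)) (generate_ring C H)"
    using e by (intro comp_inj_on) (auto intro: inj_on_subset)
  then show ?thesis by blast
qed

lemma subring_replica:
  fixes C :: "('c, 't) ring_scheme" and h :: "bool \<Rightarrow> 'a + 'b \<Rightarrow> 'c"
  assumes "cring C" "H \<subseteq> carrier C" "H \<subseteq> {y. \<exists>i z. y = h i z}"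
  shows "\<exists>(D :: ('a + 'b) list ring) \<phi>. cring D \<and> \<phi> \<in> ring_hom D C \<and> inj_on \<phi> (carrier D) \<and>
     H \<subseteq> \<phi> ` carrier D"
proof -
  interpret C: cring C by fact
  define G where "G = generate_ring C H"
  have G: "subring G C" unfolding G_def by (rule C.generate_ring_is_subring) fact
  define C' where "C' = C\<lparr>carrier := G\<rparr>"
  have C': "cring C'" unfolding C'_def
    using C.subcring_iff[OF subringE(1)[OF G]] C.subcringI'[OF G] by simp
  interpret C': cring C' by fact
  obtain j :: "'c \<Rightarrow> ('a + 'b) list" where j: "inj_on j (carrier C')"
    using inj_generate_ring[OF assms(3), of C] by (auto simp: C'_def G_def)
  let ?D = "image_ring j C'"
  let ?\<phi> = "inv_into (carrier C') j"
  have iso: "j \<in> ring_iso C' ?D" using j by (rule inj_imp_image_ring_iso)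
  have D: "cring ?D"
    using C'.ring_iso_imp_img_cring[OF iso] by (simp add: image_ring_def image_group_def monoid.defs)
  have \<phi>: "?\<phi> \<in> ring_iso ?D C'"
    using ring_iso_set_sym[OF C'.ring_axioms iso] .
  have "?\<phi> \<in> ring_hom ?D C"
    using \<phi> subringE(1)[OF G] by (auto simp: ring_iso_def ring_hom_def C'_def)
  moreover have "inj_on ?\<phi> (carrier ?D)" "?\<phi> ` carrier ?D = carrier C'"
    using \<phi> by (auto simp: ring_iso_def bij_betw_def)
  moreover have "H \<subseteq> carrier C'" by (auto simp: C'_def G_def intro: generate_ring.incl)
  ultimately show ?thesis using D by blast
qed

lemma unique_lifting_descend:
  assumes "cring C" "cring D" "ring A" "ring B"
    and \<phi>: "\<phi> \<in> ring_hom D C" and inj: "inj_on \<phi> (carrier D)"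
    and L: "unique_lifting A B f D" and f: "f \<in> ring_hom A B"
    and N: "ideal N C" and N2: "\<forall>x\<in>N. \<forall>y\<in>N. x \<otimes>\<^bsub>C\<^esub> y = \<zero>\<^bsub>C\<^esub>"
    and g: "g \<in> ring_hom A C" and u: "u \<in> ring_hom B (C Quot N)"
    and gu: "\<forall>a\<in>carrier A. u (f a) = N +>\<^bsub>C\<^esub> g a"
    and gA: "g ` carrier A \<subseteq> \<phi> ` carrier D"
    and uB: "\<forall>b\<in>carrier B. \<exists>d\<in>carrier D. N +>\<^bsub>C\<^esub> \<phi> d = u b"
  shows "\<exists>!v. v \<in> ring_hom B D \<and> v \<in> extensional (carrier B) \<and>
           (\<forall>a\<in>carrier A. \<phi> (v (f a)) = g a) \<and> (\<forall>b\<in>carrier B. N +>\<^bsub>C\<^esub> \<phi> (v b) = u b)"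
proof -
  interpret C: cring C by fact
  interpret D: cring D by fact
  interpret A: ring A by fact
  interpret B: ring B by fact
  interpret \<phi>: ring_hom_ring D C \<phi> using \<phi> by unfold_locales
  interpret N: ideal N C by fact
  define M where "M = {d \<in> carrier D. \<phi> d \<in> N}"
  have M: "ideal M D" unfolding M_def using \<phi>.ideal_vimage[OF N] by simp
  interpret M: ideal M D by fact
  have coset: "M +>\<^bsub>D\<^esub> d = M +>\<^bsub>D\<^esub> e \<longleftrightarrow> N +>\<^bsub>C\<^esub> \<phi> d = N +>\<^bsub>C\<^esub> \<phi> e"
    if "d \<in> carrier D" "e \<in> carrier D" for d e
  proof -
    have "M +>\<^bsub>D\<^esub> d = M +>\<^bsub>D\<^esub> e \<longleftrightarrow> d \<ominus>\<^bsub>D\<^esub> e \<in> M"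
      by (rule D.quotient_eq_iff_same_a_r_cos[OF M that, symmetric])
    also have "\<dots> \<longleftrightarrow> \<phi> d \<ominus>\<^bsub>C\<^esub> \<phi> e \<in> N"
    proof -
      have "\<phi> (d \<ominus>\<^bsub>D\<^esub> e) = \<phi> d \<ominus>\<^bsub>C\<^esub> \<phi> e"
        unfolding D.minus_eq C.minus_eq
        using that by (simp only: \<phi>.hom_add \<phi>.hom_a_inv D.a_inv_closed)
      moreover have "d \<ominus>\<^bsub>D\<^esub> e \<in> carrier D" using that by (rule D.minus_closed)
      ultimately show ?thesis unfolding M_def by (simp only: mem_Collect_eq simp_thms)
    qed
    also have "\<dots> \<longleftrightarrow> N +>\<^bsub>C\<^esub> \<phi> d = N +>\<^bsub>C\<^esub> \<phi> e"
      by (rule C.quotient_eq_iff_same_a_r_cos[OF N \<phi>.hom_closed \<phi>.hom_closed]) (fact that)+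
    finally show ?thesis .
  qed
  obtain s where s: "\<And>b. b \<in> carrier B \<Longrightarrow> s b \<in> carrier D"
    "\<And>b. b \<in> carrier B \<Longrightarrow> N +>\<^bsub>C\<^esub> \<phi> (s b) = u b"
    using uB by metis
  define u' where "u' b = M +>\<^bsub>D\<^esub> s b" for b
  have u'_iff: "M +>\<^bsub>D\<^esub> d = u' b \<longleftrightarrow> N +>\<^bsub>C\<^esub> \<phi> d = u b" if "d \<in> carrier D" "b \<in> carrier B" for b d
    using that by (simp add: u'_def coset s)
  note Nh = N.rcos_ring_hom and Mh = M.rcos_ring_hom
  have u': "u' \<in> ring_hom B (D Quot M)"
  proof (rule ring_hom_memI)
    fix b assume b: "b \<in> carrier B"
    then show "u' b \<in> carrier (D Quot M)"
      unfolding u'_def using ring_hom_closed[OF Mh] s by blast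
    fix b' assume b': "b' \<in> carrier B"
    have "M +>\<^bsub>D\<^esub> (s b \<otimes>\<^bsub>D\<^esub> s b') = u' (b \<otimes>\<^bsub>B\<^esub> b')"
    proof (rule u'_iff[THEN iffD2])
      have "N +>\<^bsub>C\<^esub> \<phi> (s b \<otimes>\<^bsub>D\<^esub> s b') = (N +>\<^bsub>C\<^esub> \<phi> (s b)) \<otimes>\<^bsub>C Quot N\<^esub> (N +>\<^bsub>C\<^esub> \<phi> (s b'))"
        using b b' by (simp add: s(1) ring_hom_mult[OF Nh])
      also have "\<dots> = u (b \<otimes>\<^bsub>B\<^esub> b')"
        using b b' by (simp add: s(2) ring_hom_mult[OF u])
      finally show "N +>\<^bsub>C\<^esub> \<phi> (s b \<otimes>\<^bsub>D\<^esub> s b') = u (b \<otimes>\<^bsub>B\<^esub> b')" .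
    qed (use b b' s(1) in auto)
    then show "u' (b \<otimes>\<^bsub>B\<^esub> b') = u' b \<otimes>\<^bsub>D Quot M\<^esub> u' b'"
      using b b' s(1) by (simp add: u'_def[of b] u'_def[of b'] ring_hom_mult[OF Mh])
    have "M +>\<^bsub>D\<^esub> (s b \<oplus>\<^bsub>D\<^esub> s b') = u' (b \<oplus>\<^bsub>B\<^esub> b')"
    proof (rule u'_iff[THEN iffD2])
      have "N +>\<^bsub>C\<^esub> \<phi> (s b \<oplus>\<^bsub>D\<^esub> s b') = (N +>\<^bsub>C\<^esub> \<phi> (s b)) \<oplus>\<^bsub>C Quot N\<^esub> (N +>\<^bsub>C\<^esub> \<phi> (s b'))"
        using b b' by (simp add: s(1) ring_hom_add[OF Nh])
      also have "\<dots> = u (b \<oplus>\<^bsub>B\<^esub> b')"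
        using b b' by (simp add: s(2) ring_hom_add[OF u])
      finally show "N +>\<^bsub>C\<^esub> \<phi> (s b \<oplus>\<^bsub>D\<^esub> s b') = u (b \<oplus>\<^bsub>B\<^esub> b')" .
    qed (use b b' s(1) in auto)
    then show "u' (b \<oplus>\<^bsub>B\<^esub> b') = u' b \<oplus>\<^bsub>D Quot M\<^esub> u' b'"
      using b b' s(1) by (simp add: u'_def[of b] u'_def[of b'] ring_hom_add[OF Mh])
  next
    have "M +>\<^bsub>D\<^esub> \<one>\<^bsub>D\<^esub> = u' \<one>\<^bsub>B\<^esub>"
      by (simp add: u'_iff ring_hom_one[OF u] ring_hom_one[OF Nh])
    then show "u' \<one>\<^bsub>B\<^esub> = \<one>\<^bsub>D Quot M\<^esub>" by (simp add: ring_hom_one[OF Mh])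
  qed
  define g' where "g' a = inv_into (carrier D) \<phi> (g a)" for a
  have g'1: "g' a \<in> carrier D" "\<phi> (g' a) = g a" if "a \<in> carrier A" for a
    using gA that by (auto simp: g'_def inv_into_into f_inv_into_f image_subset_iff)
  have g'_iff: "d = g' a \<longleftrightarrow> \<phi> d = g a" if "d \<in> carrier D" "a \<in> carrier A" for a d
    using that g'1 inj_onD[OF inj, of d "g' a"] by auto
  have fA: "f a \<in> carrier B" if "a \<in> carrier A" for a using ring_hom_closed[OF f that] .
  have g': "g' \<in> ring_hom A D"
  proof (rule ring_hom_memI)
    show "g' x \<in> carrier D" if "x \<in> carrier A" for x using that by (rule g'1)
  next
    fix x y assume xy: "x \<in> carrier A" "y \<in> carrier A"
    show "g' (x \<otimes>\<^bsub>A\<^esub> y) = g' x \<otimes>\<^bsub>D\<^esub> g' y"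
      by (rule g'_iff[THEN iffD2, symmetric]) (use xy in \<open>simp_all add: g'1 ring_hom_mult[OF g]\<close>)
    show "g' (x \<oplus>\<^bsub>A\<^esub> y) = g' x \<oplus>\<^bsub>D\<^esub> g' y"
      by (rule g'_iff[THEN iffD2, symmetric]) (use xy in \<open>simp_all add: g'1 ring_hom_add[OF g]\<close>)
  next
    show "g' \<one>\<^bsub>A\<^esub> = \<one>\<^bsub>D\<^esub>"
      by (rule g'_iff[THEN iffD2, symmetric]) (simp_all add: ring_hom_one[OF g])
  qed
  have M2: "\<forall>x\<in>M. \<forall>y\<in>M. x \<otimes>\<^bsub>D\<^esub> y = \<zero>\<^bsub>D\<^esub>"
  proof (intro ballI)
    fix x y assume "x \<in> M" "y \<in> M"
    then have xy: "x \<in> carrier D" "y \<in> carrier D" and "\<phi> x \<in> N" "\<phi> y \<in> N"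
      unfolding M_def by blast+
    then have "\<phi> (x \<otimes>\<^bsub>D\<^esub> y) = \<phi> \<zero>\<^bsub>D\<^esub>"
      using N2 by (simp only: \<phi>.hom_mult \<phi>.hom_zero)
    then show "x \<otimes>\<^bsub>D\<^esub> y = \<zero>\<^bsub>D\<^esub>"
      by (rule inj_onD[OF inj]) (use xy in simp_all)
  qed
  have gu': "\<forall>a\<in>carrier A. u' (f a) = M +>\<^bsub>D\<^esub> g' a"
    using gu by (intro ballI u'_iff[THEN iffD2, symmetric]) (simp_all add: g'1 fA)
  have "\<exists>!v. v \<in> ring_hom B D \<and> v \<in> extensional (carrier B) \<and>
      (\<forall>a\<in>carrier A. v (f a) = g' a) \<and> (\<forall>b\<in>carrier B. M +>\<^bsub>D\<^esub> v b = u' b)"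
    using L[unfolded unique_lifting_def] M M2 g' u' gu' by blast
  moreover have "v \<in> ring_hom B D \<and> v \<in> extensional (carrier B) \<and>
      (\<forall>a\<in>carrier A. v (f a) = g' a) \<and> (\<forall>b\<in>carrier B. M +>\<^bsub>D\<^esub> v b = u' b) \<longleftrightarrow>
      v \<in> ring_hom B D \<and> v \<in> extensional (carrier B) \<and>
      (\<forall>a\<in>carrier A. \<phi> (v (f a)) = g a) \<and> (\<forall>b\<in>carrier B. N +>\<^bsub>C\<^esub> \<phi> (v b) = u b)" for v
    using ring_hom_closed[of v B D] fA by (cases "v \<in> ring_hom B D") (simp_all add: u'_iff g'_iff)
  ultimately show ?thesis by simp
qed

theorem formally_etale_unique_lifting:
  fixes A :: "('a, 'r) ring_scheme" and B :: "('b, 's) ring_scheme" and C :: "('c, 't) ring_scheme"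
  assumes "formally_etale A B f" "ring A" "ring B" "cring C"
  shows "unique_lifting A B f C"
  unfolding unique_lifting_def
proof (intro allI impI)
  fix N g u
  assume N: "ideal N C" and N2: "\<forall>x\<in>N. \<forall>y\<in>N. x \<otimes>\<^bsub>C\<^esub> y = \<zero>\<^bsub>C\<^esub>"
    and g: "g \<in> ring_hom A C" and u: "u \<in> ring_hom B (C Quot N)"
    and gu: "\<forall>a\<in>carrier A. u (f a) = N +>\<^bsub>C\<^esub> g a"
  interpret C: cring C by fact
  interpret B: ring B by fact
  have f: "f \<in> ring_hom A B" using assms(1) by (simp add: formally_etale_def)
  let ?P = "\<lambda>v. v \<in> ring_hom B C \<and> v \<in> extensional (carrier B) \<and>
      (\<forall>a\<in>carrier A. v (f a) = g a) \<and> (\<forall>b\<in>carrier B. N +>\<^bsub>C\<^esub> v b = u b)"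
  have replica: "\<exists>(D :: ('a + 'b) list ring) \<phi>. cring D \<and> \<phi> \<in> ring_hom D C \<and>
      inj_on \<phi> (carrier D) \<and> g ` carrier A \<union> s ` carrier B \<union> t ` carrier B \<subseteq> \<phi> ` carrier D"
    if "s \<in> carrier B \<rightarrow> carrier C" "t \<in> carrier B \<rightarrow> carrier C" for s t
  proof -
    define h where "h i z = (case z of Inl a \<Rightarrow> g a | Inr b \<Rightarrow> if i then s b else t b)"
      for i :: bool and z :: "'a + 'b"
    have "g a = h True (Inl a)" "s b = h True (Inr b)" "t b = h False (Inr b)" for a b
      by (simp_all add: h_def)
    then have "g ` carrier A \<union> s ` carrier B \<union> t ` carrier B \<subseteq> {y. \<exists>i z. y = h i z}" by blast
    moreover have "g ` carrier A \<union> s ` carrier B \<union> t ` carrier B \<subseteq> carrier C"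
      using that ring_hom_closed[OF g] by auto
    ultimately show ?thesis using subring_replica[OF assms(4)] by blast
  qed
  have lift: "unique_lifting A B f D" if "cring D" for D :: "('a + 'b) list ring"
    using assms(1) that by (simp add: formally_etale_def)
  note descend = unique_lifting_descend[OF assms(4) _ assms(2,3) _ _ lift f N N2 g u gu]
  have ex: "\<exists>v. ?P v"
  proof -
    have "\<forall>b\<in>carrier B. \<exists>c\<in>carrier C. u b = N +>\<^bsub>C\<^esub> c"
      using ring_hom_closed[OF u] by (auto simp: FactRing_def A_RCOSETS_def')
    then obtain s where s: "\<And>b. b \<in> carrier B \<Longrightarrow> s b \<in> carrier C \<and> N +>\<^bsub>C\<^esub> s b = u b"
      by metis
    have ss: "s \<in> carrier B \<rightarrow> carrier C" using s by simp
    obtain D :: "('a + 'b) list ring" and \<phi> where D\<phi>: "cring D \<and> \<phi> \<in> ring_hom D C \<and>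
        inj_on \<phi> (carrier D) \<and> g ` carrier A \<union> s ` carrier B \<union> s ` carrier B \<subseteq> \<phi> ` carrier D"
      using replica[OF ss ss] by (elim exE) (rule that)
    then have D: "cring D" "\<phi> \<in> ring_hom D C" "inj_on \<phi> (carrier D)"
      and sub: "g ` carrier A \<subseteq> \<phi> ` carrier D" "s ` carrier B \<subseteq> \<phi> ` carrier D"
      unfolding Un_subset_iff by blast+
    have "\<forall>b\<in>carrier B. \<exists>d\<in>carrier D. N +>\<^bsub>C\<^esub> \<phi> d = u b"
    proof
      fix b assume b: "b \<in> carrier B"
      then obtain d where "d \<in> carrier D" "s b = \<phi> d" using sub(2) by blast
      with s[OF b] show "\<exists>d\<in>carrier D. N +>\<^bsub>C\<^esub> \<phi> d = u b" by metis
    qed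
    from descend[OF D(1,2,3,1) sub(1) this]
    obtain v where v: "v \<in> ring_hom B D" "\<forall>a\<in>carrier A. \<phi> (v (f a)) = g a"
      "\<forall>b\<in>carrier B. N +>\<^bsub>C\<^esub> \<phi> (v b) = u b" by blast
    have "?P (restrict (\<phi> \<circ> v) (carrier B))"
      using v ring_hom_closed[OF f] ring_hom_trans[OF v(1) D(2)]
      by (auto simp: ring_hom_def)
    then show ?thesis by blast
  qed
  moreover have "v = w" if v: "?P v" and w: "?P w" for v w
  proof -
    have vw: "v \<in> carrier B \<rightarrow> carrier C" "w \<in> carrier B \<rightarrow> carrier C"
      using ring_hom_closed[OF conjunct1[OF v]] ring_hom_closed[OF conjunct1[OF w]] by simp_all
    obtain D :: "('a + 'b) list ring" and \<phi> where D\<phi>: "cring D \<and> \<phi> \<in> ring_hom D C \<and>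
        inj_on \<phi> (carrier D) \<and> g ` carrier A \<union> v ` carrier B \<union> w ` carrier B \<subseteq> \<phi> ` carrier D"
      using replica[OF vw] by (elim exE) (rule that)
    then have D: "cring D" "\<phi> \<in> ring_hom D C" "inj_on \<phi> (carrier D)"
      and sub: "g ` carrier A \<subseteq> \<phi> ` carrier D" "v ` carrier B \<subseteq> \<phi> ` carrier D"
        "w ` carrier B \<subseteq> \<phi> ` carrier D"
      unfolding Un_subset_iff by blast+
    interpret D: cring D by fact
    define pull where "pull x = restrict (\<lambda>b. inv_into (carrier D) \<phi> (x b)) (carrier B)" for x :: "'b \<Rightarrow> 'c"
    have pull: "pull x b \<in> carrier D" "\<phi> (pull x b) = x b"
      if "x ` carrier B \<subseteq> \<phi> ` carrier D" "b \<in> carrier B" for x b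
      using that by (auto simp: pull_def inv_into_into f_inv_into_f image_subset_iff)
    have pull_hom: "pull x \<in> ring_hom B D" if "?P x" "x ` carrier B \<subseteq> \<phi> ` carrier D" for x
    proof -
      have x: "x \<in> ring_hom B C" using that by blast
      show ?thesis
        by (rule ring_hom_memI)
          (auto intro!: inj_onD[OF D(3)] simp: pull that(2) ring_hom_mult[OF D(2)]
            ring_hom_add[OF D(2)] ring_hom_one[OF D(2)]
            ring_hom_mult[OF x] ring_hom_add[OF x] ring_hom_one[OF x])
    qed
    have "\<forall>b\<in>carrier B. \<exists>d\<in>carrier D. N +>\<^bsub>C\<^esub> \<phi> d = u b"
      using pull[OF sub(2)] v by metis
    note uniq = descend[OF D(1,2,3,1) sub(1) this]
    have pull_sol: "pull x \<in> ring_hom B D \<and> pull x \<in> extensional (carrier B) \<and>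
        (\<forall>a\<in>carrier A. \<phi> (pull x (f a)) = g a) \<and> (\<forall>b\<in>carrier B. N +>\<^bsub>C\<^esub> \<phi> (pull x b) = u b)"
      if x: "?P x" "x ` carrier B \<subseteq> \<phi> ` carrier D" for x
    proof (intro conjI)
      show "pull x \<in> ring_hom B D" using x by (rule pull_hom)
      show "pull x \<in> extensional (carrier B)" by (simp add: pull_def)
      show "\<forall>a\<in>carrier A. \<phi> (pull x (f a)) = g a"
        using x(1) by (simp add: pull(2)[OF x(2)] ring_hom_closed[OF f])
      show "\<forall>b\<in>carrier B. N +>\<^bsub>C\<^esub> \<phi> (pull x b) = u b"
        using x(1) by (simp add: pull(2)[OF x(2)])
    qed
    have "pull v = pull w"
      using uniq pull_sol[OF v sub(2)] pull_sol[OF w sub(3)] by (elim ex1E) (metis (no_types, lifting))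
    then have "v b = w b" if "b \<in> carrier B" for b
      using pull(2)[OF sub(2) that] pull(2)[OF sub(3) that] by simp
    then show ?thesis
      using v w by (intro extensionalityI[of v "carrier B" w]) auto
  qed
  ultimately show "\<exists>!v. ?P v" by blast
qed

end

theory Submission
  imports Defs
begin

text \<open>
  A \<open>p\<close>-basis \<open>A\<close> of the field \<open>k\<close> together with the \<open>p\<close>-basis \<open>B\<close> of \<open>R\<close> over \<open>k\<close> is an absolute
  \<open>p\<close>-basis \<open>G = A \<union> B\<close>: the monomials in \<open>G\<close> with exponents below \<open>p\<close> form a basis of \<open>R\<close> over
  \<open>R\<^sup>p\<close>.  This needs the monomials in \<open>A\<close> to stay independent over \<open>R\<^sup>p\<close>.  They are independent
  over \<open>K\<^sup>p\<close>, because the derivations \<open>\<partial>/\<partial>a\<close> of \<open>k\<close> extend to the formally etale \<open>K\<close>;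
  and since a regular system of parameters is a regular sequence with prime partial quotients,
  independence climbs from \<open>R/(I, x)\<close> to \<open>R/I\<close> by dividing a relation by \<open>x\<^sup>p\<close> and applying Nakayama.

  Given an absolute \<open>p\<close>-basis, a homomorphism on \<open>R\<^sup>q\<close> (\<open>q\<close> a power of \<open>p\<close>) extends uniquely to \<open>R\<close>
  once compatible values on \<open>G\<close> are chosen.  For a derivation \<open>\<delta>\<close> and \<open>n \<le> q\<close> one has
  \<open>(g + \<delta>(g) t)\<^sup>q = g\<^sup>q\<close> modulo \<open>t\<^sup>n\<close>, so there is a homomorphism \<open>R \<rightarrow> R[t]/t\<^sup>n\<close> with
  \<open>g \<mapsto> g + \<delta>(g) t\<close> that is constant on \<open>R\<^sup>q\<close>.  By uniqueness these are compatible for varying \<open>n\<close>,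
  \<open>k\<close>-linear, and congruent to \<open>r + \<delta>(r) t\<close> modulo \<open>t\<^sup>2\<close>; their coefficients integrate \<open>\<delta>\<close>.
\<close>

section \<open>Krull's principal ideal theorem\<close>

text \<open>The obstacle is the field \<open>k\<close>. Repeating the relative step from
  \<open>R^p[k]\<close> to \<open>R^(p^2)[k]\<close> would already require \<open>R^p\<close> and
  \<open>k\<close> to be linearly disjoint over \<open>k^p\<close>. The absolute basis asks for this
  disjointness just once; afterwards a homomorphism has to be prescribed on \<open>R^q\<close> and
  \<open>G\<close> alone, and it is constant on \<open>k\<close> because \<open>\<delta>\<close>
  vanishes on \<open>A\<close>. Formal etaleness speaks of the residue field only, so regularity
  must carry the disjointness up to \<open>R\<close>. Regularity is given as an equality of numbers,
  generators of \<open>m\<close> against dimension; Krull's principal ideal theorem turns it into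
  primality of the partial quotients.

  The rings \<open>R^q\<close>, the localizations and the partial quotients are never formed. A
  homomorphism on \<open>R^q\<close> is a map \<open>h\<close> on \<open>R\<close> standing for
  \<open>r^q \<mapsto> h r\<close>, elements of \<open>R^p\<close> are carried by their
  \<open>p\<close>-th roots, and localization at \<open>Q\<close> is replaced by the closure
  operator \<open>sat Q\<close>. The exponent \<open>q\<close> depends on \<open>n\<close>, so only
  finite truncations occur.\<close>

context cring
begin

lemma ideal_of_closed:
  assumes "I \<subseteq> carrier R" "\<zero> \<in> I" "\<And>x y. x \<in> I \<Longrightarrow> y \<in> I \<Longrightarrow> x \<oplus> y \<in> I"
    and mult: "\<And>r x. r \<in> carrier R \<Longrightarrow> x \<in> I \<Longrightarrow> r \<otimes> x \<in> I"
  shows "ideal I R"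
proof (rule idealI[OF ring_axioms])
  show "subgroup I (add_monoid R)"
  proof (rule add.subgroupI)
    fix a assume a: "a \<in> I"
    have "(\<ominus> \<one>) \<otimes> a \<in> I" using a by (intro mult) auto
    then show "\<ominus> a \<in> I" using a assms(1) by (simp add: l_minus subset_iff)
  qed (use assms in auto)
next
  fix a x assume a: "a \<in> I" and x: "x \<in> carrier R"
  show "x \<otimes> a \<in> I" by (rule mult[OF x a])
  moreover have "a \<in> carrier R" using a assms(1) by blast
  ultimately show "a \<otimes> x \<in> I" using x by (simp add: m_comm)
qed

lemma ideal_simps:
  assumes "ideal I R"
  shows "x \<in> I \<Longrightarrow> x \<in> carrier R" "\<zero> \<in> I" "x \<in> I \<Longrightarrow> y \<in> I \<Longrightarrow> x \<oplus> y \<in> I"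
    "x \<in> I \<Longrightarrow> \<ominus> x \<in> I" "x \<in> I \<Longrightarrow> y \<in> I \<Longrightarrow> x \<ominus> y \<in> I"
    "r \<in> carrier R \<Longrightarrow> x \<in> I \<Longrightarrow> r \<otimes> x \<in> I" "r \<in> carrier R \<Longrightarrow> x \<in> I \<Longrightarrow> x \<otimes> r \<in> I"
proof -
  interpret ideal I R by fact
  show "x \<in> I \<Longrightarrow> x \<in> carrier R" "\<zero> \<in> I" "x \<in> I \<Longrightarrow> y \<in> I \<Longrightarrow> x \<oplus> y \<in> I"
    "x \<in> I \<Longrightarrow> \<ominus> x \<in> I" "x \<in> I \<Longrightarrow> y \<in> I \<Longrightarrow> x \<ominus> y \<in> I"
    "r \<in> carrier R \<Longrightarrow> x \<in> I \<Longrightarrow> r \<otimes> x \<in> I" "r \<in> carrier R \<Longrightarrow> x \<in> I \<Longrightarrow> x \<otimes> r \<in> I"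
    using I_l_closed I_r_closed by (auto simp: minus_eq)
qed

lemma ideal_cancel_add:
  assumes "ideal I R" "x \<oplus> y \<in> I" "x \<in> carrier R" "y \<in> I"
  shows "x \<in> I"
proof -
  have "(x \<oplus> y) \<ominus> y \<in> I" using assms by (intro ideal_simps(5)) auto
  moreover have "(x \<oplus> y) \<ominus> y = x" using assms(3) ideal_simps(1)[OF assms(1,4)] by algebra
  ultimately show ?thesis by simp
qed

text \<open>The ideal \<open>I + (a)\<close>, written out so that membership hands over the
  coefficient of \<open>a\<close>. It takes the place of the quotient ring
  \<open>R/(I, a)\<close>.\<close>

definition adjoin :: "'a set \<Rightarrow> 'a \<Rightarrow> 'a set" where
  "adjoin I a = {i \<oplus> r \<otimes> a | i r. i \<in> I \<and> r \<in> carrier R}"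

lemma adjoinI: "i \<in> I \<Longrightarrow> r \<in> carrier R \<Longrightarrow> i \<oplus> r \<otimes> a \<in> adjoin I a"
  by (auto simp: adjoin_def)

lemma adjoinE:
  assumes "x \<in> adjoin I a"
  obtains i r where "x = i \<oplus> r \<otimes> a" "i \<in> I" "r \<in> carrier R"
  using assms by (auto simp: adjoin_def)

lemma adjoin_mono: "I \<subseteq> J \<Longrightarrow> adjoin I a \<subseteq> adjoin J a"
  unfolding adjoin_def by blast

lemma adjoin_ideal:
  assumes I: "ideal I R" and a: "a \<in> carrier R"
  shows "ideal (adjoin I a) R"
proof (rule ideal_of_closed)
  show "adjoin I a \<subseteq> carrier R" using a ideal_simps(1)[OF I] by (auto elim!: adjoinE)
  show "\<zero> \<in> adjoin I a"
    using adjoinI[OF ideal_simps(2)[OF I], of \<zero> a] a by simp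
next
  fix x y assume "x \<in> adjoin I a" "y \<in> adjoin I a"
  then obtain i r j s where *: "x = i \<oplus> r \<otimes> a" "i \<in> I" "r \<in> carrier R"
    "y = j \<oplus> s \<otimes> a" "j \<in> I" "s \<in> carrier R" by (auto elim!: adjoinE)
  then have "x \<oplus> y = (i \<oplus> j) \<oplus> (r \<oplus> s) \<otimes> a"
    using a ideal_simps(1)[OF I, of i] ideal_simps(1)[OF I, of j] by algebra
  then show "x \<oplus> y \<in> adjoin I a" using * adjoinI ideal_simps(3)[OF I] by simp
next
  fix t x assume t: "t \<in> carrier R" and "x \<in> adjoin I a"
  then obtain i r where *: "x = i \<oplus> r \<otimes> a" "i \<in> I" "r \<in> carrier R" by (auto elim!: adjoinE)
  then have "t \<otimes> x = t \<otimes> i \<oplus> (t \<otimes> r) \<otimes> a"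
    using a t ideal_simps(1)[OF I, of i] by algebra
  then show "t \<otimes> x \<in> adjoin I a" using * t adjoinI ideal_simps(6)[OF I] by simp
qed

lemma adjoin_incl:
  assumes I: "ideal I R" and a: "a \<in> carrier R"
  shows "I \<subseteq> adjoin I a" "a \<in> adjoin I a"
proof -
  show "I \<subseteq> adjoin I a"
    using adjoinI[of _ I \<zero> a] ideal_simps(1)[OF I] a by fastforce
  show "a \<in> adjoin I a"
    using adjoinI[OF ideal_simps(2)[OF I], of \<one> a] a by simp
qed

lemma adjoin_minimal:
  assumes "ideal J R" "I \<subseteq> J" "a \<in> J"
  shows "adjoin I a \<subseteq> J"
  using ideal_simps(3,6)[OF assms(1)] assms(2,3) by (auto elim!: adjoinE)

text \<open>The contraction to \<open>R\<close> of the extension of \<open>I\<close> to the localization at \<open>Q\<close>.\<close>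

definition sat :: "'a set \<Rightarrow> 'a set \<Rightarrow> 'a set" where
  "sat Q I = {a \<in> carrier R. \<exists>s\<in>carrier R - Q. s \<otimes> a \<in> I}"

lemma satI: "a \<in> carrier R \<Longrightarrow> s \<in> carrier R \<Longrightarrow> s \<notin> Q \<Longrightarrow> s \<otimes> a \<in> I \<Longrightarrow> a \<in> sat Q I"
  by (auto simp: sat_def)

lemma satE:
  assumes "a \<in> sat Q I"
  obtains s where "a \<in> carrier R" "s \<in> carrier R" "s \<notin> Q" "s \<otimes> a \<in> I"
  using assms by (auto simp: sat_def)

lemma sat_mono: "I \<subseteq> J \<Longrightarrow> sat Q I \<subseteq> sat Q J"
  by (auto simp: sat_def)

context
  fixes Q assumes Q: "primeideal Q R"
begin

lemma prime_mult_notin: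
  "s \<in> carrier R \<Longrightarrow> t \<in> carrier R \<Longrightarrow> s \<notin> Q \<Longrightarrow> t \<notin> Q \<Longrightarrow> s \<otimes> t \<notin> Q"
  using primeideal.I_prime[OF Q] by blast

lemma prime_one_notin: "\<one> \<notin> Q"
  using primeideal.I_notcarr[OF Q] ideal.one_imp_carrier[OF primeideal.axioms(1)[OF Q]] by blast

lemma sat_incl: "I \<subseteq> carrier R \<Longrightarrow> I \<subseteq> sat Q I"
  by (auto intro!: satI[of _ \<one>] prime_one_notin)

lemma sat_sat: "I \<subseteq> carrier R \<Longrightarrow> sat Q (sat Q I) = sat Q I"
proof
  show "sat Q (sat Q I) \<subseteq> sat Q I"
  proof
    fix a assume "a \<in> sat Q (sat Q I)"
    then obtain s t where "a \<in> carrier R" "s \<in> carrier R" "s \<notin> Q" "t \<in> carrier R" "t \<notin> Q"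
      "t \<otimes> (s \<otimes> a) \<in> I" by (auto elim!: satE)
    then show "a \<in> sat Q I"
      using prime_mult_notin by (intro satI[of a "t \<otimes> s"]) (auto simp: m_assoc)
  qed
  show "I \<subseteq> carrier R \<Longrightarrow> sat Q I \<subseteq> sat Q (sat Q I)" by (intro sat_mono sat_incl)
qed

lemma sat_ideal:
  assumes I: "ideal I R"
  shows "ideal (sat Q I) R"
proof (rule ideal_of_closed)
  show "sat Q I \<subseteq> carrier R" by (auto simp: sat_def)
  have "I \<subseteq> carrier R" using ideal_simps(1)[OF I] by blast
  then show "\<zero> \<in> sat Q I" using sat_incl ideal_simps(2)[OF I] by blast
next
  fix x y assume "x \<in> sat Q I" "y \<in> sat Q I"
  then obtain s t where *: "x \<in> carrier R" "y \<in> carrier R" "s \<in> carrier R" "s \<notin> Q"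
    "t \<in> carrier R" "t \<notin> Q" "s \<otimes> x \<in> I" "t \<otimes> y \<in> I" by (auto elim!: satE)
  have "(s \<otimes> t) \<otimes> (x \<oplus> y) = t \<otimes> (s \<otimes> x) \<oplus> s \<otimes> (t \<otimes> y)" using * by algebra
  then show "x \<oplus> y \<in> sat Q I"
    using * prime_mult_notin ideal_simps(3,6)[OF I] by (intro satI[of _ "s \<otimes> t"]) auto
next
  fix r x assume r: "r \<in> carrier R" and "x \<in> sat Q I"
  then obtain s where *: "x \<in> carrier R" "s \<in> carrier R" "s \<notin> Q" "s \<otimes> x \<in> I"
    by (auto elim!: satE)
  have "s \<otimes> (r \<otimes> x) = r \<otimes> (s \<otimes> x)" using * r by algebra
  then show "r \<otimes> x \<in> sat Q I"
    using * r ideal_simps(6)[OF I] by (intro satI[of _ s]) auto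
qed

lemma sat_subset_iff:
  assumes "ideal I R" "ideal J R"
  shows "I \<subseteq> sat Q J \<longleftrightarrow> sat Q I \<subseteq> sat Q J"
  using sat_mono[of I "sat Q J" Q] sat_sat[of J] sat_incl[of I] ideal_simps(1)[OF assms(1)]
    ideal_simps(1)[OF assms(2)] by blast

text \<open>Nakayama at \<open>Q\<close> without localizing. Generators of \<open>M\<close> are
  discarded one at a time: the hypothesis for \<open>g\<close> becomes
  \<open>(ts - xr) g \<in> ?J\<close>, and \<open>ts - xr\<close> lies outside \<open>Q\<close>
  because \<open>x \<in> Q\<close>, so \<open>g\<close> is already in the saturation of the
  remaining ones.\<close>

lemma Nakayama_sat_aux:
  assumes N: "ideal N R" and M: "ideal M R" and x: "x \<in> Q"
    and NM: "\<And>a. a \<in> M \<Longrightarrow> \<exists>s\<in>carrier R - Q. \<exists>n\<in>N. \<exists>b\<in>M. s \<otimes> a = n \<oplus> x \<otimes> b"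
  shows "finite G \<Longrightarrow> G \<subseteq> M \<Longrightarrow> M \<subseteq> sat Q (Idl (N \<union> G)) \<Longrightarrow> M \<subseteq> sat Q N"
proof (induction G rule: finite_induct)
  case empty
  have "Idl N \<subseteq> N" using genideal_minimal[OF N] by blast
  then show ?case using empty sat_mono[of "Idl N" N Q] by auto
next
  case (insert g G)
  have xR: "x \<in> carrier R" using x ideal_simps(1)[OF primeideal.axioms(1)[OF Q]] by blast
  let ?J = "Idl (N \<union> G)"
  have "N \<union> G \<subseteq> carrier R" using insert ideal_simps(1)[OF M] ideal_simps(1)[OF N] by blast
  then have J: "ideal ?J R" and J': "N \<union> G \<subseteq> ?J"
    by (rule genideal_ideal, rule genideal_self)
  have gM: "g \<in> M" and g: "g \<in> carrier R" using insert ideal_simps(1)[OF M] by auto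
  have sub: "Idl (N \<union> insert g G) \<subseteq> adjoin ?J g"
    using adjoin_incl[OF J g] J' by (intro genideal_minimal adjoin_ideal J g) auto
  obtain s n b where s: "s \<in> carrier R" "s \<notin> Q" "n \<in> N" "b \<in> M" "s \<otimes> g = n \<oplus> x \<otimes> b"
    using NM[OF gM] by blast
  have "b \<in> sat Q (adjoin ?J g)" using insert.prems(2) s(4) sat_mono[OF sub, of Q] by blast
  then obtain t i r where t: "t \<in> carrier R" "t \<notin> Q" "t \<otimes> b = i \<oplus> r \<otimes> g" "i \<in> ?J" "r \<in> carrier R"
    by (auto elim!: satE adjoinE)
  have c: "n \<in> carrier R" "b \<in> carrier R" "i \<in> carrier R"
    using s t ideal_simps(1)[OF N] ideal_simps(1)[OF M] ideal_simps(1)[OF J] by auto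
  have "(t \<otimes> s \<ominus> x \<otimes> r) \<otimes> g = t \<otimes> (s \<otimes> g) \<ominus> x \<otimes> (r \<otimes> g)"
    using s(1) t(1,5) g xR by algebra
  also have "\<dots> = t \<otimes> n \<oplus> x \<otimes> (t \<otimes> b) \<ominus> x \<otimes> (r \<otimes> g)"
    unfolding s(5) using t(1) c xR by algebra
  also have "\<dots> = t \<otimes> n \<oplus> x \<otimes> i"
    unfolding t(3) using t(1,5) c xR g by algebra
  finally have eq: "(t \<otimes> s \<ominus> x \<otimes> r) \<otimes> g = t \<otimes> n \<oplus> x \<otimes> i" .
  have "t \<otimes> s \<ominus> x \<otimes> r \<notin> Q"
  proof
    assume "t \<otimes> s \<ominus> x \<otimes> r \<in> Q"
    then have "(t \<otimes> s \<ominus> x \<otimes> r) \<oplus> r \<otimes> x \<in> Q"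
      using x t(5) ideal_simps(3,6)[OF primeideal.axioms(1)[OF Q]] by blast
    moreover have "(t \<otimes> s \<ominus> x \<otimes> r) \<oplus> r \<otimes> x = t \<otimes> s" using t s xR by algebra
    ultimately show False using prime_mult_notin s t by simp
  qed
  moreover have "t \<otimes> n \<oplus> x \<otimes> i \<in> ?J"
    using ideal_simps[OF J] t s J' xR by auto
  ultimately have "g \<in> sat Q ?J"
    using eq s t g xR by (intro satI[of g "t \<otimes> s \<ominus> x \<otimes> r"]) auto
  then have "adjoin ?J g \<subseteq> sat Q ?J"
    using sat_incl[of ?J] ideal_simps(1)[OF J] by (intro adjoin_minimal sat_ideal J) auto
  then have "M \<subseteq> sat Q (sat Q ?J)"
    using insert.prems(2) sub sat_mono by blast
  moreover have "sat Q (sat Q ?J) = sat Q ?J"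
    by (rule sat_sat) (use ideal_simps(1)[OF J] in blast)
  ultimately show ?case using insert.IH insert.prems(1) by simp
qed

end

end

lemma (in noetherian_ring) maximal_ideal_in_family:
  assumes "F \<noteq> {}" "\<And>I. I \<in> F \<Longrightarrow> ideal I R"
  obtains I where "I \<in> F" "\<And>J. J \<in> F \<Longrightarrow> I \<subseteq> J \<Longrightarrow> J = I"
proof -
  have "\<exists>M\<in>F. \<forall>Y\<in>F. M \<subseteq> Y \<longrightarrow> Y = M"
  proof (rule subset_Zorn_nonempty[OF assms(1)])
    fix C assume C: "C \<noteq> {}" "subset.chain F C"
    then have "subset.chain {I. ideal I R} C" using assms(2) by (auto simp: pred_on.chain_def)
    then have "\<Union>C \<in> C" using ideal_chain_is_trivial[OF C(1)] by blast
    then show "\<Union>C \<in> F" using C(2) by (auto simp: pred_on.chain_def)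
  qed
  then show ?thesis using that by blast
qed

section \<open>Nakayama, descending chains and the height of principal ideals\<close>

locale noetherian_cring = noetherian_ring + cring
begin

lemma Nakayama_sat:
  assumes Q: "primeideal Q R" and N: "ideal N R" and M: "ideal M R" and x: "x \<in> Q"
    and NM: "\<And>a. a \<in> M \<Longrightarrow> \<exists>s\<in>carrier R - Q. \<exists>n\<in>N. \<exists>b\<in>M. s \<otimes> a = n \<oplus> x \<otimes> b"
  shows "M \<subseteq> sat Q N"
proof -
  obtain G where G: "finite G" "G \<subseteq> carrier R" "M = Idl G" using finetely_gen[OF M] by blast
  have "G \<subseteq> M" using G genideal_self by blast
  have "Idl G \<subseteq> Idl (N \<union> G)" using G ideal_simps(1)[OF N] by (intro subset_Idl_subset) auto
  then have "M \<subseteq> sat Q (Idl (N \<union> G))"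
    using sat_incl[OF Q, of "Idl (N \<union> G)"] ideal_simps(1)[OF genideal_ideal, of "N \<union> G"]
      G ideal_simps(1)[OF N] by blast
  from Nakayama_sat_aux[OF Q N M x NM G(1) \<open>G \<subseteq> M\<close> this] show ?thesis by blast
qed

text \<open>
  The localization at \<open>Q\<close> modulo \<open>J0\<close> is Artinian.  For a maximal counterexample \<open>J\<close> in place of
  \<open>J0\<close>, an associated prime \<open>(J : a)\<close> contains \<open>J0\<close> and hence is \<open>Q\<close> by minimality, so \<open>J + (a)\<close>
  is larger than \<open>J\<close> by a simple module.
\<close>

lemma descending_chain_stabilizes:
  assumes Q: "primeideal Q R" and J0: "ideal J0 R"
    and minimal: "\<And>P. primeideal P R \<Longrightarrow> J0 \<subseteq> P \<Longrightarrow> P \<subseteq> Q \<Longrightarrow> P = Q"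
    and I: "\<And>n. ideal (I n) R" "\<And>n. J0 \<subseteq> I n" "\<And>n. I (Suc n) \<subseteq> I n"
  shows "\<exists>n0. \<forall>n\<ge>n0. I n0 \<subseteq> sat Q (I n)"
proof (rule ccontr)
  assume contra: "\<not> ?thesis"
  define bad where "bad J \<longleftrightarrow> (\<exists>I. (\<forall>n. ideal (I n) R \<and> J \<subseteq> I n \<and> I (Suc n) \<subseteq> I n) \<and>
     \<not> (\<exists>n0. \<forall>n\<ge>n0. I n0 \<subseteq> sat Q (I n)))" for J
  have "bad J0" unfolding bad_def using I contra by (intro exI[of _ I]) blast
  then have ne: "{J. ideal J R \<and> J0 \<subseteq> J \<and> bad J} \<noteq> {}" using J0 by blast
  obtain J where "J \<in> {J. ideal J R \<and> J0 \<subseteq> J \<and> bad J}"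
    and JM: "\<And>J'. J' \<in> {J. ideal J R \<and> J0 \<subseteq> J \<and> bad J} \<Longrightarrow> J \<subseteq> J' \<Longrightarrow> J' = J"
    by (rule maximal_ideal_in_family[OF ne]) simp_all
  then have J: "ideal J R" "J0 \<subseteq> J" "bad J" by simp_all
  have Jmax: "J' = J" if "ideal J' R" "J0 \<subseteq> J'" "bad J'" "J \<subseteq> J'" for J'
    by (rule JM) (use that in simp_all)
  obtain I where I0: "\<forall>n. ideal (I n) R \<and> J \<subseteq> I n \<and> I (Suc n) \<subseteq> I n"
    and Ibad: "\<not> (\<exists>n0. \<forall>n\<ge>n0. I n0 \<subseteq> sat Q (I n))"
    using J(3) unfolding bad_def by (elim exE conjE) (rule that)
  have I: "ideal (I n) R" "J \<subseteq> I n" "I (Suc n) \<subseteq> I n" for n using I0 by blast+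
  have Jc: "J \<subseteq> carrier R" and Ic: "I n \<subseteq> carrier R" for n
    using ideal_simps(1)[OF J(1)] ideal_simps(1)[OF I(1)] by blast+
  have decr: "I n \<subseteq> I m" if "m \<le> n" for m n using lift_Suc_antimono_le[of I, OF I(3) that] .
  \<comment> \<open>Saturating a bad chain over \<open>J\<close> gives a bad chain over
    \<open>sat Q J\<close>, so maximality makes \<open>J\<close> saturated. This is what later puts
    \<open>col a\<close> inside \<open>Q\<close>.\<close>
  have Jsat: "sat Q J = J"
  proof (rule Jmax)
    show "ideal (sat Q J) R" by (rule sat_ideal[OF Q J(1)])
    show "J0 \<subseteq> sat Q J" "J \<subseteq> sat Q J" using J(2) sat_incl[OF Q Jc] by blast+
    have "\<not> (\<exists>n0. \<forall>n\<ge>n0. sat Q (I n0) \<subseteq> sat Q (sat Q (I n)))"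
      using Ibad sat_subset_iff[OF Q I(1) I(1)] sat_sat[OF Q Ic] by simp
    then show "bad (sat Q J)"
      unfolding bad_def
      using sat_ideal[OF Q I(1)] sat_mono[OF I(2)] sat_mono[OF I(3)]
      by (intro exI[of _ "\<lambda>n. sat Q (I n)"]) auto
  qed
  have "J \<noteq> carrier R"
    using Ibad I(2) Ic sat_incl[OF Q Ic] by blast
  then obtain b0 where b0: "b0 \<in> carrier R" "b0 \<notin> J" using Jc by blast
  define col where "col b = {r \<in> carrier R. r \<otimes> b \<in> J}" for b
  have col_ideal: "ideal (col b) R" if b: "b \<in> carrier R" for b
  proof (rule ideal_of_closed)
    show "\<zero> \<in> col b" using b ideal_simps(2)[OF J(1)] by (simp add: col_def)
  qed (use b ideal_simps[OF J(1)] in \<open>auto simp: col_def l_distr m_assoc\<close>)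
  \<comment> \<open>\<open>col b\<close> is the colon ideal \<open>(J : b)\<close>; a maximal proper
    one exists by noetherianity, and such ideals are prime.\<close>
  obtain a where a: "a \<in> carrier R" "a \<notin> J"
    and amax: "\<And>b. b \<in> carrier R \<Longrightarrow> b \<notin> J \<Longrightarrow> col a \<subseteq> col b \<Longrightarrow> col b = col a"
  proof -
    have "{col b | b. b \<in> carrier R \<and> b \<notin> J} \<noteq> {}" using b0 by blast
    then obtain K where "K \<in> {col b | b. b \<in> carrier R \<and> b \<notin> J}"
      and K: "\<And>L. L \<in> {col b | b. b \<in> carrier R \<and> b \<notin> J} \<Longrightarrow> K \<subseteq> L \<Longrightarrow> L = K"
      by (rule maximal_ideal_in_family) (use col_ideal in auto)
    then obtain a where a: "a \<in> carrier R" "a \<notin> J" "K = col a" by blast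
    show ?thesis by (rule that[OF a(1,2)]) (use K a(3) in blast)
  qed
  have "primeideal (col a) R"
  proof (rule primeidealI)
    show "ideal (col a) R" using a by (intro col_ideal)
    have "\<one> \<notin> col a" using a by (simp add: col_def)
    then show "carrier R \<noteq> col a" using one_closed by blast
    fix r s assume rs: "r \<in> carrier R" "s \<in> carrier R" "r \<otimes> s \<in> col a"
    show "r \<in> col a \<or> s \<in> col a"
    proof (cases "s \<in> col a")
      case False
      then have sa: "s \<otimes> a \<in> carrier R" "s \<otimes> a \<notin> J" using a rs by (auto simp: col_def)
      have "col a \<subseteq> col (s \<otimes> a)"
      proof
        fix t assume "t \<in> col a"
        then have "t \<in> carrier R" "s \<otimes> (t \<otimes> a) \<in> J"
          using rs ideal_simps(6)[OF J(1)] by (auto simp: col_def)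
        then show "t \<in> col (s \<otimes> a)" using a rs by (simp add: col_def m_lcomm)
      qed
      then have "col (s \<otimes> a) = col a" by (rule amax[OF sa])
      moreover have "r \<in> col (s \<otimes> a)" using rs a by (auto simp: col_def m_assoc)
      ultimately show ?thesis by blast
    qed simp
  qed (rule is_cring)
  moreover have "J0 \<subseteq> col a"
    using J(2) Jc a ideal_simps(7)[OF J(1)] by (auto simp: col_def)
  moreover have "col a \<subseteq> Q"
  proof
    fix r assume "r \<in> col a"
    then show "r \<in> Q" using a Jsat satI[of a r Q J] by (auto simp: col_def)
  qed
  ultimately have colQ: "col a = Q" by (rule minimal)
  have adj: "ideal (adjoin J a) R" "J0 \<subseteq> adjoin J a" "J \<subseteq> adjoin J a" "adjoin J a \<noteq> J"
    using adjoin_ideal[OF J(1) a(1)] adjoin_incl[OF J(1) a(1)] a J(2) by blast+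
  then have "\<not> bad (adjoin J a)" using Jmax by blast
  moreover have "bad (adjoin J a)" if "\<not> (\<exists>n1. \<forall>n\<ge>n1. adjoin (I n1) a \<subseteq> sat Q (adjoin (I n) a))"
    unfolding bad_def
  proof (intro exI conjI)
    show "\<forall>n. ideal (adjoin (I n) a) R \<and> adjoin J a \<subseteq> adjoin (I n) a \<and>
        adjoin (I (Suc n)) a \<subseteq> adjoin (I n) a"
      using adjoin_ideal[OF I(1) a(1)] adjoin_mono[OF I(2)] adjoin_mono[OF I(3)] by simp
  qed (rule that)
  ultimately have "\<exists>n1. \<forall>n\<ge>n1. adjoin (I n1) a \<subseteq> sat Q (adjoin (I n) a)" by metis
  then obtain n1 where n1: "\<And>n. n \<ge> n1 \<Longrightarrow> adjoin (I n1) a \<subseteq> sat Q (adjoin (I n) a)"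
    by blast
  \<comment> \<open>Either \<open>a\<close> lies in every \<open>sat Q (I n)\<close> and any index
    serves, or \<open>n2\<close> is an index where it does not.\<close>
  obtain n2 where n2: "a \<in> sat Q (I n2) \<Longrightarrow> (\<forall>n. a \<in> sat Q (I n))"
    by blast
  have "I (max n1 n2) \<subseteq> sat Q (I n)" if n: "n \<ge> max n1 n2" for n
  proof
    fix b assume b: "b \<in> I (max n1 n2)"
    then have bc: "b \<in> carrier R" using Ic by blast
    have "b \<in> adjoin (I n1) a"
      using b decr[of n1 "max n1 n2"] adjoin_incl(1)[OF I(1) a(1)] by auto
    then have "b \<in> sat Q (adjoin (I n) a)" using n1[of n] n by auto
    then obtain s i r where s: "s \<in> carrier R" "s \<notin> Q" "i \<in> I n" "r \<in> carrier R"
      "s \<otimes> b = i \<oplus> r \<otimes> a" by (auto elim!: satE adjoinE)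
    have ic: "i \<in> carrier R" using s Ic by blast
    have "r \<otimes> a \<in> sat Q (I n)"
    \<comment> \<open>The simplicity of \<open>adjoin J a\<close> over \<open>J\<close> at
      \<open>Q\<close>: since \<open>col a = Q\<close>, an \<open>r\<close> in \<open>Q\<close>
      sends \<open>a\<close> into \<open>J\<close>, and any other \<open>r\<close> is a unit at
      \<open>Q\<close>, where the choice of \<open>n2\<close> decides.\<close>
    proof (cases "r \<in> Q")
      case True
      then have "r \<otimes> a \<in> J" using colQ by (auto simp: col_def)
      then show ?thesis using I(2) sat_incl[OF Q Ic] by blast
    next
      case False
      have "i \<in> I n2" using s decr[of n2 n] n by auto
      moreover have "s \<otimes> b \<in> I n2"
        by (rule ideal_simps(6)[OF I(1) s(1)]) (use b decr[of n2 "max n1 n2"] in auto)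
      ultimately have "s \<otimes> b \<ominus> i \<in> I n2" using ideal_simps(5)[OF I(1)] by blast
      moreover have "s \<otimes> b \<ominus> i = r \<otimes> a" unfolding s(5) using s a ic by algebra
      ultimately have "a \<in> sat Q (I n2)" using s a False by (intro satI[of a r]) auto
      then have "a \<in> sat Q (I n)" using n2 by blast
      then show ?thesis using ideal_simps(6)[OF sat_ideal[OF Q I(1)]] s by blast
    qed
    moreover have "i \<in> sat Q (I n)" using s sat_incl[OF Q Ic] by blast
    ultimately have "s \<otimes> b \<in> sat Q (I n)"
      unfolding s(5) using ideal_simps(3)[OF sat_ideal[OF Q I(1)]] by blast
    then have "b \<in> sat Q (sat Q (I n))" using s bc by (intro satI[of b s]) auto
    then show "b \<in> sat Q (I n)" using sat_sat[OF Q Ic] by simp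
  qed
  then show False using Ibad by blast
qed

text \<open>Without such a \<open>P'\<close>, \<open>Q\<close> is minimal over \<open>P0\<close> and
  \<open>x\<close>, so \<open>R/(P0, x)\<close> is Artinian at \<open>Q\<close> and the chain
  \<open>J n\<close> stabilizes modulo \<open>x\<close>. Nakayama removes \<open>x\<close>, and at
  \<open>P\<close> a power of \<open>y\<close> becomes a multiple of the next one modulo
  \<open>P0\<close>, which is absurd for \<open>y \<in> P - P0\<close>.\<close>

theorem principal_ideal_theorem:
  assumes P0: "primeideal P0 R" and P: "primeideal P R" and Q: "primeideal Q R"
    and "P0 \<subset> P" "P \<subset> Q" "x \<in> Q"
  obtains P' where "primeideal P' R" "x \<in> P'" "P0 \<subseteq> P'" "P' \<subset> Q"
proof (cases "x \<in> P")
  case True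
  then show ?thesis using that[of P] assms by blast
next
  case False
  show ?thesis
  proof (rule ccontr)
    assume "\<not> thesis"
    then have none: "\<And>P'. primeideal P' R \<Longrightarrow> x \<in> P' \<Longrightarrow> P0 \<subseteq> P' \<Longrightarrow> P' \<subseteq> Q \<Longrightarrow> P' = Q"
      using that by blast
    note iP0 = primeideal.axioms(1)[OF P0] and iP = primeideal.axioms(1)[OF P]
      and iQ = primeideal.axioms(1)[OF Q]
    have x: "x \<in> carrier R" using assms ideal_simps(1)[OF iQ] by blast
    obtain y where y: "y \<in> P" "y \<notin> P0" using assms by blast
    then have yc: "y \<in> carrier R" using ideal_simps(1)[OF iP] by blast
    \<comment> \<open>Powers of a single \<open>y \<in> P - P0\<close> replace the symbolic powers of \<open>P\<close>.\<close>
    define J where "J n = sat P (adjoin P0 (y [^] (n::nat)))" for n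
    have adjJ: "ideal (adjoin P0 (y [^] n)) R" for n :: nat
      by (rule adjoin_ideal[OF iP0]) (use yc in auto)
    have J: "ideal (J n) R" for n unfolding J_def by (rule sat_ideal[OF P adjJ])
    have Jc: "J n \<subseteq> carrier R" for n using ideal_simps(1)[OF J] by blast
    have Jdec: "J (Suc n) \<subseteq> J n" for n
    proof -
      have "y \<otimes> (y [^] n) \<in> adjoin P0 (y [^] n)"
        using adjoin_incl(2)[OF iP0, of "y [^] n"] yc ideal_simps(6)[OF adjJ] by blast
      then have "adjoin P0 (y [^] Suc n) \<subseteq> adjoin P0 (y [^] n)"
        using yc adjoin_incl(1)[OF iP0, of "y [^] n"]
        by (intro adjoin_minimal adjJ) (auto simp: m_comm)
      then show ?thesis unfolding J_def by (rule sat_mono)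
    qed
    have P0J: "P0 \<subseteq> J n" for n
      unfolding J_def using adjoin_incl(1)[OF iP0, of "y [^] n"] yc
        sat_incl[OF P, of "adjoin P0 (y [^] n)"] ideal_simps(1)[OF adjJ] by blast
    have adjx: "ideal (adjoin P0 x) R" by (rule adjoin_ideal[OF iP0 x])
    have "\<exists>n0. \<forall>n\<ge>n0. adjoin (J n0) x \<subseteq> sat Q (adjoin (J n) x)"
    proof (rule descending_chain_stabilizes[OF Q adjx])
      show "P' = Q" if "primeideal P' R" "adjoin P0 x \<subseteq> P'" "P' \<subseteq> Q" for P'
        using none[OF that(1)] that adjoin_incl[OF iP0 x] by blast
      show "ideal (adjoin (J n) x) R" for n by (rule adjoin_ideal[OF J x])
      show "adjoin P0 x \<subseteq> adjoin (J n) x" "adjoin (J (Suc n)) x \<subseteq> adjoin (J n) x" for n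
        using P0J Jdec unfolding adjoin_def by blast+
    qed
    then obtain n where n: "adjoin (J n) x \<subseteq> sat Q (adjoin (J (Suc n)) x)"
      by (meson le_SucI order_refl)
    have "J n \<subseteq> sat Q (J (Suc n))"
    proof (rule Nakayama_sat[OF Q J J \<open>x \<in> Q\<close>])
      fix a assume a: "a \<in> J n"
      have "a \<in> sat Q (adjoin (J (Suc n)) x)" using n a adjoin_incl(1)[OF J x] by blast
      then obtain s b r where s: "s \<in> carrier R" "s \<notin> Q" "b \<in> J (Suc n)" "r \<in> carrier R"
        "s \<otimes> a = b \<oplus> r \<otimes> x" by (auto elim!: satE adjoinE)
      then have bc: "b \<in> carrier R" using Jc by blast
      have "s \<otimes> a \<ominus> b \<in> J n" using a s Jdec ideal_simps(5,6)[OF J] by blast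
      moreover have "s \<otimes> a \<ominus> b = x \<otimes> r" unfolding s(5) using s x bc by algebra
      \<comment> \<open>Since \<open>x \<notin> P\<close>, it is a unit at \<open>P\<close> and can
        be cancelled against the \<open>P\<close>-saturated ideal \<open>J n\<close>.\<close>
      ultimately have "r \<in> sat P (J n)" using s x False by (intro satI[of r x]) auto
      then have "r \<in> J n"
        unfolding J_def using sat_sat[OF P, of "adjoin P0 (y [^] n)"] ideal_simps(1)[OF adjJ] by auto
      moreover have "s \<otimes> a = b \<oplus> x \<otimes> r" using s x bc by algebra
      ultimately show "\<exists>s\<in>carrier R - Q. \<exists>c\<in>J (Suc n). \<exists>b\<in>J n. s \<otimes> a = c \<oplus> x \<otimes> b"
        using s by blast
    qed
    also have "\<dots> \<subseteq> sat P (J (Suc n))" using assms by (auto simp: sat_def)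
    also have "\<dots> = J (Suc n)"
      unfolding J_def by (rule sat_sat[OF P]) (use ideal_simps(1)[OF adjJ] in blast)
    finally have "J n \<subseteq> J (Suc n)" .
    moreover have "y [^] n \<in> J n"
      unfolding J_def using adjoin_incl(2)[OF iP0, of "y [^] n"] yc
        sat_incl[OF P, of "adjoin P0 (y [^] n)"] ideal_simps(1)[OF adjJ] by blast
    ultimately have "y [^] n \<in> sat P (adjoin P0 (y [^] Suc n))" unfolding J_def by blast
    then obtain s i r where s: "s \<in> carrier R" "s \<notin> P" "i \<in> P0" "r \<in> carrier R"
      "s \<otimes> y [^] n = i \<oplus> r \<otimes> y [^] Suc n"
      by (elim satE adjoinE) (rule that)
    have ic: "i \<in> carrier R" using s ideal_simps(1)[OF iP0] by blast
    have ync: "y [^] n \<in> carrier R" using yc by simp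
    \<comment> \<open>Cancelling \<open>y^n\<close> modulo the prime \<open>P0\<close> leaves
      \<open>s - r y \<in> P0\<close>, and \<open>y \<in> P\<close> then forces
      \<open>s \<in> P\<close>.\<close>
    have "y [^] n \<otimes> (s \<ominus> r \<otimes> y) = s \<otimes> y [^] n \<ominus> r \<otimes> (y [^] n \<otimes> y)"
      using s(1,4) ync yc by algebra
    also have "\<dots> = i"
      unfolding s(5) using s(1,4) ync yc ic by (simp, algebra)
    finally have "y [^] n \<otimes> (s \<ominus> r \<otimes> y) \<in> P0" using s by simp
    moreover have "y [^] n \<notin> P0"
    proof (induction n)
      case 0 show ?case using prime_one_notin[OF P0] by simp
    next
      case (Suc n) then show ?case using prime_mult_notin[OF P0, of "y [^] n" y] y yc by simp
    qed
    ultimately have "s \<ominus> r \<otimes> y \<in> P0"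
      using prime_mult_notin[OF P0, of "y [^] n" "s \<ominus> r \<otimes> y"] s yc by auto
    then have "(s \<ominus> r \<otimes> y) \<oplus> r \<otimes> y \<in> P"
      using assms(4) y s ideal_simps(3,6)[OF iP] by blast
    moreover have "(s \<ominus> r \<otimes> y) \<oplus> r \<otimes> y = s" using s yc by algebra
    ultimately show False using s by simp
  qed
qed

end

section \<open>Regular local rings\<close>

definition prime_chain :: "('a, 'r) ring_scheme \<Rightarrow> nat \<Rightarrow> (nat \<Rightarrow> 'a set) \<Rightarrow> bool" where
  "prime_chain R n P \<longleftrightarrow> (\<forall>i\<le>n. primeideal (P i) R) \<and> (\<forall>i<n. P i \<subset> P (Suc i))"

lemma prime_chain_mono: "prime_chain R n P \<Longrightarrow> i \<le> j \<Longrightarrow> j \<le> n \<Longrightarrow> P i \<subseteq> P j"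
proof (induction j)
  case (Suc j)
  show ?case
  proof (cases "i = Suc j")
    case False
    then have "P i \<subseteq> P j" using Suc by simp
    moreover have "P j \<subset> P (Suc j)" using Suc.prems by (simp add: prime_chain_def)
    ultimately show ?thesis by blast
  qed simp
qed simp

lemma prime_chain_shorter: "prime_chain R n P \<Longrightarrow> m \<le> n \<Longrightarrow> prime_chain R m P"
  by (simp add: prime_chain_def)

lemma prime_chain_snoc:
  "prime_chain R n P \<Longrightarrow> primeideal Q R \<Longrightarrow> P n \<subset> Q \<Longrightarrow> prime_chain R (Suc n) (P(Suc n := Q))"
  by (auto simp: prime_chain_def less_Suc_eq le_Suc_eq)

lemma prime_chain_cons:
  "prime_chain R n P \<Longrightarrow> primeideal Q R \<Longrightarrow> Q \<subset> P 0 \<Longrightarrow>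
    prime_chain R (Suc n) (\<lambda>i. case i of 0 \<Rightarrow> Q | Suc j \<Rightarrow> P j)"
  by (auto simp: prime_chain_def less_Suc_eq_0_disj split: nat.splits)

context noetherian_cring
begin

text \<open>Killing \<open>x\<close> costs at most one prime of the chain. As long as
  \<open>x\<close> is missing from the second prime from the top, that prime is exchanged for one
  containing \<open>x\<close> by the principal ideal theorem, and the exchange is repeated
  downwards.\<close>

lemma prime_chain_through:
  assumes "prime_chain R (Suc n) P" "x \<in> P (Suc n)"
  shows "\<exists>Q. prime_chain R n Q \<and> x \<in> Q 0 \<and> P 0 \<subseteq> Q 0 \<and> Q n = P (Suc n)"
  using assms
proof (induction n arbitrary: P)
  case 0
  then show ?case
    by (intro exI[of _ "\<lambda>_. P 1"]) (auto simp: prime_chain_def)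
next
  case (Suc n)
  have pr: "primeideal (P n) R" "primeideal (P (Suc n)) R" "primeideal (P (Suc (Suc n))) R"
    and lt: "P n \<subset> P (Suc n)" "P (Suc n) \<subset> P (Suc (Suc n))"
    using Suc.prems by (auto simp: prime_chain_def)
  show ?case
  proof (cases "x \<in> P (Suc n)")
    case True
    have ch: "prime_chain R (Suc n) P" using prime_chain_shorter[OF Suc.prems(1), of "Suc n"] by simp
    obtain Q where Q: "prime_chain R n Q" "x \<in> Q 0" "P 0 \<subseteq> Q 0" "Q n = P (Suc n)"
      using Suc.IH[OF ch True] by blast
    have "prime_chain R (Suc n) (Q(Suc n := P (Suc (Suc n))))"
      by (rule prime_chain_snoc[OF Q(1) pr(3)]) (use Q lt in simp)
    moreover have "x \<in> (Q(Suc n := P (Suc (Suc n)))) 0" "P 0 \<subseteq> (Q(Suc n := P (Suc (Suc n)))) 0"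
      "(Q(Suc n := P (Suc (Suc n)))) (Suc n) = P (Suc (Suc n))" using Q by simp_all
    ultimately show ?thesis by blast
  next
    case False
    then have xn: "x \<notin> P n" using lt by blast
    obtain P' where P': "primeideal P' R" "x \<in> P'" "P n \<subseteq> P'" "P' \<subset> P (Suc (Suc n))"
      using principal_ideal_theorem[OF pr lt Suc.prems(2)] by blast
    have "P n \<subset> P'" using P' xn by blast
    then have ch: "prime_chain R (Suc n) (P(Suc n := P'))"
      using prime_chain_snoc[OF prime_chain_shorter[OF Suc.prems(1)], of n P'] P' by simp
    obtain Q where Q: "prime_chain R n Q" "x \<in> Q 0" "P 0 \<subseteq> Q 0" "Q n = P'"
      using Suc.IH[OF ch] P'(2) by auto
    have "prime_chain R (Suc n) (Q(Suc n := P (Suc (Suc n))))"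
      by (rule prime_chain_snoc[OF Q(1) pr(3)]) (use Q P' in simp)
    moreover have "x \<in> (Q(Suc n := P (Suc (Suc n)))) 0" "P 0 \<subseteq> (Q(Suc n := P (Suc (Suc n)))) 0"
      "(Q(Suc n := P (Suc (Suc n)))) (Suc n) = P (Suc (Suc n))" using Q by simp_all
    ultimately show ?thesis by blast
  qed
qed

end

section \<open>Noetherian local rings and systems of parameters\<close>

locale local_noetherian_cring = noetherian_cring +
  fixes m
  assumes maximal: "maximalideal m R" and unique_maximal: "maximalideal J R \<Longrightarrow> J = m"
begin

lemma m_ideal: "ideal m R"
  using maximal maximalideal.axioms(1) by blast

lemma m_prime: "primeideal m R"
  using maximalideal_prime[OF maximal] .

lemma proper_ideal_subset_m:
  assumes "ideal I R" "I \<noteq> carrier R"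
  shows "I \<subseteq> m"
proof -
  have ne: "{J. ideal J R \<and> I \<subseteq> J \<and> J \<noteq> carrier R} \<noteq> {}" using assms by blast
  obtain M where M: "M \<in> {J. ideal J R \<and> I \<subseteq> J \<and> J \<noteq> carrier R}"
    and Mmax: "\<And>J. J \<in> {J. ideal J R \<and> I \<subseteq> J \<and> J \<noteq> carrier R} \<Longrightarrow> M \<subseteq> J \<Longrightarrow> J = M"
    by (rule maximal_ideal_in_family[OF ne]) simp_all
  have "maximalideal M R"
  proof (rule maximalidealI)
    show "ideal M R" "carrier R \<noteq> M" using M by auto
    show "J = M \<or> J = carrier R" if "ideal J R" "M \<subseteq> J" "J \<subseteq> carrier R" for J
      using Mmax[of J] that M by blast
  qed
  then show ?thesis using unique_maximal M by blast
qed

text \<open>Elements outside \<open>m\<close> are units. This turns the statements at a prime, in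
  particular Nakayama, into plain statements about \<open>R\<close>.\<close>

lemma sat_m:
  assumes I: "ideal I R"
  shows "sat m I = I"
proof
  show "I \<subseteq> sat m I" using sat_incl[OF m_prime] ideal_simps(1)[OF I] by blast
  show "sat m I \<subseteq> I"
  proof
    fix a assume "a \<in> sat m I"
    then obtain s where s: "a \<in> carrier R" "s \<in> carrier R" "s \<notin> m" "s \<otimes> a \<in> I" by (auto elim!: satE)
    have "adjoin {\<zero>} s = carrier R"
      using proper_ideal_subset_m[OF adjoin_ideal[OF zeroideal s(2)]] adjoin_incl[OF zeroideal s(2)] s(3)
      by blast
    then obtain r where r: "r \<in> carrier R" "\<one> = \<zero> \<oplus> r \<otimes> s"
      using one_closed by (auto elim!: adjoinE)
    then have "r \<otimes> (s \<otimes> a) = \<one> \<otimes> a" using s by (simp add: m_assoc)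
    then have "r \<otimes> (s \<otimes> a) = a" using s by simp
    then show "a \<in> I" using ideal_simps(6)[OF I r(1) s(4)] by simp
  qed
qed

lemma Nakayama_local:
  assumes N: "ideal N R" and M: "ideal M R" and x: "x \<in> m"
    and NM: "\<And>a. a \<in> M \<Longrightarrow> \<exists>c\<in>N. \<exists>b\<in>M. a = c \<oplus> x \<otimes> b"
  shows "M \<subseteq> N"
proof -
  have "M \<subseteq> sat m N"
  proof (rule Nakayama_sat[OF m_prime N M x])
    fix a assume a: "a \<in> M"
    then have "\<one> \<in> carrier R - m" "\<one> \<otimes> a = a"
      using prime_one_notin[OF m_prime] ideal_simps(1)[OF M a] by auto
    then show "\<exists>s\<in>carrier R - m. \<exists>n\<in>N. \<exists>b\<in>M. s \<otimes> a = n \<oplus> x \<otimes> b"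
      using NM[OF a] by metis
  qed
  then show ?thesis using sat_m[OF N] by simp
qed

lemma prime_subset_m: "primeideal P R \<Longrightarrow> P \<subseteq> m"
  using proper_ideal_subset_m primeideal.axioms(1) primeideal.I_notcarr by metis

lemma Idl_adjoin:
  assumes I: "ideal I R" and T: "T \<subseteq> carrier R" and x: "x \<in> T"
  shows "Idl (adjoin I x \<union> (T - {x})) = Idl (I \<union> T)"
proof -
  have xc: "x \<in> carrier R" using T x by blast
  note aI = adjoin_ideal[OF I xc]
  have c: "I \<union> T \<subseteq> carrier R" "adjoin I x \<union> (T - {x}) \<subseteq> carrier R"
    using T ideal_simps(1)[OF I] ideal_simps(1)[OF aI] by blast+
  show ?thesis
  proof
    show "Idl (adjoin I x \<union> (T - {x})) \<subseteq> Idl (I \<union> T)"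
      using genideal_self[OF c(1)] x
      by (intro genideal_minimal genideal_ideal c Un_least adjoin_minimal) auto
    show "Idl (I \<union> T) \<subseteq> Idl (adjoin I x \<union> (T - {x}))"
      using genideal_self[OF c(2)] adjoin_incl[OF I xc]
      by (intro genideal_minimal genideal_ideal c Un_least) blast+
  qed
qed

text \<open>\<open>P 0\<close> is strictly below \<open>m\<close>, so it misses some generator
  \<open>x\<close>. Replacing the top prime by \<open>m\<close> makes \<open>x\<close> belong to the
  top, after which the chain can be pushed above \<open>x\<close>.\<close>

lemma chain_quotient_step:
  assumes I: "ideal I R" and T: "T \<subseteq> carrier R" and gen: "Idl (I \<union> T) = m"
    and ch: "prime_chain R (Suc n) P" and IP: "I \<subseteq> P 0"
  obtains x Q where "x \<in> T" "x \<in> m" "x \<notin> P 0" "prime_chain R n Q" "adjoin I x \<subseteq> Q 0" "P 0 \<subseteq> Q 0"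
proof -
  have "primeideal (P (Suc n)) R" "P n \<subset> P (Suc n)" and pr0: "primeideal (P 0) R"
    using ch by (simp_all add: prime_chain_def)
  then have Pm: "P n \<subset> m" using prime_subset_m by blast
  then have "P 0 \<subset> m" using prime_chain_mono[OF ch, of 0 n] by auto
  then have "\<not> Idl (I \<union> T) \<subseteq> P 0" using gen by auto
  then have "\<not> I \<union> T \<subseteq> P 0" using genideal_minimal[OF primeideal.axioms(1)[OF pr0]] by blast
  then obtain x where x: "x \<in> T" "x \<notin> P 0" using IP by blast
  have "I \<union> T \<subseteq> carrier R" using T ideal_simps(1)[OF I] by blast
  then have xm: "x \<in> m" using genideal_self x gen by blast
  have "prime_chain R (Suc n) (P(Suc n := m))"
    using prime_chain_snoc[OF prime_chain_shorter[OF ch] m_prime Pm] by simp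
  from prime_chain_through[OF this, of x] xm
  obtain Q where Q: "prime_chain R n Q" "x \<in> Q 0" "P 0 \<subseteq> Q 0" by auto
  moreover have "primeideal (Q 0) R" using Q by (simp add: prime_chain_def)
  then have "adjoin I x \<subseteq> Q 0"
    using IP Q by (intro adjoin_minimal primeideal.axioms(1)) auto
  ultimately show ?thesis using that[of x Q] x xm by blast
qed

text \<open>Krull's height theorem for \<open>R/I\<close>: each generator moved from
  \<open>T\<close> into \<open>I\<close> shortens the chain by one.\<close>

lemma prime_chain_le_generators:
  assumes "ideal I R" "finite T" "T \<subseteq> carrier R" "Idl (I \<union> T) = m" "prime_chain R n P" "I \<subseteq> P 0"
  shows "n \<le> card T"
  using assms
proof (induction n arbitrary: I T P)
  case (Suc n)
  obtain x Q where x: "x \<in> T" "prime_chain R n Q" "adjoin I x \<subseteq> Q 0"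
    by (rule chain_quotient_step[OF Suc.prems(1,3-6)]) (rule that)
  then have xc: "x \<in> carrier R" using Suc by blast
  have "n \<le> card (T - {x})"
    by (rule Suc.IH[OF adjoin_ideal[OF Suc.prems(1) xc]])
      (use Suc.prems x Idl_adjoin[OF Suc.prems(1,3) x(1)] in auto)
  moreover have "card T = Suc (card (T - {x}))" by (rule card.remove) (use x Suc.prems in auto)
  ultimately show ?case by simp
qed simp

text \<open>Here \<open>R/I\<close> is regular local of dimension \<open>n\<close>, with parameters \<open>T\<close>.\<close>

lemma regular_sequence_induct:
  assumes \<Phi>m: "\<Phi> m"
    and step: "\<And>I x. primeideal I R \<Longrightarrow> x \<in> m \<Longrightarrow> x \<notin> I \<Longrightarrow> \<Phi> (adjoin I x) \<Longrightarrow> \<Phi> I"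
  shows "ideal I R \<Longrightarrow> finite T \<Longrightarrow> T \<subseteq> carrier R \<Longrightarrow> Idl (I \<union> T) = m \<Longrightarrow>
    prime_chain R n P \<Longrightarrow> I \<subseteq> P 0 \<Longrightarrow> card T \<le> n \<Longrightarrow> primeideal I R \<and> \<Phi> I"
proof (induction n arbitrary: I T P)
  case 0
  then have "Idl I = m" by simp
  moreover have "Idl I = I"
    using genideal_minimal[OF 0(1) subset_refl] genideal_self ideal_simps(1)[OF 0(1)] by blast
  ultimately show ?case using m_prime \<Phi>m by simp
next
  case (Suc n)
  note I = Suc.prems(1) and T = Suc.prems(2,3)
  obtain x Q where x: "x \<in> T" "x \<in> m" "x \<notin> P 0" and Q: "prime_chain R n Q" "adjoin I x \<subseteq> Q 0" "P 0 \<subseteq> Q 0"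
    using chain_quotient_step[OF I T(2) Suc.prems(4-6)] by blast
  have xc: "x \<in> carrier R" using x T by blast
  let ?I = "adjoin I x" and ?T = "T - {x}"
  have I': "ideal ?I R" by (rule adjoin_ideal[OF I xc])
  have T': "finite ?T" "?T \<subseteq> carrier R" "Idl (?I \<union> ?T) = m" "card ?T \<le> n"
    using T x Idl_adjoin[OF I T(2) x(1)] Suc.prems(4,7) by (auto simp: card_Diff_singleton)
  have pr: "primeideal ?I R" and \<Phi>I: "\<Phi> ?I"
    using Suc.IH[OF I' T'(1-3) Q(1,2) T'(4)] by auto
  have pr0: "primeideal (P 0) R" using Suc.prems by (simp add: prime_chain_def)
  note iP0 = primeideal.axioms(1)[OF pr0]
  \<comment> \<open>Otherwise the prime \<open>?I\<close> could be put below \<open>Q 0\<close>,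
    giving a chain of length \<open>Suc n\<close> over an ideal modulo which \<open>m\<close> has
    only \<open>n\<close> generators.\<close>
  have "?I = Q 0"
  proof (rule ccontr)
    assume "?I \<noteq> Q 0"
    then have "prime_chain R (Suc n) (\<lambda>i. case i of 0 \<Rightarrow> ?I | Suc j \<Rightarrow> Q j)"
      using Q by (intro prime_chain_cons pr) auto
    from prime_chain_le_generators[OF I' T'(1-3) this] T'(4) show False by simp
  qed
  then have "P 0 \<subseteq> ?I" using Q by simp
  \<comment> \<open>An element of \<open>P 0\<close> is \<open>i + r x\<close>, and
    \<open>x \<notin> P 0\<close> forces \<open>r \<in> P 0\<close>. So
    \<open>P 0 = I + x P 0\<close>, and Nakayama identifies \<open>I\<close> with the prime
    \<open>P 0\<close>.\<close>
  have "P 0 \<subseteq> I"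
  proof (rule Nakayama_local[OF I iP0 x(2)])
    fix a assume a: "a \<in> P 0"
    then obtain i r where ir: "a = i \<oplus> r \<otimes> x" "i \<in> I" "r \<in> carrier R"
      using \<open>P 0 \<subseteq> ?I\<close> by (auto elim!: adjoinE)
    have ic: "i \<in> carrier R" using ir ideal_simps(1)[OF I] by blast
    have "r \<otimes> x \<oplus> i \<in> P 0" using a ir ic xc by (simp add: a_comm)
    then have "r \<otimes> x \<in> P 0"
      by (rule ideal_cancel_add[OF iP0]) (use ir xc Suc.prems(6) in blast)+
    then have "r \<in> P 0" using primeideal.I_prime[OF pr0 ir(3) xc] x by blast
    moreover have "a = i \<oplus> x \<otimes> r" using ir xc by (simp add: m_comm)
    ultimately show "\<exists>c\<in>I. \<exists>b\<in>P 0. a = c \<oplus> x \<otimes> b" using ir(2) by blast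
  qed
  then have "P 0 = I" using Suc.prems by blast
  then show ?case using step[of I x] pr0 x \<Phi>I by simp
qed

end

section \<open>The Frobenius endomorphism and truncated power series\<close>

lemma ring_hom_cring_of_hom: "cring R \<Longrightarrow> cring S \<Longrightarrow> h \<in> ring_hom R S \<Longrightarrow> ring_hom_cring R S h"
  by (simp add: ring_hom_cring_def ring_hom_cring_axioms_def)

lemma (in cring) binomial:
  assumes "x \<in> carrier R" "y \<in> carrier R"
  shows "(x \<oplus> y) [^] n = (\<Oplus>i\<in>{..n}. add_pow R (n choose i) (x [^] i \<otimes> y [^] (n - i)))"
proof (induction n)
  case (Suc n)
  define g where "g i = x [^] Suc i \<otimes> y [^] (n - i)" for i
  define h where "h i = x [^] i \<otimes> y [^] (Suc n - i)" for i
  have gh: "h (Suc i) = g i" for i by (simp add: g_def h_def)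
  have gc [simp]: "g i \<in> carrier R" "h i \<in> carrier R" for i using assms by (simp_all add: g_def h_def)
  have "(\<Oplus>i\<in>{..Suc n}. add_pow R (Suc n choose i) (h i)) =
      (\<Oplus>i\<in>{..n}. add_pow R (n choose i) (g i) \<oplus> add_pow R (n choose Suc i) (g i)) \<oplus> h 0"
    by (subst finsum_Suc2) (simp_all add: gh add.nat_pow_mult)
  also have "\<dots> = (\<Oplus>i\<in>{..n}. add_pow R (n choose i) (g i)) \<oplus> ((\<Oplus>i\<in>{..n}. add_pow R (n choose Suc i) (h (Suc i))) \<oplus> add_pow R (n choose 0) (h 0))"
    by (subst finsum_addf) (simp_all add: gh a_assoc)
  also have "(\<Oplus>i\<in>{..n}. add_pow R (n choose Suc i) (h (Suc i))) \<oplus> add_pow R (n choose 0) (h 0)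
      = (\<Oplus>i\<in>{..Suc n}. add_pow R (n choose i) (h i))"
    by (subst finsum_Suc2) simp_all
  also have "\<dots> = (\<Oplus>i\<in>{..n}. add_pow R (n choose i) (h i))"
    by (simp add: finsum_Suc binomial_eq_0)
  also have "(\<Oplus>i\<in>{..n}. add_pow R (n choose i) (g i)) = x \<otimes> (x \<oplus> y) [^] n"
    unfolding Suc.IH
    by (subst finsum_rdistr) (auto intro!: finsum_cong simp: assms g_def add_pow_rdistr m_ac)
  also have "(\<Oplus>i\<in>{..n}. add_pow R (n choose i) (h i)) = y \<otimes> (x \<oplus> y) [^] n"
    unfolding Suc.IH
    by (subst finsum_rdistr) (auto intro!: finsum_cong simp: assms h_def add_pow_rdistr m_ac Suc_diff_le)
  also have "x \<otimes> (x \<oplus> y) [^] n \<oplus> y \<otimes> (x \<oplus> y) [^] n = (x \<oplus> y) [^] Suc n"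
    using assms by (simp add: m_comm l_distr)
  finally show ?case by (simp only: h_def)
qed (use assms in simp)

text \<open>Only \<open>p\<close> times \<open>\<one>\<close> being zero is demanded. This passes
  along every ring homomorphism, even to the zero ring, which occurs as
  \<open>trunc R 0\<close>.\<close>

locale char_p_cring = cring +
  fixes p :: nat
  assumes p: "Factorial_Ring.prime p" and char: "add_pow R p \<one> = \<zero>"
begin

lemma p_ge_2: "p \<ge> 2"
  using p by (rule prime_ge_2_nat)

lemma p_multiple: "x \<in> carrier R \<Longrightarrow> p dvd n \<Longrightarrow> add_pow R n x = \<zero>"
proof -
  assume x: "x \<in> carrier R" and "p dvd n"
  then obtain k where n: "n = p * k" by blast
  have "add_pow R p x = (add_pow R p \<one>) \<otimes> x" using x by (simp add: add_pow_ldistr)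
  also have "\<dots> = \<zero>" using x by (simp add: char)
  finally have "add_pow R k (add_pow R p x) = \<zero>" by simp
  then show "add_pow R n x = \<zero>" using x n by (simp add: add.nat_pow_pow)
qed

lemma frobenius_add:
  assumes x: "x \<in> carrier R" and y: "y \<in> carrier R"
  shows "(x \<oplus> y) [^] p = x [^] p \<oplus> y [^] p"
proof -
  \<comment> \<open>Both end terms are split off the binomial sum; \<open>p\<close> divides every
    coefficient in between.\<close>
  obtain l where l: "p = Suc (Suc l)" using p_ge_2 by (metis Suc_diff_Suc Suc_1 Suc_le_lessD add_2_eq_Suc le_Suc_ex)
  define f where "f i = add_pow R (p choose i) (x [^] i \<otimes> y [^] (p - i))" for i
  have f [simp]: "f i \<in> carrier R" for i using x y by (simp add: f_def)
  have "f (Suc i) = \<zero>" if "i \<le> l" for i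
    unfolding f_def by (intro p_multiple dvd_choose_prime p) (use that x y l in auto)
  then have "(\<Oplus>i\<in>{..l}. f (Suc i)) = \<zero>" by (intro add.finprod_one_eqI) auto
  moreover have "(\<Oplus>i\<in>{..Suc l}. f i) = (\<Oplus>i\<in>{..l}. f (Suc i)) \<oplus> f 0"
    by (rule finsum_Suc2) simp
  moreover have "(\<Oplus>i\<in>{..Suc (Suc l)}. f i) = f (Suc (Suc l)) \<oplus> (\<Oplus>i\<in>{..Suc l}. f i)"
    by (rule finsum_Suc) simp
  ultimately have "(\<Oplus>i\<in>{..p}. f i) = f p \<oplus> f 0" by (simp add: l)
  then show ?thesis using binomial[OF x y, of p] x y by (simp add: f_def)
qed

lemma frobenius_hom: "(\<lambda>x. x [^] p) \<in> ring_hom R R"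
  by (rule ring_hom_memI) (auto simp: frobenius_add nat_pow_distrib)

lemma frobenius_power_hom: "(\<lambda>x. x [^] (p ^ N)) \<in> ring_hom R R"
proof (induction N)
  case 0
  show ?case by (rule ring_hom_memI) auto
next
  case (Suc N)
  show ?case
    by (rule ring_hom_memI)
      (auto simp: nat_pow_distrib frobenius_add ring_hom_add[OF Suc] nat_pow_pow[symmetric] mult.commute[of p])
qed

lemma char_p_target:
  assumes "cring C" "h \<in> ring_hom R C"
  shows "char_p_cring C p"
proof -
  interpret C: cring C by fact
  interpret h: ring_hom_cring R C h using assms by unfold_locales
  have "add_pow C n \<one>\<^bsub>C\<^esub> = h (add_pow R n \<one>)" for n :: nat
    by (induction n) (simp_all add: add.nat_pow_Suc)
  then show ?thesis using p char by unfold_locales simp_all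
qed

end

text \<open>\<open>R[t]/t\<^sup>n\<close>, with elements encoded as coefficient functions that vanish from \<open>n\<close> on; \<open>tlin R n c d\<close> is \<open>c + d t\<close>.\<close>

definition trunc :: "('a, 'r) ring_scheme \<Rightarrow> nat \<Rightarrow> (nat \<Rightarrow> 'a) ring" where
  "trunc R n = \<lparr>carrier = {f. (\<forall>i. f i \<in> carrier R) \<and> (\<forall>i\<ge>n. f i = \<zero>\<^bsub>R\<^esub>)},
     monoid.mult = (\<lambda>f g i. if i < n then \<Oplus>\<^bsub>R\<^esub>j\<in>{..i}. f j \<otimes>\<^bsub>R\<^esub> g (i - j) else \<zero>\<^bsub>R\<^esub>),
     monoid.one = (\<lambda>i. if i = 0 \<and> 0 < n then \<one>\<^bsub>R\<^esub> else \<zero>\<^bsub>R\<^esub>),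
     ring.zero = (\<lambda>_. \<zero>\<^bsub>R\<^esub>),
     ring.add = (\<lambda>f g i. f i \<oplus>\<^bsub>R\<^esub> g i)\<rparr>"

lemma trunc_simps:
  "f \<otimes>\<^bsub>trunc R n\<^esub> g = (\<lambda>i. if i < n then \<Oplus>\<^bsub>R\<^esub>j\<in>{..i}. f j \<otimes>\<^bsub>R\<^esub> g (i - j) else \<zero>\<^bsub>R\<^esub>)"
  "\<one>\<^bsub>trunc R n\<^esub> = (\<lambda>i. if i = 0 \<and> 0 < n then \<one>\<^bsub>R\<^esub> else \<zero>\<^bsub>R\<^esub>)"
  "\<zero>\<^bsub>trunc R n\<^esub> = (\<lambda>_. \<zero>\<^bsub>R\<^esub>)"
  "f \<oplus>\<^bsub>trunc R n\<^esub> g = (\<lambda>i. f i \<oplus>\<^bsub>R\<^esub> g i)"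
  by (simp_all add: trunc_def)

lemma trunc_carrier:
  "f \<in> carrier (trunc R n) \<longleftrightarrow> (\<forall>i. f i \<in> carrier R) \<and> (\<forall>i\<ge>n. f i = \<zero>\<^bsub>R\<^esub>)"
  by (simp add: trunc_def)

definition tlin :: "('a, 'r) ring_scheme \<Rightarrow> nat \<Rightarrow> 'a \<Rightarrow> 'a \<Rightarrow> nat \<Rightarrow> 'a" where
  "tlin R n c d = (\<lambda>i. if i < n then if i = 0 then c else if i = 1 then d else \<zero>\<^bsub>R\<^esub> else \<zero>\<^bsub>R\<^esub>)"

definition trestrict :: "('a, 'r) ring_scheme \<Rightarrow> nat \<Rightarrow> (nat \<Rightarrow> 'a) \<Rightarrow> nat \<Rightarrow> 'a" where
  "trestrict R n f = (\<lambda>i. if i < n then f i else \<zero>\<^bsub>R\<^esub>)"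

section \<open>The ring structure of \<open>R[t]/t^n\<close>\<close>

context cring
begin

text \<open>The ring laws come from the polynomial ring \<open>UP R\<close>: the product is the
  polynomial product cut off at \<open>n\<close>, and associativity holds because cutting off a
  factor beforehand changes no coefficient below \<open>n\<close> (\<open>absorb\<close>).\<close>

lemma trunc_cring: "cring (trunc R n)"
proof -
  have "UP_cring R" by unfold_locales
  then interpret P: cring "UP R" by (rule UP_cring.UP_cring)
  let ?T = "trunc R n" and ?P = "UP R"
  have up: "f \<in> up R" if "f \<in> carrier ?T" for f
  proof (rule mem_upI)
    show "f i \<in> carrier R" for i using that by (simp add: trunc_carrier)
    show "\<exists>n. bound \<zero> n f" using that by (intro exI[of _ n] bound.intro) (simp add: trunc_carrier)
  qed
  have upc: "carrier ?P = up R" by (simp add: UP_def)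
  have UP_mult: "f \<otimes>\<^bsub>?P\<^esub> g = (\<lambda>i. \<Oplus>j\<in>{..i}. f j \<otimes> g (i - j))"
    if "f \<in> up R" "g \<in> up R" for f g
    using that unfolding UP_def by simp
  have mult: "f \<otimes>\<^bsub>?T\<^esub> g = trestrict R n (f \<otimes>\<^bsub>?P\<^esub> g)" if "f \<in> up R" "g \<in> up R" for f g
    by (simp only: trunc_simps(1) trestrict_def UP_mult[OF that])
  have restr: "trestrict R n f \<in> carrier ?T" if "f \<in> up R" for f
    using mem_upD[OF that] by (simp add: trunc_carrier trestrict_def)
  have P_closed: "f \<otimes>\<^bsub>?P\<^esub> g \<in> up R" if "f \<in> up R" "g \<in> up R" for f g
    using P.m_closed[of f g] that by (simp add: upc)
  have closed: "f \<otimes>\<^bsub>?T\<^esub> g \<in> carrier ?T" if "f \<in> carrier ?T" "g \<in> carrier ?T" for f g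
    using up that by (simp add: mult restr P_closed)
  have absorb: "trestrict R n (trestrict R n f \<otimes>\<^bsub>?P\<^esub> g) = trestrict R n (f \<otimes>\<^bsub>?P\<^esub> g)"
    if "f \<in> up R" "g \<in> up R" for f g
  proof
    fix i
    have r: "trestrict R n f \<in> up R" using up[OF restr[OF that(1)]] .
    show "trestrict R n (trestrict R n f \<otimes>\<^bsub>?P\<^esub> g) i = trestrict R n (f \<otimes>\<^bsub>?P\<^esub> g) i"
      unfolding UP_mult[OF that] UP_mult[OF r that(2)]
      using mem_upD[OF that(1)] mem_upD[OF that(2)]
      by (auto simp: trestrict_def simp_implies_def intro!: finsum_cong)
  qed
  have comm: "f \<otimes>\<^bsub>?T\<^esub> g = g \<otimes>\<^bsub>?T\<^esub> f" if "f \<in> carrier ?T" "g \<in> carrier ?T" for f g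
    using up[OF that(1)] up[OF that(2)] by (simp add: mult P.m_comm upc)
  have assoc: "f \<otimes>\<^bsub>?T\<^esub> g \<otimes>\<^bsub>?T\<^esub> h = f \<otimes>\<^bsub>?T\<^esub> (g \<otimes>\<^bsub>?T\<^esub> h)"
    if "f \<in> carrier ?T" "g \<in> carrier ?T" "h \<in> carrier ?T" for f g h
  proof -
    note u = up[OF that(1)] up[OF that(2)] up[OF that(3)]
    have *: "a \<otimes>\<^bsub>?T\<^esub> b \<otimes>\<^bsub>?T\<^esub> c = trestrict R n (a \<otimes>\<^bsub>?P\<^esub> b \<otimes>\<^bsub>?P\<^esub> c)"
      if "a \<in> up R" "b \<in> up R" "c \<in> up R" for a b c
      using that by (simp add: mult absorb P_closed up[OF restr])
    have "f \<otimes>\<^bsub>?T\<^esub> (g \<otimes>\<^bsub>?T\<^esub> h) = g \<otimes>\<^bsub>?T\<^esub> h \<otimes>\<^bsub>?T\<^esub> f"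
      using that by (intro comm closed)
    then show ?thesis
      using u by (simp add: * P.m_assoc P.m_comm upc P.m_lcomm)
  qed
  show ?thesis
  proof (rule cringI)
    show "abelian_group ?T"
    proof (rule abelian_groupI)
      fix f assume f: "f \<in> carrier ?T"
      show "\<exists>g\<in>carrier ?T. g \<oplus>\<^bsub>?T\<^esub> f = \<zero>\<^bsub>?T\<^esub>"
        by (rule bexI[of _ "\<lambda>i. \<ominus> f i"]) (use f in \<open>auto simp: trunc_carrier trunc_simps l_neg\<close>)
    qed (auto simp: trunc_carrier trunc_simps a_ac)
    show "Group.comm_monoid ?T"
    proof (rule comm_monoidI)
      show "\<one>\<^bsub>?T\<^esub> \<in> carrier ?T" by (simp add: trunc_carrier trunc_simps)
      fix f assume f: "f \<in> carrier ?T"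
      have "\<one>\<^bsub>?T\<^esub> \<otimes>\<^bsub>?T\<^esub> f = trestrict R n (\<one>\<^bsub>?P\<^esub> \<otimes>\<^bsub>?P\<^esub> f)"
      proof (cases "n = 0")
        case False
        then have "\<one>\<^bsub>?T\<^esub> = \<one>\<^bsub>?P\<^esub>" by (simp add: trunc_simps UP_def)
        then show ?thesis using mult[of "\<one>\<^bsub>?P\<^esub>" f] up[OF f] P.one_closed by (simp add: upc)
      qed (simp add: trunc_simps trestrict_def)
      also have "\<dots> = trestrict R n f" using up[OF f] by (simp add: upc)
      also have "\<dots> = f" using f by (auto simp: trestrict_def trunc_carrier)
      finally show "\<one>\<^bsub>?T\<^esub> \<otimes>\<^bsub>?T\<^esub> f = f" .
    qed (use closed assoc comm in auto)
    fix f g h assume fgh: "f \<in> carrier ?T" "g \<in> carrier ?T" "h \<in> carrier ?T"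
    show "(f \<oplus>\<^bsub>?T\<^esub> g) \<otimes>\<^bsub>?T\<^esub> h = f \<otimes>\<^bsub>?T\<^esub> h \<oplus>\<^bsub>?T\<^esub> g \<otimes>\<^bsub>?T\<^esub> h"
      using fgh by (auto simp: trunc_simps trunc_carrier l_distr finsum_addf)
  qed
qed

lemma tlin_closed: "c \<in> carrier R \<Longrightarrow> d \<in> carrier R \<Longrightarrow> tlin R n c d \<in> carrier (trunc R n)"
  by (simp add: tlin_def trunc_carrier)

lemma trunc_const_mult:
  assumes "c \<in> carrier R" "f \<in> carrier (trunc R n)"
  shows "tlin R n c \<zero> \<otimes>\<^bsub>trunc R n\<^esub> f = (\<lambda>i. c \<otimes> f i)"
proof
  fix i
  show "(tlin R n c \<zero> \<otimes>\<^bsub>trunc R n\<^esub> f) i = c \<otimes> f i"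
  proof (cases "i < n")
    case True
    have "(\<Oplus>j\<in>{..i}. tlin R n c \<zero> j \<otimes> f (i - j)) = (\<Oplus>j\<in>{..i}. if 0 = j then c \<otimes> f (i - j) else \<zero>)"
      using True assms by (intro finsum_cong) (auto simp: tlin_def trunc_carrier simp_implies_def)
    also have "\<dots> = c \<otimes> f i"
      using assms by (subst add.finprod_singleton) (auto simp: trunc_carrier)
    finally show ?thesis using True by (simp add: trunc_simps)
  qed (use assms in \<open>auto simp: trunc_simps trunc_carrier\<close>)
qed

lemma tconst_hom: "(\<lambda>c. tlin R n c \<zero>) \<in> ring_hom R (trunc R n)"
proof (rule ring_hom_memI)
  fix c d assume cd: "c \<in> carrier R" "d \<in> carrier R"
  show "tlin R n (c \<otimes> d) \<zero> = tlin R n c \<zero> \<otimes>\<^bsub>trunc R n\<^esub> tlin R n d \<zero>"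
    using trunc_const_mult[OF cd(1) tlin_closed[OF cd(2) zero_closed, of n]] cd by (auto simp: tlin_def)
qed (auto simp: tlin_closed, auto simp: tlin_def trunc_simps)

lemma trestrict_hom:
  assumes "n \<le> l"
  shows "trestrict R n \<in> ring_hom (trunc R l) (trunc R n)"
proof (rule ring_hom_memI)
  fix f g assume "f \<in> carrier (trunc R l)" "g \<in> carrier (trunc R l)"
  then show "trestrict R n (f \<otimes>\<^bsub>trunc R l\<^esub> g) = trestrict R n f \<otimes>\<^bsub>trunc R n\<^esub> trestrict R n g"
    using assms by (auto simp: fun_eq_iff trestrict_def trunc_simps trunc_carrier simp_implies_def intro!: finsum_cong)
qed (use assms in \<open>auto simp: trestrict_def trunc_simps trunc_carrier\<close>)

lemma tcoeff0_hom: "0 < n \<Longrightarrow> (\<lambda>f. f 0) \<in> ring_hom (trunc R n) R"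
  by (rule ring_hom_memI) (auto simp: trunc_simps trunc_carrier)

lemma trunc_order_mult:
  assumes fg: "f \<in> carrier (trunc R n)" "g \<in> carrier (trunc R n)"
    and f: "\<And>i. i < a \<Longrightarrow> f i = \<zero>" and g: "\<And>i. i < b \<Longrightarrow> g i = \<zero>" and "i < a + b"
  shows "(f \<otimes>\<^bsub>trunc R n\<^esub> g) i = \<zero>"
proof -
  have "f j \<otimes> g (i - j) = \<zero>" if "j \<le> i" for j
    using f[of j] g[of "i - j"] assms(5) that fg by (cases "j < a") (auto simp: trunc_carrier)
  then have "(\<Oplus>j\<in>{..i}. f j \<otimes> g (i - j)) = \<zero>" by (intro add.finprod_one_eqI) auto
  then show ?thesis by (simp add: trunc_simps)
qed

lemma trunc_nilpotent:
  assumes f: "f \<in> carrier (trunc R n)" and f0: "f 0 = \<zero>" and "n \<le> q"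
  shows "f [^]\<^bsub>trunc R n\<^esub> q = \<zero>\<^bsub>trunc R n\<^esub>"
proof -
  interpret T: cring "trunc R n" by (rule trunc_cring)
  have "i < j \<Longrightarrow> (f [^]\<^bsub>trunc R n\<^esub> j) i = \<zero>" for i j :: nat
  proof (induction j arbitrary: i)
    case (Suc j)
    then show ?case
      using trunc_order_mult[of "f [^]\<^bsub>trunc R n\<^esub> j" n f j 1 i] f f0 by simp
  qed simp
  moreover have "(f [^]\<^bsub>trunc R n\<^esub> q) i = \<zero>" if "i \<ge> n" for i
    using T.nat_pow_closed[OF f, of q] that by (simp add: trunc_carrier)
  ultimately have "(f [^]\<^bsub>trunc R n\<^esub> q) i = \<zero>" for i
    using assms(3) by (cases "i < n") auto
  then show ?thesis by (auto simp: trunc_simps)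
qed

end

text \<open>Frobenius separates the two summands, and \<open>(d t)^(p^N)\<close> has order at least
  \<open>p^N\<close>, hence vanishes modulo \<open>t^n\<close>.\<close>

lemma (in char_p_cring) tlin_pow:
  assumes c: "c \<in> carrier R" and d: "d \<in> carrier R" and n: "n \<le> p ^ N"
  shows "tlin R n c d [^]\<^bsub>trunc R n\<^esub> (p ^ N) = tlin R n (c [^] (p ^ N)) \<zero>"
proof -
  interpret T: cring "trunc R n" by (rule trunc_cring)
  interpret T: char_p_cring "trunc R n" p by (rule char_p_target[OF T.is_cring tconst_hom])
  interpret h: ring_hom_cring R "trunc R n" "\<lambda>c. tlin R n c \<zero>"
    using tconst_hom by unfold_locales
  have cl: "tlin R n c \<zero> \<in> carrier (trunc R n)" "tlin R n \<zero> d \<in> carrier (trunc R n)"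
    using c d by (auto intro: tlin_closed)
  have "tlin R n c d = tlin R n c \<zero> \<oplus>\<^bsub>trunc R n\<^esub> tlin R n \<zero> d"
    using c d by (auto simp: tlin_def trunc_simps)
  then have "tlin R n c d [^]\<^bsub>trunc R n\<^esub> (p ^ N) =
      tlin R n c \<zero> [^]\<^bsub>trunc R n\<^esub> (p ^ N) \<oplus>\<^bsub>trunc R n\<^esub> tlin R n \<zero> d [^]\<^bsub>trunc R n\<^esub> (p ^ N)"
    using ring_hom_add[OF T.frobenius_power_hom cl] by simp
  also have "tlin R n \<zero> d [^]\<^bsub>trunc R n\<^esub> (p ^ N) = \<zero>\<^bsub>trunc R n\<^esub>"
    by (rule trunc_nilpotent[OF cl(2) _ n]) (simp add: tlin_def)
  finally show ?thesis using c cl by (simp add: h.hom_pow)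
qed

section \<open>Absolute \<open>p\<close>-bases\<close>

text \<open>A monomial with its variables kept apart from their values. Relations thereby move along
  homomorphisms without any change of the index set, even if variables were to be
  identified.\<close>

definition mval :: "('c, 't) ring_scheme \<Rightarrow> ('b \<Rightarrow> 'c) \<Rightarrow> ('b \<Rightarrow> nat) \<Rightarrow> 'c" where
  "mval C f \<alpha> = finprod C (\<lambda>b. f b [^]\<^bsub>C\<^esub> \<alpha> b) {b. \<alpha> b \<noteq> 0}"

lemma monomial_mval: "monomial R \<alpha> = mval R (\<lambda>b. b) \<alpha>"
  by (simp add: monomial_def mval_def)

lemma p_exponentsD:
  "\<alpha> \<in> p_exponents p G \<Longrightarrow> finite {b. \<alpha> b \<noteq> 0}" "\<alpha> \<in> p_exponents p G \<Longrightarrow> {b. \<alpha> b \<noteq> 0} \<subseteq> G"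
  "\<alpha> \<in> p_exponents p G \<Longrightarrow> \<alpha> b < p"
  by (auto simp: p_exponents_def)

section \<open>Monomials in arbitrary values\<close>

context cring
begin

lemma mval_closed: "f \<in> {b. \<alpha> b \<noteq> 0} \<rightarrow> carrier R \<Longrightarrow> mval R f \<alpha> \<in> carrier R"
  unfolding mval_def by (rule finprod_closed) auto

lemma monomial_in_carrier:
  assumes "\<alpha> \<in> p_exponents p A" "A \<subseteq> carrier R"
  shows "monomial R \<alpha> \<in> carrier R"
  unfolding monomial_mval using assms p_exponentsD(2)[OF assms(1)] by (intro mval_closed) blast

lemma mval_superset:
  assumes "finite A" "{b. \<alpha> b \<noteq> 0} \<subseteq> A" "f \<in> A \<rightarrow> carrier R"
  shows "mval R f \<alpha> = finprod R (\<lambda>b. f b [^] \<alpha> b) A"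
  unfolding mval_def by (rule finprod_mono_neutral_cong_left) (use assms in auto)

lemma mval_split:
  assumes "finite {b. \<alpha> b \<noteq> 0}" "f \<in> {b. \<alpha> b \<noteq> 0} \<rightarrow> carrier R" "f g \<in> carrier R"
  shows "mval R f \<alpha> = f g [^] \<alpha> g \<otimes> mval R f (\<alpha>(g := 0))"
proof -
  let ?B = "{b. (\<alpha>(g := 0)) b \<noteq> 0}"
  have B: "finite ?B" "?B \<subseteq> {b. \<alpha> b \<noteq> 0}" "g \<notin> ?B" using assms(1) by (auto elim!: rev_finite_subset)
  have "mval R f \<alpha> = finprod R (\<lambda>b. f b [^] \<alpha> b) (insert g ?B)"
    by (rule mval_superset) (use assms B in auto)
  also have "\<dots> = f g [^] \<alpha> g \<otimes> finprod R (\<lambda>b. f b [^] \<alpha> b) ?B"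
    by (rule finprod_insert) (use assms B in auto)
  also have "finprod R (\<lambda>b. f b [^] \<alpha> b) ?B = mval R f (\<alpha>(g := 0))"
    unfolding mval_def by (rule finprod_cong) (use assms B in \<open>auto simp: simp_implies_def\<close>)
  finally show ?thesis .
qed

lemma mval_0: "mval R f (\<lambda>_. 0) = \<one>"
  by (simp add: mval_def)

lemma mval_add:
  assumes "finite {b. \<alpha> b \<noteq> 0}" "finite {b. \<beta> b \<noteq> 0}"
    "f \<in> {b. \<alpha> b \<noteq> 0} \<union> {b. \<beta> b \<noteq> 0} \<rightarrow> carrier R"
  shows "mval R f (\<lambda>b. \<alpha> b + \<beta> b) = mval R f \<alpha> \<otimes> mval R f \<beta>"
proof -
  let ?A = "{b. \<alpha> b \<noteq> 0} \<union> {b. \<beta> b \<noteq> 0}"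
  have "mval R f \<alpha> = finprod R (\<lambda>b. f b [^] \<alpha> b) ?A" "mval R f \<beta> = finprod R (\<lambda>b. f b [^] \<beta> b) ?A"
    "mval R f (\<lambda>b. \<alpha> b + \<beta> b) = finprod R (\<lambda>b. f b [^] (\<alpha> b + \<beta> b)) ?A"
    by (rule mval_superset, use assms in \<open>simp_all add: Pi_def subset_iff\<close>)+
  moreover have "finprod R (\<lambda>b. f b [^] (\<alpha> b + \<beta> b)) ?A = finprod R (\<lambda>b. f b [^] \<alpha> b \<otimes> f b [^] \<beta> b) ?A"
    by (rule finprod_cong) (use assms in \<open>auto simp: simp_implies_def Pi_def nat_pow_mult\<close>)
  moreover have "finprod R (\<lambda>b. f b [^] \<alpha> b \<otimes> f b [^] \<beta> b) ?A
      = finprod R (\<lambda>b. f b [^] \<alpha> b) ?A \<otimes> finprod R (\<lambda>b. f b [^] \<beta> b) ?A"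
    by (rule finprod_multf) (use assms(3) in \<open>simp_all add: Pi_def\<close>)
  ultimately show ?thesis by simp
qed

lemma mval_single:
  assumes "f g \<in> carrier R"
  shows "mval R f (\<lambda>b. if b = g then n else 0) = f g [^] n"
proof -
  have "mval R f (\<lambda>b. if b = g then n else 0) = f g [^] n \<otimes> mval R f (\<lambda>b. 0)"
    by (subst mval_split[where g = g]) (use assms in \<open>auto simp: fun_upd_def intro!: arg_cong2[where f = "(\<otimes>)"] arg_cong[where f = "mval R f"]\<close>)
  then show ?thesis using assms by (simp add: mval_0)
qed

lemma mval_hom:
  assumes C: "cring C" and h: "h \<in> ring_hom R C" and f: "f \<in> {b. \<alpha> b \<noteq> 0} \<rightarrow> carrier R"
    and f': "\<And>b. \<alpha> b \<noteq> 0 \<Longrightarrow> f' b = h (f b)"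
  shows "h (mval R f \<alpha>) = mval C f' \<alpha>"
proof -
  interpret C: cring C by fact
  interpret h: ring_hom_cring R C h using h by unfold_locales
  have "h (mval R f \<alpha>) = finprod C (h \<circ> (\<lambda>b. f b [^] \<alpha> b)) {b. \<alpha> b \<noteq> 0}"
    unfolding mval_def by (rule h.hom_finprod) (use f in auto)
  also have "\<dots> = mval C f' \<alpha>"
    unfolding mval_def
    by (rule C.finprod_cong) (use f f' in \<open>auto simp: simp_implies_def Pi_def\<close>)
  finally show ?thesis .
qed

end

section \<open>Sums with coefficients in \<open>R^p\<close>\<close>

context char_p_cring
begin

abbreviation psum where
  "psum F c \<equiv> (\<Oplus>\<alpha>\<in>F. c \<alpha> [^] p \<otimes> monomial R \<alpha>)"

lemma psum_add:
  assumes F: "F \<subseteq> p_exponents p A" "A \<subseteq> carrier R" "c \<in> F \<rightarrow> carrier R" "d \<in> F \<rightarrow> carrier R"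
  shows "psum F (\<lambda>\<alpha>. c \<alpha> \<oplus> d \<alpha>)
    = psum F c \<oplus> psum F d"
proof -
  have m: "monomial R \<alpha> \<in> carrier R" "c \<alpha> \<in> carrier R" "d \<alpha> \<in> carrier R" if "\<alpha> \<in> F" for \<alpha>
    using that F monomial_in_carrier[of \<alpha> p A] by auto
  have "psum F (\<lambda>\<alpha>. c \<alpha> \<oplus> d \<alpha>)
      = (\<Oplus>\<alpha>\<in>F. c \<alpha> [^] p \<otimes> monomial R \<alpha> \<oplus> d \<alpha> [^] p \<otimes> monomial R \<alpha>)"
    by (rule add.finprod_cong') (use m in \<open>auto simp: frobenius_add l_distr\<close>)
  also have "\<dots> = psum F c \<oplus> psum F d"
    by (rule finsum_addf) (use m in auto)
  finally show ?thesis .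
qed

lemma psum_scale:
  assumes F: "F \<subseteq> p_exponents p A" "finite F" "A \<subseteq> carrier R" "c \<in> F \<rightarrow> carrier R" "r \<in> carrier R"
  shows "psum F (\<lambda>\<alpha>. r \<otimes> c \<alpha>) = r [^] p \<otimes> psum F c"
proof -
  have m: "monomial R \<alpha> \<in> carrier R" "c \<alpha> \<in> carrier R" if "\<alpha> \<in> F" for \<alpha>
    using that F monomial_in_carrier[of \<alpha> p A] by auto
  have "r [^] p \<otimes> psum F c = (\<Oplus>\<alpha>\<in>F. r [^] p \<otimes> (c \<alpha> [^] p \<otimes> monomial R \<alpha>))"
    by (rule finsum_rdistr) (use F m in auto)
  also have "\<dots> = psum F (\<lambda>\<alpha>. r \<otimes> c \<alpha>)"
    by (rule add.finprod_cong') (use m F in \<open>auto simp: nat_pow_distrib m_assoc\<close>)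
  finally show ?thesis by simp
qed

end

text \<open>Independence yields \<open>c \<alpha> = \<zero>\<close> and not merely
  \<open>c \<alpha> [^] p = \<zero>\<close>. Applied to the trivial monomial, it contains the
  injectivity of Frobenius, so coordinates may be recorded by their \<open>p\<close>-th
  roots.\<close>

locale abs_p_basis = char_p_cring +
  fixes G
  assumes G: "G \<subseteq> carrier R"
    and gen: "generate_ring R ((\<lambda>r. r [^] p) ` carrier R \<union> G) = carrier R"
    and indep: "\<lbrakk>F \<subseteq> p_exponents p G; finite F; c \<in> F \<rightarrow> carrier R;
      psum F c = \<zero>; \<alpha> \<in> F\<rbrakk> \<Longrightarrow> c \<alpha> = \<zero>"
begin

abbreviation E where "E \<equiv> p_exponents p G"

lemma monomial_closed: "\<alpha> \<in> E \<Longrightarrow> monomial R \<alpha> \<in> carrier R"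
  using monomial_in_carrier G by blast

lemma zero_E: "(\<lambda>_. 0) \<in> E"
  using p_ge_2 by (auto simp: p_exponents_def)

lemma upd_E: "\<alpha> \<in> E \<Longrightarrow> g \<in> G \<Longrightarrow> n < p \<Longrightarrow> \<alpha>(g := n) \<in> E"
proof -
  assume a: "\<alpha> \<in> E" "g \<in> G" "n < p"
  then have "finite (insert g {b. \<alpha> b \<noteq> 0})" by (auto simp: p_exponents_def)
  then have "finite {b. (\<alpha>(g := n)) b \<noteq> 0}" by (rule rev_finite_subset) auto
  then show ?thesis using a by (auto simp: p_exponents_def)
qed

text \<open>Multiplying by \<open>g\<close> either raises an exponent or, at \<open>p - 1\<close>, moves \<open>g\<^sup>p\<close> into the coefficient.\<close>

lemma mult_generator:
  assumes "\<alpha> \<in> E" "g \<in> G" and C: "cring C" and f: "f \<in> G \<rightarrow> carrier C"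
  shows "\<alpha> g < p - 1 \<Longrightarrow> f g \<otimes>\<^bsub>C\<^esub> mval C f \<alpha> = mval C f (\<alpha>(g := Suc (\<alpha> g)))"
    and "\<alpha> g = p - 1 \<Longrightarrow> f g \<otimes>\<^bsub>C\<^esub> mval C f \<alpha> = f g [^]\<^bsub>C\<^esub> p \<otimes>\<^bsub>C\<^esub> mval C f (\<alpha>(g := 0))"
proof -
  interpret C: cring C by fact
  have fg: "f g \<in> carrier C" using f assms by blast
  have split: "mval C f \<beta> = f g [^]\<^bsub>C\<^esub> \<beta> g \<otimes>\<^bsub>C\<^esub> mval C f (\<beta>(g := 0))"
    and cl: "mval C f \<beta> \<in> carrier C" if "\<beta> \<in> E" for \<beta>
    using p_exponentsD(1,2)[OF that] f by (auto intro!: C.mval_split C.mval_closed fg)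
  have E0: "\<alpha>(g := 0) \<in> E" using upd_E assms p_ge_2 by simp
  have *: "f g \<otimes>\<^bsub>C\<^esub> mval C f \<alpha> = f g [^]\<^bsub>C\<^esub> Suc (\<alpha> g) \<otimes>\<^bsub>C\<^esub> mval C f (\<alpha>(g := 0))"
    unfolding split[OF assms(1)] using cl[OF E0] fg by (simp add: C.m_ac)
  show "f g \<otimes>\<^bsub>C\<^esub> mval C f \<alpha> = mval C f (\<alpha>(g := Suc (\<alpha> g)))" if "\<alpha> g < p - 1"
    using split[OF upd_E[of \<alpha> g "Suc (\<alpha> g)"]] assms that * by simp
  show "f g \<otimes>\<^bsub>C\<^esub> mval C f \<alpha> = f g [^]\<^bsub>C\<^esub> p \<otimes>\<^bsub>C\<^esub> mval C f (\<alpha>(g := 0))" if "\<alpha> g = p - 1"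
    using * that p_ge_2 by simp
qed

text \<open>The \<open>R^p\<close>-span of the monomials, generated one summand at a time; its
  induction rule becomes \<open>basis_induct\<close>, on which the construction of homomorphisms
  rests.\<close>

inductive_set span where
  zero: "\<zero> \<in> span"
| summand: "w \<in> carrier R \<Longrightarrow> \<alpha> \<in> E \<Longrightarrow> s \<in> span \<Longrightarrow> w [^] p \<otimes> monomial R \<alpha> \<oplus> s \<in> span"

lemma span_closed: "s \<in> span \<Longrightarrow> s \<in> carrier R"
  by (induction rule: span.induct) (auto simp: monomial_closed)

lemma span_add: "s \<in> span \<Longrightarrow> t \<in> span \<Longrightarrow> s \<oplus> t \<in> span"
  by (induction rule: span.induct)
    (auto simp: a_assoc monomial_closed span_closed intro: span.summand)

lemma span_single: "w \<in> carrier R \<Longrightarrow> \<alpha> \<in> E \<Longrightarrow> w [^] p \<otimes> monomial R \<alpha> \<in> span"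
  using span.summand[OF _ _ span.zero, of w \<alpha>] by (simp add: monomial_closed)

lemma span_scale: "s \<in> span \<Longrightarrow> u \<in> carrier R \<Longrightarrow> u [^] p \<otimes> s \<in> span"
proof (induction rule: span.induct)
  case (summand w \<alpha> s)
  have "u [^] p \<otimes> (w [^] p \<otimes> monomial R \<alpha> \<oplus> s) = (u \<otimes> w) [^] p \<otimes> monomial R \<alpha> \<oplus> u [^] p \<otimes> s"
    using summand by (simp add: r_distr nat_pow_distrib monomial_closed span_closed m_assoc)
  then show ?case using summand by (simp add: span.summand)
qed (simp add: span.zero)

lemma span_generator: "s \<in> span \<Longrightarrow> g \<in> G \<Longrightarrow> g \<otimes> s \<in> span"
proof (induction rule: span.induct)
  case (summand w \<alpha> s)
  have g: "g \<in> carrier R" using summand G by blast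
  have "(\<lambda>b. b) \<in> G \<rightarrow> carrier R" using G by blast
  note mg = mult_generator[OF summand.hyps(2) summand.prems is_cring this, folded monomial_mval]
  have "g \<otimes> (w [^] p \<otimes> monomial R \<alpha> \<oplus> s) = w [^] p \<otimes> (g \<otimes> monomial R \<alpha>) \<oplus> g \<otimes> s"
    using summand g by (simp add: r_distr monomial_closed span_closed m_lcomm)
  moreover have "w [^] p \<otimes> (g \<otimes> monomial R \<alpha>) \<in> span"
  proof (cases "\<alpha> g = p - 1")
    case True
    have 0: "\<alpha>(g := 0) \<in> E" using upd_E summand p_ge_2 by simp
    have "w [^] p \<otimes> (g \<otimes> monomial R \<alpha>) = (w \<otimes> g) [^] p \<otimes> monomial R (\<alpha>(g := 0))"
      using mg(2) True G summand g 0 by (auto simp: nat_pow_distrib m_assoc monomial_closed)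
    then show ?thesis using span_single[of "w \<otimes> g" "\<alpha>(g := 0)"] summand g 0 by simp
  next
    case False
    then have lt: "\<alpha> g < p - 1" using p_exponentsD(3)[OF summand.hyps(2), of g] by simp
    then have "\<alpha>(g := Suc (\<alpha> g)) \<in> E" using upd_E summand by simp
    then show ?thesis using mg(1)[OF lt] G summand by (auto intro: span_single)
  qed
  ultimately show ?case using summand by (simp add: span_add)
qed (use G in \<open>auto simp: span.zero\<close>)

text \<open>Derived from additivity of Frobenius, which treats odd \<open>p\<close> and
  \<open>p = 2\<close> alike.\<close>

lemma minus_one_pow: "(\<ominus> \<one>) [^] p = \<ominus> \<one>"
proof -
  have "(\<ominus> \<one>) [^] p \<oplus> \<one> = (\<ominus> \<one> \<oplus> \<one>) [^] p" by (simp add: frobenius_add)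
  also have "\<dots> = \<zero>" using p_ge_2 by (simp add: l_neg nat_pow_zero)
  finally show ?thesis using minus_equality[of "(\<ominus> \<one>) [^] p" \<one>] by simp
qed

lemma span_eq: "span = carrier R"
proof
  show "span \<subseteq> carrier R" using span_closed by blast
  \<comment> \<open>Closure of \<open>span\<close> under products is not checked directly: the
    multipliers preserving \<open>span\<close> form a subring, which contains the generators and
    therefore everything.\<close>
  define M where "M = {r \<in> carrier R. \<forall>s\<in>span. r \<otimes> s \<in> span}"
  have "subring M R"
  proof (rule subringI)
    show "M \<subseteq> carrier R" "\<one> \<in> M" by (auto simp: M_def span_closed)
    fix x y assume x: "x \<in> M" and y: "y \<in> M"
    show "x \<otimes> y \<in> M" "x \<oplus> y \<in> M"
      using x y by (auto simp: M_def m_assoc span_closed l_distr span_add)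
    have "\<ominus> x \<otimes> s = (\<ominus> \<one>) [^] p \<otimes> (x \<otimes> s)" if "s \<in> span" for s
      unfolding minus_one_pow using x that span_closed by (simp add: M_def l_minus)
    then show "\<ominus> x \<in> M" using x by (auto simp: M_def span_scale)
  qed
  moreover have "(\<lambda>r. r [^] p) ` carrier R \<union> G \<subseteq> M"
    using G by (auto simp: M_def span_scale span_generator)
  ultimately have M: "carrier R \<subseteq> M"
    using generate_ring_min_subring1[of "(\<lambda>r. r [^] p) ` carrier R \<union> G" M] gen G by auto
  have "\<one> \<in> span"
    using span_single[OF one_closed zero_E] by (simp add: monomial_mval mval_0)
  then show "carrier R \<subseteq> span" using M by (force simp: M_def)
qed

lemma basis_induct [consumes 1, case_names zero summand]:
  assumes "r \<in> carrier R" "P \<zero>"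
    "\<And>w \<alpha> s. w \<in> carrier R \<Longrightarrow> \<alpha> \<in> E \<Longrightarrow> s \<in> carrier R \<Longrightarrow> P s \<Longrightarrow> P (w [^] p \<otimes> monomial R \<alpha> \<oplus> s)"
  shows "P r"
proof -
  have "r \<in> span" using assms(1) span_eq by simp
  then show ?thesis by (induction rule: span.induct) (use assms span_closed in auto)
qed

text \<open>Coordinates over \<open>R^p\<close>, stored as \<open>p\<close>-th roots and extended by
  zero from a finite support, so that uniqueness becomes an equality of functions.\<close>

definition rep :: "(('a \<Rightarrow> nat) \<Rightarrow> 'a) \<Rightarrow> 'a \<Rightarrow> bool" where
  "rep c r \<longleftrightarrow> (\<forall>\<alpha>. c \<alpha> \<in> carrier R) \<and> finite {\<alpha>. c \<alpha> \<noteq> \<zero>} \<and> {\<alpha>. c \<alpha> \<noteq> \<zero>} \<subseteq> E \<and>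
     r = psum {\<alpha>. c \<alpha> \<noteq> \<zero>} c"

lemma zero_pow: "\<zero> [^] p = \<zero>"
  using p_ge_2 by (simp add: nat_pow_zero)

text \<open>Sums over the supports of different coordinate functions are compared on a common finite
  set. The general \<open>h\<close> covers both the \<open>p\<close>-th power in \<open>R\<close>
  and a homomorphism to \<open>C\<close>.\<close>

lemma sum_on:
  assumes C: "cring C" and h: "\<And>x. x \<in> carrier R \<Longrightarrow> h x \<in> carrier C" "h \<zero> = \<zero>\<^bsub>C\<^esub>"
    and x: "\<And>\<alpha>. \<alpha> \<in> A \<Longrightarrow> x \<alpha> \<in> carrier C"
    and c: "\<And>\<alpha>. c \<alpha> \<in> carrier R" and A: "finite A" "{\<alpha>. c \<alpha> \<noteq> \<zero>} \<subseteq> A"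
  shows "(\<Oplus>\<^bsub>C\<^esub>\<alpha>\<in>{\<alpha>. c \<alpha> \<noteq> \<zero>}. h (c \<alpha>) \<otimes>\<^bsub>C\<^esub> x \<alpha>) = (\<Oplus>\<^bsub>C\<^esub>\<alpha>\<in>A. h (c \<alpha>) \<otimes>\<^bsub>C\<^esub> x \<alpha>)"
proof -
  interpret C: cring C by fact
  show ?thesis
    by (rule C.add.finprod_mono_neutral_cong_left) (use assms in auto)
qed

lemma rep_unique:
  assumes "rep c r" "rep d r"
  shows "c = d"
proof
  fix \<alpha>
  let ?A = "{\<alpha>. c \<alpha> \<noteq> \<zero>} \<union> {\<alpha>. d \<alpha> \<noteq> \<zero>}"
  have A: "finite ?A" "?A \<subseteq> E" and cd: "\<And>\<alpha>. c \<alpha> \<in> carrier R" "\<And>\<alpha>. d \<alpha> \<in> carrier R"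
    using assms by (auto simp: rep_def)
  have c: "r = psum ?A c" and d: "r = psum ?A d"
    using assms A sum_on[OF is_cring, where h = "\<lambda>x. x [^] p" and x = "monomial R" and A = ?A] cd
    by (simp_all add: rep_def zero_pow monomial_closed subset_iff)
  define e where "e \<alpha> = c \<alpha> \<oplus> (\<ominus> \<one>) \<otimes> d \<alpha>" for \<alpha>
  have e: "e \<alpha> \<in> carrier R" for \<alpha> using cd by (simp add: e_def)
  have r: "r \<in> carrier R" unfolding c by (rule finsum_closed) (use A cd monomial_closed in auto)
  have "psum ?A e = r \<oplus> (\<ominus> \<one>) [^] p \<otimes> r"
    unfolding e_def using psum_add[OF A(2) G, of c "\<lambda>\<alpha>. (\<ominus> \<one>) \<otimes> d \<alpha>"]
      psum_scale[OF A(2,1) G, of d "\<ominus> \<one>"] cd by (simp add: c[symmetric] d[symmetric])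
  also have "\<dots> = \<zero>" using r by (simp add: minus_one_pow l_minus r_neg)
  finally have "\<alpha> \<in> ?A \<Longrightarrow> e \<alpha> = \<zero>" using indep[OF A(2,1), of e] e by blast
  then have "\<alpha> \<in> ?A \<Longrightarrow> c \<alpha> \<ominus> d \<alpha> = \<zero>" using cd by (simp add: e_def minus_eq l_minus)
  then show "c \<alpha> = d \<alpha>" using cd by (cases "\<alpha> \<in> ?A") auto
qed

lemma rep_zero: "rep (\<lambda>_. \<zero>) \<zero>"
  by (simp add: rep_def)

lemma rep_single:
  assumes "w \<in> carrier R" "\<alpha> \<in> E"
  shows "rep (\<lambda>\<beta>. if \<beta> = \<alpha> then w else \<zero>) (w [^] p \<otimes> monomial R \<alpha>)"
proof -
  have m: "monomial R \<alpha> \<in> carrier R" using assms monomial_closed by blast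
  show ?thesis
  proof (cases "w = \<zero>")
    case True
    then show ?thesis using m by (simp add: rep_def zero_pow)
  next
    case False
    then have "{\<beta>. (if \<beta> = \<alpha> then w else \<zero>) \<noteq> \<zero>} = {\<alpha>}" by auto
    then show ?thesis using assms m by (simp add: rep_def)
  qed
qed

lemma rep_add:
  assumes c: "rep c r" and d: "rep d s"
  shows "rep (\<lambda>\<alpha>. c \<alpha> \<oplus> d \<alpha>) (r \<oplus> s)"
proof -
  let ?A = "{\<alpha>. c \<alpha> \<noteq> \<zero>} \<union> {\<alpha>. d \<alpha> \<noteq> \<zero>}"
  have A: "finite ?A" "?A \<subseteq> E" and cd: "\<And>\<alpha>. c \<alpha> \<in> carrier R" "\<And>\<alpha>. d \<alpha> \<in> carrier R"
    using assms by (auto simp: rep_def)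
  have sub: "{\<alpha>. c \<alpha> \<oplus> d \<alpha> \<noteq> \<zero>} \<subseteq> ?A" by auto
  have on_A: "psum {\<alpha>. e \<alpha> \<noteq> \<zero>} e = psum ?A e"
    if "\<And>\<alpha>. e \<alpha> \<in> carrier R" "{\<alpha>. e \<alpha> \<noteq> \<zero>} \<subseteq> ?A" for e
    by (rule sum_on[OF is_cring, where h = "\<lambda>x. x [^] p" and x = "monomial R"])
      (use that A monomial_closed in \<open>auto simp: zero_pow\<close>)
  have "psum ?A (\<lambda>\<alpha>. c \<alpha> \<oplus> d \<alpha>)
      = psum ?A c \<oplus> psum ?A d"
    by (rule psum_add[OF A(2) G]) (use cd in auto)
  also have "\<dots> = r \<oplus> s"
    using c d on_A[of c] on_A[of d] cd by (simp add: rep_def)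
  finally have "r \<oplus> s = psum ?A (\<lambda>\<alpha>. c \<alpha> \<oplus> d \<alpha>)" by simp
  moreover have "finite {\<alpha>. c \<alpha> \<oplus> d \<alpha> \<noteq> \<zero>}" using A(1) sub by (rule rev_finite_subset)
  ultimately show ?thesis
    using A sub cd on_A[of "\<lambda>\<alpha>. c \<alpha> \<oplus> d \<alpha>"] unfolding rep_def by auto
qed

lemma rep_exists: "r \<in> carrier R \<Longrightarrow> \<exists>c. rep c r"
proof (induction rule: basis_induct)
  case zero show ?case using rep_zero by blast
next
  case (summand w \<alpha> s)
  then show ?case using rep_add[OF rep_single] by blast
qed

text \<open>The map \<open>h\<close> stands for the homomorphism \<open>r^p \<mapsto> h r\<close> on
  \<open>R^p\<close>. Over \<open>R^p\<close> the ring \<open>R\<close> is free on the monomials and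
  its multiplication is determined by the values of \<open>g^p\<close>, so \<open>fp\<close> is the
  only compatibility to impose.\<close>

theorem hom_extension:
  assumes C: "cring C" and h: "h \<in> ring_hom R C" and f: "f \<in> G \<rightarrow> carrier C"
    and fp: "\<And>g. g \<in> G \<Longrightarrow> f g [^]\<^bsub>C\<^esub> p = h g"
  shows "\<exists>v\<in>ring_hom R C. (\<forall>g\<in>G. v g = f g) \<and> (\<forall>r\<in>carrier R. v (r [^] p) = h r)"
proof -
  interpret C: cring C by fact
  interpret h: ring_hom_cring R C h using h by unfold_locales
  have fm [simp]: "mval C f \<alpha> \<in> carrier C" if "\<alpha> \<in> E" for \<alpha>
    by (rule C.mval_closed) (use f p_exponentsD(2)[OF that] in auto)
  define coord where "coord r = (SOME c. rep c r)" for r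
  have coord: "rep (coord r) r" if "r \<in> carrier R" for r
    using someI_ex[OF rep_exists[OF that]] by (simp add: coord_def)
  have coord_eq: "coord r = c" if "rep c r" "r \<in> carrier R" for c r
    using rep_unique coord that by blast
  define v where "v r = (\<Oplus>\<^bsub>C\<^esub>\<alpha>\<in>{\<alpha>. coord r \<alpha> \<noteq> \<zero>}. h (coord r \<alpha>) \<otimes>\<^bsub>C\<^esub> mval C f \<alpha>)" for r
  have v_closed [simp]: "v r \<in> carrier C" if "r \<in> carrier R" for r
    unfolding v_def by (rule C.finsum_closed) (use coord[OF that] in \<open>auto simp: rep_def\<close>)
  have v_add: "v (r \<oplus> s) = v r \<oplus>\<^bsub>C\<^esub> v s" if rs: "r \<in> carrier R" "s \<in> carrier R" for r s
  proof -
    let ?c = "coord r" and ?d = "coord s"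
    let ?A = "{\<alpha>. ?c \<alpha> \<noteq> \<zero>} \<union> {\<alpha>. ?d \<alpha> \<noteq> \<zero>}"
    have A: "finite ?A" "?A \<subseteq> E" and cd: "\<And>\<alpha>. ?c \<alpha> \<in> carrier R" "\<And>\<alpha>. ?d \<alpha> \<in> carrier R"
      using coord[OF rs(1)] coord[OF rs(2)] by (auto simp: rep_def)
    have on_A: "(\<Oplus>\<^bsub>C\<^esub>\<alpha>\<in>{\<alpha>. e \<alpha> \<noteq> \<zero>}. h (e \<alpha>) \<otimes>\<^bsub>C\<^esub> mval C f \<alpha>) = (\<Oplus>\<^bsub>C\<^esub>\<alpha>\<in>?A. h (e \<alpha>) \<otimes>\<^bsub>C\<^esub> mval C f \<alpha>)"
      if "\<And>\<alpha>. e \<alpha> \<in> carrier R" "{\<alpha>. e \<alpha> \<noteq> \<zero>} \<subseteq> ?A" for e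
      by (rule sum_on[OF C]) (use that A in auto)
    have sum: "coord (r \<oplus> s) = (\<lambda>\<alpha>. ?c \<alpha> \<oplus> ?d \<alpha>)"
      using rs by (intro coord_eq rep_add coord) auto
    have "v (r \<oplus> s) = (\<Oplus>\<^bsub>C\<^esub>\<alpha>\<in>?A. h (?c \<alpha> \<oplus> ?d \<alpha>) \<otimes>\<^bsub>C\<^esub> mval C f \<alpha>)"
      unfolding v_def sum by (rule on_A) (use cd in auto)
    also have "\<dots> = (\<Oplus>\<^bsub>C\<^esub>\<alpha>\<in>?A. h (?c \<alpha>) \<otimes>\<^bsub>C\<^esub> mval C f \<alpha> \<oplus>\<^bsub>C\<^esub> h (?d \<alpha>) \<otimes>\<^bsub>C\<^esub> mval C f \<alpha>)"
      by (rule C.add.finprod_cong') (use A cd in \<open>auto simp: C.l_distr subset_iff\<close>)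
    also have "\<dots> = (\<Oplus>\<^bsub>C\<^esub>\<alpha>\<in>?A. h (?c \<alpha>) \<otimes>\<^bsub>C\<^esub> mval C f \<alpha>) \<oplus>\<^bsub>C\<^esub> (\<Oplus>\<^bsub>C\<^esub>\<alpha>\<in>?A. h (?d \<alpha>) \<otimes>\<^bsub>C\<^esub> mval C f \<alpha>)"
      by (rule C.finsum_addf) (use A cd in auto)
    also have "\<dots> = v r \<oplus>\<^bsub>C\<^esub> v s"
      unfolding v_def using on_A[of ?c] on_A[of ?d] cd by auto
    finally show ?thesis .
  qed
  have v_single: "v (w [^] p \<otimes> monomial R \<alpha>) = h w \<otimes>\<^bsub>C\<^esub> mval C f \<alpha>"
    if "w \<in> carrier R" "\<alpha> \<in> E" for w \<alpha>
  proof -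
    have c: "coord (w [^] p \<otimes> monomial R \<alpha>) = (\<lambda>\<beta>. if \<beta> = \<alpha> then w else \<zero>)"
      using that by (intro coord_eq rep_single) (auto simp: monomial_closed)
    show ?thesis
    proof (cases "w = \<zero>")
      case True
      then show ?thesis unfolding v_def c using that by simp
    next
      case False
      then have "{\<beta>. (if \<beta> = \<alpha> then w else \<zero>) \<noteq> \<zero>} = {\<alpha>}" by auto
      then show ?thesis unfolding v_def c using that by simp
    qed
  qed
  have v_zero: "v \<zero> = \<zero>\<^bsub>C\<^esub>"
    unfolding v_def using coord_eq[OF rep_zero] by simp
  have v_scale: "v (u [^] p \<otimes> s) = h u \<otimes>\<^bsub>C\<^esub> v s" if "s \<in> carrier R" "u \<in> carrier R" for u s
    using that
  proof (induction s rule: basis_induct)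
    case (summand w \<alpha> s)
    have m: "monomial R \<alpha> \<in> carrier R" using summand monomial_closed by blast
    have "u [^] p \<otimes> (w [^] p \<otimes> monomial R \<alpha> \<oplus> s) = (u \<otimes> w) [^] p \<otimes> monomial R \<alpha> \<oplus> u [^] p \<otimes> s"
      using summand m by (simp add: r_distr nat_pow_distrib m_assoc)
    then show ?case
      using summand m by (simp add: v_add v_single C.r_distr C.m_assoc)
  qed (simp add: v_zero)
  have v_one: "v \<one> = \<one>\<^bsub>C\<^esub>"
    using v_single[OF one_closed zero_E] by (simp add: monomial_mval mval_0 C.mval_0)
  have v_generator: "v (g \<otimes> s) = f g \<otimes>\<^bsub>C\<^esub> v s" if "s \<in> carrier R" "g \<in> G" for g s
    using that
  proof (induction s rule: basis_induct)
    case (summand w \<alpha> s)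
    have m: "monomial R \<alpha> \<in> carrier R" using summand monomial_closed by blast
    have g: "g \<in> carrier R" and fg: "f g \<in> carrier C" using summand G f by blast+
    have id: "(\<lambda>b. b) \<in> G \<rightarrow> carrier R" using G by blast
    note mR = mult_generator[OF summand.hyps(2) summand.prems is_cring id, folded monomial_mval]
    note mC = mult_generator[OF summand.hyps(2) summand.prems C f]
    have "v (w [^] p \<otimes> (g \<otimes> monomial R \<alpha>)) = h w \<otimes>\<^bsub>C\<^esub> (f g \<otimes>\<^bsub>C\<^esub> mval C f \<alpha>)"
    proof (cases "\<alpha> g = p - 1")
      \<comment> \<open>At exponent \<open>p - 1\<close> the product wraps around; this is where
        \<open>f g [^] p = h g\<close> enters.\<close>
      case True
      have 0: "\<alpha>(g := 0) \<in> E" using upd_E summand p_ge_2 by simp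
      have "w [^] p \<otimes> (g \<otimes> monomial R \<alpha>) = (w \<otimes> g) [^] p \<otimes> monomial R (\<alpha>(g := 0))"
        using mR(2)[OF True] summand g 0 by (simp add: nat_pow_distrib m_assoc monomial_closed)
      then show ?thesis
        using mC(2)[OF True] fp[OF summand.prems] v_single[of "w \<otimes> g", OF _ 0] summand g 0
        by (simp add: C.m_assoc)
    next
      case False
      then have lt: "\<alpha> g < p - 1" using p_exponentsD(3)[OF summand.hyps(2), of g] by simp
      then have "\<alpha>(g := Suc (\<alpha> g)) \<in> E" using upd_E summand by simp
      then show ?thesis using mR(1)[OF lt] mC(1)[OF lt] summand v_single by simp
    qed
    moreover have "g \<otimes> (w [^] p \<otimes> monomial R \<alpha> \<oplus> s) = w [^] p \<otimes> (g \<otimes> monomial R \<alpha>) \<oplus> g \<otimes> s"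
      using summand g m by (simp add: r_distr m_lcomm)
    moreover have "v (w [^] p \<otimes> monomial R \<alpha> \<oplus> s) = h w \<otimes>\<^bsub>C\<^esub> mval C f \<alpha> \<oplus>\<^bsub>C\<^esub> v s"
      using summand m by (simp add: v_add v_single)
    ultimately show ?case
      using summand g m fg by (simp add: v_add C.r_distr C.m_lcomm)
  qed (use G f in \<open>auto simp: v_zero Pi_def subset_iff\<close>)
  \<comment> \<open>Multiplicativity need only be tested on generators: the first factors for which
    it holds form a subring.\<close>
  define M where "M = {r \<in> carrier R. \<forall>s\<in>carrier R. v (r \<otimes> s) = v r \<otimes>\<^bsub>C\<^esub> v s}"
  have pw: "v (r [^] p) = h r" if "r \<in> carrier R" for r
    using v_scale[OF one_closed that] that by (simp add: v_one)
  have gen_v: "v g = f g" if "g \<in> G" for g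
    using v_generator[OF one_closed that] that G f by (auto simp: v_one Pi_def subset_iff)
  have "subring M R"
  proof (rule subringI)
    show "M \<subseteq> carrier R" "\<one> \<in> M" by (auto simp: M_def v_one)
    fix x y assume x: "x \<in> M" and y: "y \<in> M"
    then have xy: "x \<in> carrier R" "y \<in> carrier R" by (auto simp: M_def)
    have vx: "v (x \<otimes> s) = v x \<otimes>\<^bsub>C\<^esub> v s" and vy: "v (y \<otimes> s) = v y \<otimes>\<^bsub>C\<^esub> v s" if "s \<in> carrier R" for s
      using x y that by (auto simp: M_def)
    show "x \<otimes> y \<in> M" "x \<oplus> y \<in> M"
      using xy vx vy by (simp_all add: M_def m_assoc C.m_assoc l_distr v_add C.l_distr)
    have neg: "v (\<ominus> t) = (h (\<ominus> \<one>)) \<otimes>\<^bsub>C\<^esub> v t" if "t \<in> carrier R" for t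
      using v_scale[of t "\<ominus> \<one>"] that by (simp add: minus_one_pow l_minus)
    show "\<ominus> x \<in> M"
      using xy vx by (simp add: M_def l_minus neg C.m_assoc)
  qed
  moreover have "(\<lambda>r. r [^] p) ` carrier R \<union> G \<subseteq> M"
    using G by (auto simp: M_def pw gen_v v_scale v_generator)
  ultimately have "carrier R \<subseteq> M"
    using generate_ring_min_subring1[of "(\<lambda>r. r [^] p) ` carrier R \<union> G" M] gen G by auto
  then have "v \<in> ring_hom R C"
    by (intro ring_hom_memI) (auto simp: v_add v_one M_def)
  then show ?thesis using pw gen_v by blast
qed

text \<open>The homomorphism on \<open>R^(p^(N+1))\<close> represented by \<open>h\<close> is
  extended to \<open>R^(p^N)\<close> first. Read through the \<open>p^N\<close>-th power map this is
  one application of \<open>hom_extension\<close>, with \<open>f g\<close> raised to the power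
  \<open>p^N\<close> as the value at \<open>g\<close>.\<close>

corollary hom_extension_power:
  assumes C: "cring C" and h: "h \<in> ring_hom R C" and f: "f \<in> G \<rightarrow> carrier C"
    and fp: "\<And>g. g \<in> G \<Longrightarrow> f g [^]\<^bsub>C\<^esub> (p ^ N) = h g"
  shows "\<exists>v\<in>ring_hom R C. (\<forall>g\<in>G. v g = f g) \<and> (\<forall>r\<in>carrier R. v (r [^] (p ^ N)) = h r)"
  using h fp
proof (induction N arbitrary: h)
  case 0
  interpret C: cring C by fact
  show ?case
    using 0 f ring_hom_closed[OF 0(1)] by (intro bexI[of _ h]) (auto simp: Pi_def)
next
  case (Suc N)
  interpret C: cring C by fact
  have fg: "f g \<in> carrier C" if "g \<in> G" for g using f that by blast
  have "\<exists>v\<in>ring_hom R C. (\<forall>g\<in>G. v g = f g [^]\<^bsub>C\<^esub> (p ^ N)) \<and> (\<forall>r\<in>carrier R. v (r [^] p) = h r)"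
    by (rule hom_extension[OF C Suc.prems(1)])
      (use Suc.prems(2) fg in \<open>auto simp: C.nat_pow_pow mult.commute\<close>)
  then obtain h' where h': "h' \<in> ring_hom R C" "\<And>g. g \<in> G \<Longrightarrow> h' g = f g [^]\<^bsub>C\<^esub> (p ^ N)"
    "\<And>r. r \<in> carrier R \<Longrightarrow> h' (r [^] p) = h r" by blast
  obtain v where v: "v \<in> ring_hom R C" "\<And>g. g \<in> G \<Longrightarrow> v g = f g"
    "\<And>r. r \<in> carrier R \<Longrightarrow> v (r [^] (p ^ N)) = h' r"
    using Suc.IH[OF h'(1)] h'(2) by metis
  have "v (r [^] (p ^ Suc N)) = h r" if "r \<in> carrier R" for r
    using v(3)[of "r [^] p"] h'(3)[OF that] that by (simp add: nat_pow_pow)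
  then show ?case using v by blast
qed

text \<open>Since \<open>R = R^p[G]\<close>, the \<open>p^N\<close>-th powers are generated by the
  \<open>p^(N+1)\<close>-th powers together with the \<open>p^N\<close>-th powers of
  \<open>G\<close>. Agreement thus descends from exponent \<open>p^N\<close> to exponent 1.\<close>

lemma hom_eqI:
  assumes C: "cring C" and v: "v \<in> ring_hom R C" and w: "w \<in> ring_hom R C"
    and G_eq: "\<And>g. g \<in> G \<Longrightarrow> v g = w g"
    and pow_eq: "\<And>r. r \<in> carrier R \<Longrightarrow> v (r [^] (p ^ N)) = w (r [^] (p ^ N))"
    and "r \<in> carrier R"
  shows "v r = w r"
  using pow_eq assms(6)
proof (induction N arbitrary: r)
  case (Suc N)
  interpret v: ring_hom_cring R C v using C v is_cring by (simp add: ring_hom_cring_of_hom)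
  interpret w: ring_hom_cring R C w using C w is_cring by (simp add: ring_hom_cring_of_hom)
  let ?q = "p ^ N"
  interpret q: ring_hom_cring R R "\<lambda>x. x [^] ?q"
    using frobenius_power_hom is_cring by (simp add: ring_hom_cring_of_hom)
  define M where "M = {r \<in> carrier R. v (r [^] ?q) = w (r [^] ?q)}"
  have "subring M R"
  proof (rule subringI)
    fix x y assume "x \<in> M" "y \<in> M"
    then show "\<ominus> x \<in> M" "x \<otimes> y \<in> M" "x \<oplus> y \<in> M"
      by (auto simp: M_def q.hom_a_inv q.hom_mult q.hom_add simp del: v.hom_pow w.hom_pow)
  qed (auto simp: M_def)
  moreover have "(\<lambda>r. r [^] p) ` carrier R \<union> G \<subseteq> M"
    using G G_eq Suc.prems(1) by (auto simp: M_def nat_pow_pow simp del: v.hom_pow w.hom_pow) (auto simp: subset_iff)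
  ultimately have "carrier R \<subseteq> M"
    using generate_ring_min_subring1[of "(\<lambda>r. r [^] p) ` carrier R \<union> G" M] gen G by auto
  then have "v (r [^] ?q) = w (r [^] ?q)" if "r \<in> carrier R" for r using that by (auto simp: M_def)
  then show ?case using Suc.IH Suc.prems(2) by blast
qed simp

end

section \<open>Integrability of derivations\<close>

lemma ring_hom_subset:
  "k \<subseteq> carrier R \<Longrightarrow> f \<in> ring_hom R S \<Longrightarrow> f \<in> ring_hom (R\<lparr>carrier := k\<rparr>) S"
  by (auto simp: ring_hom_def Pi_def subset_iff)

lemma nat_pow_subset: "x [^]\<^bsub>R\<lparr>carrier := k\<rparr>\<^esub> (n::nat) = x [^]\<^bsub>R\<^esub> n"
  by (simp add: nat_pow_def)

context abs_p_basis
begin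

theorem derivation_integrable:
  assumes k: "k \<subseteq> carrier R" and A: "A \<subseteq> G" "abs_p_basis (R\<lparr>carrier := k\<rparr>) p A"
    and \<delta>: "\<delta> \<in> Der R k"
  shows "\<delta> \<in> IDer R k"
proof -
  interpret k: abs_p_basis "R\<lparr>carrier := k\<rparr>" p A by fact
  have \<delta>_closed [simp]: "\<delta> x \<in> carrier R" if "x \<in> carrier R" for x
    using \<delta> that by (auto simp: Der_def linear_maps_def)
  have \<delta>_add: "\<delta> (x \<oplus> y) = \<delta> x \<oplus> \<delta> y" if "x \<in> carrier R" "y \<in> carrier R" for x y
    using \<delta> that by (auto simp: Der_def linear_maps_def)
  have \<delta>_mult: "\<delta> (x \<otimes> y) = x \<otimes> \<delta> y \<oplus> \<delta> x \<otimes> y" if "x \<in> carrier R" "y \<in> carrier R" for x y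
    using \<delta> that by (auto simp: Der_def)
  have \<delta>_scale: "\<delta> (c \<otimes> y) = c \<otimes> \<delta> y" if "c \<in> k" "y \<in> carrier R" for c y
    using \<delta> that by (auto simp: Der_def linear_maps_def)
  have \<delta>_one: "\<delta> \<one> = \<zero>"
    using \<delta>_mult[OF one_closed one_closed] by simp
  have \<delta>_const: "\<delta> c = \<zero>" if "c \<in> k" for c
    using \<delta>_scale[OF that one_closed] that k by (auto simp: \<delta>_one subset_iff)
  note [simp] = tlin_closed
  \<comment> \<open>The exponent \<open>p^n\<close> is merely a convenient power of \<open>p\<close>
    that is at least \<open>n\<close>.\<close>
  have "\<exists>v\<in>ring_hom R (trunc R n). (\<forall>g\<in>G. v g = tlin R n g (\<delta> g)) \<and>
      (\<forall>r\<in>carrier R. v (r [^] (p ^ n)) = tlin R n (r [^] (p ^ n)) \<zero>)" for n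
  proof (rule hom_extension_power[OF trunc_cring])
    show "(\<lambda>r. tlin R n (r [^] (p ^ n)) \<zero>) \<in> ring_hom R (trunc R n)"
      using ring_hom_trans[OF frobenius_power_hom tconst_hom] by (simp add: comp_def)
    show "(\<lambda>g. tlin R n g (\<delta> g)) \<in> G \<rightarrow> carrier (trunc R n)" using G by auto
    have "n \<le> p ^ n" using power_gt_expt[of p n] p_ge_2 by simp
    then show "tlin R n g (\<delta> g) [^]\<^bsub>trunc R n\<^esub> (p ^ n) = tlin R n (g [^] (p ^ n)) \<zero>" if "g \<in> G" for g
      using that G by (intro tlin_pow) auto
  qed
  then obtain \<phi> where \<phi>: "\<And>n. \<phi> n \<in> ring_hom R (trunc R n)"
    and \<phi>G: "\<And>n g. g \<in> G \<Longrightarrow> \<phi> n g = tlin R n g (\<delta> g)"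
    and \<phi>p: "\<And>n r. r \<in> carrier R \<Longrightarrow> \<phi> n (r [^] (p ^ n)) = tlin R n (r [^] (p ^ n)) \<zero>"
    by metis
  have \<phi>_closed: "\<phi> n r \<in> carrier (trunc R n)" if "r \<in> carrier R" for n r
    using ring_hom_closed[OF \<phi> that] .
  have \<phi>_coeff [simp]: "\<phi> n r i \<in> carrier R" if "r \<in> carrier R" for n r i
    using \<phi>_closed[OF that, of n] by (simp add: trunc_carrier)
  \<comment> \<open>Two truncation levels \<open>n \<le> l\<close> must be compared on a common set
    of powers; the \<open>p^l\<close>-th powers serve both.\<close>
  have \<phi>p': "\<phi> n (r [^] (p ^ l)) = tlin R n (r [^] (p ^ l)) \<zero>" if "r \<in> carrier R" "n \<le> l" for n l r
  proof -
    have "r [^] (p ^ l) = (r [^] (p ^ (l - n))) [^] (p ^ n)"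
      using that by (simp add: nat_pow_pow power_add[symmetric])
    then show ?thesis using \<phi>p[of "r [^] (p ^ (l - n))" n] that by simp
  qed
  have compat: "trestrict R n (\<phi> l r) = \<phi> n r" if "n \<le> l" "r \<in> carrier R" for n l r
  proof -
    have "(trestrict R n \<circ> \<phi> l) r = \<phi> n r"
    proof (rule hom_eqI[OF trunc_cring _ \<phi> _ _ that(2)])
      show "trestrict R n \<circ> \<phi> l \<in> ring_hom R (trunc R n)"
        by (rule ring_hom_trans[OF \<phi> trestrict_hom[OF that(1)]])
      have tr: "trestrict R n (tlin R l c d) = tlin R n c d" for c d
        using that by (auto simp: trestrict_def tlin_def)
      show "(trestrict R n \<circ> \<phi> l) g = \<phi> n g" if "g \<in> G" for g
        using that by (simp add: \<phi>G tr)
      show "(trestrict R n \<circ> \<phi> l) (s [^] (p ^ l)) = \<phi> n (s [^] (p ^ l))" if "s \<in> carrier R" for s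
        using that \<open>n \<le> l\<close> by (simp add: \<phi>p' tr)
    qed
    then show ?thesis by simp
  qed
  have coeff: "\<phi> n r i = \<phi> (Suc i) r i" if "i < n" "r \<in> carrier R" for n i r
    using compat[of "Suc i" n r] that by (auto simp: trestrict_def fun_eq_iff split: if_splits)
  have \<phi>1: "\<phi> 1 r = tlin R 1 r \<zero>" if "r \<in> carrier R" for r
    by (rule hom_eqI[OF trunc_cring \<phi> tconst_hom _ \<phi>p that]) (auto simp: \<phi>G tlin_def)
  \<comment> \<open>The right-hand side is a homomorphism because \<open>\<delta>\<close> is a
    derivation, and \<open>2 \<le> p^2\<close> makes it constant on \<open>p^2\<close>-th powers;
    uniqueness does the rest.\<close>
  have \<phi>2: "\<phi> 2 r = tlin R 2 r (\<delta> r)" if "r \<in> carrier R" for r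
  proof (rule hom_eqI[OF trunc_cring \<phi> _ \<phi>G _ that])
    show hom: "(\<lambda>r. tlin R 2 r (\<delta> r)) \<in> ring_hom R (trunc R 2)"
    proof (rule ring_hom_memI)
      fix x y assume xy: "x \<in> carrier R" "y \<in> carrier R"
      show "tlin R 2 (x \<otimes> y) (\<delta> (x \<otimes> y)) = tlin R 2 x (\<delta> x) \<otimes>\<^bsub>trunc R 2\<^esub> tlin R 2 y (\<delta> y)"
      proof
        fix i :: nat
        consider "i = 0" | "i = 1" | "i \<ge> 2" by linarith
        then show "tlin R 2 (x \<otimes> y) (\<delta> (x \<otimes> y)) i = (tlin R 2 x (\<delta> x) \<otimes>\<^bsub>trunc R 2\<^esub> tlin R 2 y (\<delta> y)) i"
          using xy by cases (auto simp: tlin_def trunc_simps \<delta>_mult a_comm)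
      qed
    qed (auto simp: \<delta>_add \<delta>_one, auto simp: tlin_def trunc_simps)
    interpret h: ring_hom_cring R "trunc R 2" "\<lambda>r. tlin R 2 r (\<delta> r)"
      using hom trunc_cring is_cring by (simp add: ring_hom_cring_of_hom)
    show "\<phi> 2 (s [^] (p ^ 2)) = tlin R 2 (s [^] (p ^ 2)) (\<delta> (s [^] (p ^ 2)))" if "s \<in> carrier R" for s
    proof -
      have "2 \<le> p ^ 2" using power_gt_expt[of p 2] p_ge_2 by simp
      then have "tlin R 2 s (\<delta> s) [^]\<^bsub>trunc R 2\<^esub> (p ^ 2) = tlin R 2 (s [^] (p ^ 2)) \<zero>"
        using that by (intro tlin_pow) auto
      then show ?thesis using that h.hom_pow[of s "p ^ 2"] by (simp add: \<phi>p)
    qed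
  qed
  \<comment> \<open>Uniqueness is applied over \<open>k\<close> with its own basis \<open>A\<close>:
    both maps are constant on \<open>A\<close>, where \<open>\<delta>\<close> vanishes, and on the
    \<open>p^n\<close>-th powers of \<open>k\<close>.\<close>
  have \<phi>k: "\<phi> n c = tlin R n c \<zero>" if "c \<in> k" for n c
  proof (rule k.hom_eqI[OF trunc_cring[of n], where v = "\<phi> n" and w = "\<lambda>c. tlin R n c \<zero>" and N = n])
    show "\<phi> n \<in> ring_hom (R\<lparr>carrier := k\<rparr>) (trunc R n)"
      "(\<lambda>c. tlin R n c \<zero>) \<in> ring_hom (R\<lparr>carrier := k\<rparr>) (trunc R n)"
      by (intro ring_hom_subset[OF k] \<phi> tconst_hom)+
    show "\<phi> n a = tlin R n a \<zero>" if "a \<in> A" for a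
    proof -
      have "a \<in> G" "a \<in> k" using that A(1) k.G by auto
      then show ?thesis using \<phi>G[of a n] \<delta>_const[of a] by simp
    qed
    show "\<phi> n (r [^]\<^bsub>R\<lparr>carrier := k\<rparr>\<^esub> p ^ n) = tlin R n (r [^]\<^bsub>R\<lparr>carrier := k\<rparr>\<^esub> p ^ n) \<zero>"
      if "r \<in> carrier (R\<lparr>carrier := k\<rparr>)" for r
      using that k \<phi>p[of r n] by (auto simp: nat_pow_subset)
    show "c \<in> carrier (R\<lparr>carrier := k\<rparr>)" using that by simp
  qed
  \<comment> \<open>Coefficient \<open>n\<close> is read at level \<open>Suc n\<close>, the first
    one at which it is not cut off; by \<open>coeff\<close> all higher levels agree.\<close>
  define D where "D n = (\<lambda>r\<in>carrier R. \<phi> (Suc n) r n)" for n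
  have "HS_derivation R k D"
    unfolding HS_derivation_def
  proof (intro conjI allI ballI)
    fix n
    show "D n \<in> linear_maps R k"
      unfolding linear_maps_def
    proof (intro CollectI conjI ballI)
      show "D n \<in> carrier R \<rightarrow>\<^sub>E carrier R" by (auto simp: D_def)
      show "D n (x \<oplus> y) = D n x \<oplus> D n y" if "x \<in> carrier R" "y \<in> carrier R" for x y
        using that by (simp add: D_def ring_hom_add[OF \<phi>] trunc_simps)
      show "D n (c \<otimes> x) = c \<otimes> D n x" if "c \<in> k" "x \<in> carrier R" for c x
        using that k trunc_const_mult[OF _ \<phi>_closed, of c x "Suc n"]
        by (auto simp: D_def ring_hom_mult[OF \<phi>] \<phi>k subset_iff)
    qed
  next
    show "D 0 x = x" if "x \<in> carrier R" for x
      using that \<phi>1 by (simp add: D_def tlin_def)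
  next
    fix n x y assume xy: "x \<in> carrier R" "y \<in> carrier R"
    have "D n (x \<otimes> y) = (\<Oplus>i\<in>{..n}. \<phi> (Suc n) x i \<otimes> \<phi> (Suc n) y (n - i))"
      using xy by (simp add: D_def ring_hom_mult[OF \<phi>] trunc_simps)
    also have "\<dots> = (\<Oplus>i\<in>{..n}. D i x \<otimes> D (n - i) y)"
    proof (rule add.finprod_cong')
      fix i assume "i \<in> {..n}"
      then show "\<phi> (Suc n) x i \<otimes> \<phi> (Suc n) y (n - i) = D i x \<otimes> D (n - i) y"
        using xy coeff[of i "Suc n" x] coeff[of "n - i" "Suc n" y] by (simp add: D_def)
    qed (use xy in \<open>auto simp: D_def\<close>)
    finally show "D n (x \<otimes> y) = (\<Oplus>i\<in>{..n}. D i x \<otimes> D (n - i) y)" .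
  qed
  moreover have "D 1 = \<delta>"
  proof (rule extensionalityI[of _ "carrier R"])
    show "\<delta> \<in> extensional (carrier R)" using \<delta> by (auto simp: Der_def linear_maps_def PiE_def)
    show "D 1 x = \<delta> x" if "x \<in> carrier R" for x
      using \<phi>2[OF that] that by (simp add: D_def tlin_def numeral_2_eq_2)
  qed (simp add: D_def)
  ultimately show ?thesis using \<delta> by (auto simp: IDer_def)
qed

end

section \<open>Existence of a \<open>p\<close>-basis of a field\<close>

lemma (in cring) trunc_lowest_coeff:
  assumes fg: "f \<in> carrier (trunc R n)" "g \<in> carrier (trunc R n)"
    and f: "\<And>i. i < a \<Longrightarrow> f i = \<zero>" and g: "\<And>i. i < b \<Longrightarrow> g i = \<zero>" and n: "a + b < n"
  shows "(f \<otimes>\<^bsub>trunc R n\<^esub> g) (a + b) = f a \<otimes> g b"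
proof -
  have c: "f i \<in> carrier R" "g i \<in> carrier R" for i using fg by (auto simp: trunc_carrier)
  have "(\<Oplus>j\<in>{..a + b}. f j \<otimes> g (a + b - j)) = (\<Oplus>j\<in>{..a + b}. if a = j then f j \<otimes> g (a + b - j) else \<zero>)"
  proof (rule add.finprod_cong')
    fix j assume "j \<in> {..a + b}"
    then show "f j \<otimes> g (a + b - j) = (if a = j then f j \<otimes> g (a + b - j) else \<zero>)"
      using f[of j] g[of "a + b - j"] c by (cases j a rule: linorder_cases) auto
  qed (use c in auto)
  also have "\<dots> = f a \<otimes> g b"
    by (subst add.finprod_singleton) (use c in auto)
  finally show ?thesis using n by (simp add: trunc_simps)
qed

lemma (in cring) trunc_lin_mult:
  assumes f: "f \<in> carrier (trunc R n)" and c: "c \<in> carrier R"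
  shows "(tlin R n c \<one> \<otimes>\<^bsub>trunc R n\<^esub> f) 0 = c \<otimes> f 0"
    and "Suc i < n \<Longrightarrow> (tlin R n c \<one> \<otimes>\<^bsub>trunc R n\<^esub> f) (Suc i) = c \<otimes> f (Suc i) \<oplus> f i"
proof -
  have fc: "f i \<in> carrier R" for i using f by (auto simp: trunc_carrier)
  show "(tlin R n c \<one> \<otimes>\<^bsub>trunc R n\<^esub> f) 0 = c \<otimes> f 0"
    using fc[of 0] c f by (cases "n = 0") (auto simp: trunc_simps tlin_def trunc_carrier)
  assume i: "Suc i < n"
  let ?t = "\<lambda>j. tlin R n c \<one> j \<otimes> f (Suc i - j)"
  have t: "?t j \<in> carrier R" for j using c fc by (simp add: tlin_def)
  have "(\<Oplus>j\<in>{..Suc i}. ?t j) = (\<Oplus>j\<in>{..i}. ?t (Suc j)) \<oplus> ?t 0"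
    by (rule finsum_Suc2) (use t in auto)
  also have "(\<Oplus>j\<in>{..i}. ?t (Suc j)) = (\<Oplus>j\<in>{..i}. if 0 = j then f (i - j) else \<zero>)"
    by (rule add.finprod_cong') (use i fc in \<open>auto simp: tlin_def\<close>)
  also have "\<dots> = f i" by (subst add.finprod_singleton) (use fc in auto)
  finally show "(tlin R n c \<one> \<otimes>\<^bsub>trunc R n\<^esub> f) (Suc i) = c \<otimes> f (Suc i) \<oplus> f i"
    using i c fc by (simp add: trunc_simps tlin_def a_comm)
qed

section \<open>Fields of characteristic \<open>p\<close> and adjoining a \<open>p\<close>-th
  root\<close>

locale char_p_field = field + char_p_cring
begin

lemma multiple_one_nonzero:
  assumes "0 < d" "d < p"
  shows "add_pow R d \<one> \<noteq> \<zero>"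
proof
  assume d: "add_pow R d \<one> = \<zero>"
  have "coprime d p" using p assms by (metis coprime_commute prime_imp_coprime_nat dvd_imp_le not_le)
  then obtain x y where "d * x = p * y + 1"
    using bezout_nat[of d p] assms by (auto simp: coprime_iff_gcd_eq_1)
  then have "add_pow R (d * x) \<one> = add_pow R (p * y) \<one> \<oplus> \<one>"
    by (simp add: add.nat_pow_Suc)
  moreover have "add_pow R (d * x) \<one> = \<zero>" "add_pow R (p * y) \<one> = \<zero>"
    using d char by (simp_all add: add.nat_pow_pow[symmetric])
  ultimately show False by simp
qed

end

text \<open>The aim is that \<open>c\<close> has degree \<open>p\<close> over the subfield
  \<open>L\<close>. Polynomials over \<open>L\<close> of degree below \<open>p\<close> are replaced
  by their values at \<open>w = c + \<epsilon>\<close> in \<open>R[\<epsilon>]/\<epsilon>^p\<close>: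
  the powers of \<open>w\<close> stay independent there, while \<open>w^p = c^p\<close> still
  holds.\<close>

locale purely_inseparable_step = char_p_field +
  fixes L c
  assumes L: "subring L R" and L_inv: "\<And>x. x \<in> L \<Longrightarrow> x \<noteq> \<zero> \<Longrightarrow> inv x \<in> L"
    and c: "c \<in> carrier R" "c [^] p \<in> L" "c \<notin> L"
begin

abbreviation T where "T \<equiv> trunc R p"
abbreviation const where "const e \<equiv> tlin R p e \<zero>"
abbreviation w where "w \<equiv> tlin R p c \<one>"
abbreviation wp where "wp n \<equiv> w [^]\<^bsub>T\<^esub> (n::nat)"

sublocale T: cring T by (rule trunc_cring)

lemma L_closed [simp]: "e \<in> L \<Longrightarrow> e \<in> carrier R"
  using subringE(1)[OF L] by blast

lemma const_closed [simp]: "e \<in> carrier R \<Longrightarrow> const e \<in> carrier T"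
  by (simp add: tlin_closed)

lemma w_closed [simp]: "w \<in> carrier T"
  using c by (simp add: tlin_closed)

sublocale const: ring_hom_cring R T const
  using tconst_hom is_cring T.is_cring by (simp add: ring_hom_cring_of_hom)

primrec W :: "nat \<Rightarrow> (nat \<Rightarrow> 'a) set" where
  "W 0 = {\<zero>\<^bsub>T\<^esub>}"
| "W (Suc n) = {z \<oplus>\<^bsub>T\<^esub> const e \<otimes>\<^bsub>T\<^esub> wp n | z e. z \<in> W n \<and> e \<in> L}"

lemma W_SucI: "z \<in> W n \<Longrightarrow> e \<in> L \<Longrightarrow> z \<oplus>\<^bsub>T\<^esub> const e \<otimes>\<^bsub>T\<^esub> wp n \<in> W (Suc n)"
  by auto

lemma W_closed: "z \<in> W n \<Longrightarrow> z \<in> carrier T"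
  by (induction n arbitrary: z) auto

lemma W_mono: "z \<in> W n \<Longrightarrow> z \<in> W (Suc n)"
  using W_SucI[of z n \<zero>] subringE(2)[OF L] W_closed[of z n] by simp

lemma W_zero: "\<zero>\<^bsub>T\<^esub> \<in> W n"
  by (induction n) (use W_mono in auto)

lemma W_add: "y \<in> W n \<Longrightarrow> z \<in> W n \<Longrightarrow> y \<oplus>\<^bsub>T\<^esub> z \<in> W n"
proof (induction n arbitrary: y z)
  case (Suc n)
  then obtain y' e z' f where *: "y = y' \<oplus>\<^bsub>T\<^esub> const e \<otimes>\<^bsub>T\<^esub> wp n" "y' \<in> W n" "e \<in> L"
    "z = z' \<oplus>\<^bsub>T\<^esub> const f \<otimes>\<^bsub>T\<^esub> wp n" "z' \<in> W n" "f \<in> L" by auto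
  have eq: "y \<oplus>\<^bsub>T\<^esub> z = (y' \<oplus>\<^bsub>T\<^esub> z') \<oplus>\<^bsub>T\<^esub> const (e \<oplus> f) \<otimes>\<^bsub>T\<^esub> wp n"
    using * W_closed by (simp add: T.l_distr T.a_ac)
  show ?case unfolding eq by (intro W_SucI Suc.IH subringE(7)[OF L] *)
qed simp

lemma W_scale: "z \<in> W n \<Longrightarrow> e \<in> L \<Longrightarrow> const e \<otimes>\<^bsub>T\<^esub> z \<in> W n"
proof (induction n arbitrary: z)
  case (Suc n)
  then obtain z' f where *: "z = z' \<oplus>\<^bsub>T\<^esub> const f \<otimes>\<^bsub>T\<^esub> wp n" "z' \<in> W n" "f \<in> L" by auto
  have eq: "const e \<otimes>\<^bsub>T\<^esub> z = const e \<otimes>\<^bsub>T\<^esub> z' \<oplus>\<^bsub>T\<^esub> const (e \<otimes> f) \<otimes>\<^bsub>T\<^esub> wp n"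
    using * W_closed Suc.prems by (simp add: T.r_distr T.m_assoc)
  show ?case unfolding eq by (intro W_SucI Suc.IH subringE(6)[OF L] * Suc.prems)
qed simp

lemma W_neg: "z \<in> W n \<Longrightarrow> \<ominus>\<^bsub>T\<^esub> z \<in> W n"
  using W_scale[of z n "\<ominus> \<one>"] subringE(3,5)[OF L] W_closed[of z n] by (simp add: T.l_minus)

lemma W_shift: "z \<in> W n \<Longrightarrow> w \<otimes>\<^bsub>T\<^esub> z \<in> W (Suc n)"
proof (induction n arbitrary: z)
  case (Suc n)
  then obtain z' f where *: "z = z' \<oplus>\<^bsub>T\<^esub> const f \<otimes>\<^bsub>T\<^esub> wp n" "z' \<in> W n" "f \<in> L" by auto
  have "w \<otimes>\<^bsub>T\<^esub> z = w \<otimes>\<^bsub>T\<^esub> z' \<oplus>\<^bsub>T\<^esub> const f \<otimes>\<^bsub>T\<^esub> wp (Suc n)"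
    using * W_closed by (simp add: T.r_distr T.m_ac)
  then show ?case using * Suc.IH W_SucI[of "w \<otimes>\<^bsub>T\<^esub> z'" "Suc n" f] by simp
next
  case 0
  then have "w \<otimes>\<^bsub>T\<^esub> z = \<zero>\<^bsub>T\<^esub>" by simp
  then show ?case by (simp only: W_zero)
qed

lemma W_const: "e \<in> L \<Longrightarrow> const e \<in> W (Suc n)"
proof (induction n)
  case 0
  then show ?case using W_SucI[of "\<zero>\<^bsub>T\<^esub>" 0 e] by simp
qed (blast intro: W_mono)

text \<open>Of the expansion of \<open>(c + \<epsilon>)^n\<close> only the two highest coefficients,
  \<open>1\<close> and \<open>n c\<close>, are needed; multiplication by \<open>w\<close> gives them
  recursively.\<close>

lemma w_pow_coeff:
  "i > n \<Longrightarrow> (wp n) i = \<zero>" "n < p \<Longrightarrow> (wp n) n = \<one>"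
  "Suc n < p \<Longrightarrow> (wp (Suc n)) n = add_pow R (Suc n) c"
proof -
  have cl: "wp n \<in> carrier T" for n :: nat by simp
  have rec: "(wp (Suc n)) (Suc i) = c \<otimes> (wp n) (Suc i) \<oplus> (wp n) i"
    "(wp (Suc n)) 0 = c \<otimes> (wp n) 0"
    if "Suc i < p" for n i :: nat
  proof -
    have "wp (Suc n) = w \<otimes>\<^bsub>T\<^esub> wp n" by (simp add: T.m_comm)
    then show "(wp (Suc n)) (Suc i) = c \<otimes> (wp n) (Suc i) \<oplus> (wp n) i"
      "(wp (Suc n)) 0 = c \<otimes> (wp n) 0"
      using trunc_lin_mult(1)[OF cl c(1), of n] trunc_lin_mult(2)[OF cl c(1) that, of n]
      by (simp_all only:)
  qed
  have out: "(wp n) i = \<zero>" if "i \<ge> p" for n i :: nat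
    using cl[of n] that by (simp add: trunc_carrier)
  show hi: "(wp n) i = \<zero>" if "i > n" for n i :: nat
    using that
  proof (induction n arbitrary: i)
    case (Suc n)
    then obtain j where j: "i = Suc j" "n < j" by (cases i) auto
    show ?case
    proof (cases "i < p")
      case True
      then show ?thesis using rec(1)[of j n] j Suc.IH[of j] Suc.IH[of i] c by simp
    next
      case False
      then show ?thesis using out by (meson not_le)
    qed
  qed (simp add: trunc_simps)
  show one: "(wp n) n = \<one>" if "n < p" for n :: nat
    using that
  proof (induction n)
    case (Suc n)
    then show ?case using rec(1)[of n n] hi[of n "Suc n"] c by simp
  qed (simp add: trunc_simps)
  show "(wp (Suc n)) n = add_pow R (Suc n) c" if "Suc n < p" for n :: nat
    using that
  proof (induction n)
    case 0
    then show ?case using rec(2)[of 0 0] one[of 0] c by (simp del: T.nat_pow_Suc)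
  next
    case (Suc n)
    then show ?case using rec(1)[of n "Suc n"] one[of "Suc n"] c by (simp add: add.nat_pow_Suc a_comm del: T.nat_pow_Suc)
  qed
qed

lemma W_coeff: "z \<in> W n \<Longrightarrow> i \<ge> n \<Longrightarrow> z i = \<zero>"
proof (induction n arbitrary: z)
  case (Suc n)
  then obtain z' f where *: "z = z' \<oplus>\<^bsub>T\<^esub> const f \<otimes>\<^bsub>T\<^esub> wp n" "z' \<in> W n" "f \<in> L" by auto
  then show ?case
    using Suc.IH[of z'] Suc.prems trunc_const_mult[of f "wp n" p] w_pow_coeff(1)[of n i]
    by (simp add: trunc_simps(4))
qed (simp add: trunc_simps)

text \<open>
  \<open>W n\<close> consists of the values at \<open>w = c + \<epsilon>\<close> of the polynomials over \<open>L\<close> of degree below \<open>n\<close>, and the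
  constant coefficient of such a value is the value at \<open>c\<close>.  A monic relation \<open>g\<close> of \<open>c\<close> of least
  degree \<open>d < p\<close> divides \<open>X\<^sup>p - c\<^sup>p\<close>, say with quotient \<open>H\<close>; at \<open>w\<close> this reads \<open>g H = 0\<close>.  Comparing
  orders in \<open>\<epsilon>\<close> forces \<open>g = (X - c)\<^sup>d\<close>, whose coefficient \<open>- d c\<close> lies in \<open>L\<close>, so \<open>c \<in> L\<close>.
\<close>

lemma no_relation:
  assumes "z \<in> W p" "z 0 = \<zero>"
  shows "z = \<zero>\<^bsub>T\<^esub>"
proof (rule ccontr)
  assume nz: "z \<noteq> \<zero>\<^bsub>T\<^esub>"
  define N where "N = (LEAST n. \<exists>z\<in>W n. z \<noteq> \<zero>\<^bsub>T\<^esub> \<and> z 0 = \<zero>)"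
  have "\<exists>z\<in>W N. z \<noteq> \<zero>\<^bsub>T\<^esub> \<and> z 0 = \<zero>"
    unfolding N_def by (rule LeastI[of _ p]) (use assms nz in blast)
  then obtain y where y: "y \<in> W N" "y \<noteq> \<zero>\<^bsub>T\<^esub>" "y 0 = \<zero>" by blast
  have "N \<le> p" unfolding N_def by (rule Least_le) (use assms nz in blast)
  have min: "z = \<zero>\<^bsub>T\<^esub>" if "z \<in> W n" "n < N" "z 0 = \<zero>" for z n
    using not_less_Least[OF that(2)[unfolded N_def]] that by blast
  obtain d where d: "N = Suc d" using y by (cases N) auto
  then obtain y' e where y': "y = y' \<oplus>\<^bsub>T\<^esub> const e \<otimes>\<^bsub>T\<^esub> wp d" "y' \<in> W d" "e \<in> L"
    using y(1) by auto
  have "e \<noteq> \<zero>"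
    using y' y min[of y' d] d W_closed[of y' d] by auto
  then have inv: "inv e \<in> L" "inv e \<otimes> e = \<one>" using y' L_inv field_Units by auto
  define g0 where "g0 = const (inv e) \<otimes>\<^bsub>T\<^esub> y'"
  define g where "g = g0 \<oplus>\<^bsub>T\<^esub> wp d"
  have g0: "g0 \<in> W d" "g0 \<in> carrier T" unfolding g0_def using y' inv W_scale W_closed by auto
  have gT: "g \<in> carrier T" using g0 by (simp add: g_def)
  have "g = const (inv e) \<otimes>\<^bsub>T\<^esub> y"
    unfolding g_def g0_def y'(1) using y' inv W_closed[of y' d]
    by (simp add: T.r_distr T.m_assoc[symmetric] const.hom_mult[symmetric])
  then have g_0: "g 0 = \<zero>"
    using y inv trunc_const_mult[of "inv e" y p] W_closed[of y N] by simp
  have dp: "d < p" using d \<open>N \<le> p\<close> by simp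
  have g_d: "g d = \<one>"
    using W_coeff[OF g0(1), of d] w_pow_coeff(2)[OF dp] by (simp add: g_def trunc_simps)
  then have d0: "0 < d" using g_0 by (cases d) auto
  have wd: "wp d = g \<oplus>\<^bsub>T\<^esub> \<ominus>\<^bsub>T\<^esub> g0"
    unfolding g_def using g0 by (simp add: T.a_ac T.r_neg2)
  \<comment> \<open>Division of \<open>X^(d+n)\<close> by the monic \<open>g\<close>, carried out on
    values at \<open>w\<close>: the quotient is monic of degree \<open>n\<close>, the remainder has
    degree below \<open>d\<close>.\<close>
  have division: "\<exists>q\<in>W n. \<exists>r\<in>W d. wp (d + n) = g \<otimes>\<^bsub>T\<^esub> (wp n \<oplus>\<^bsub>T\<^esub> q) \<oplus>\<^bsub>T\<^esub> r" for n
  proof (induction n)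
    case 0
    show ?case using wd gT W_neg[OF g0(1)] by (intro bexI[of _ "\<zero>\<^bsub>T\<^esub>"] bexI[of _ "\<ominus>\<^bsub>T\<^esub> g0"]) auto
  next
    case (Suc n)
    then obtain q r where q: "q \<in> W n" and r: "r \<in> W d"
      and eq: "wp (d + n) = g \<otimes>\<^bsub>T\<^esub> (wp n \<oplus>\<^bsub>T\<^esub> q) \<oplus>\<^bsub>T\<^esub> r" by blast
    obtain r' f where r': "w \<otimes>\<^bsub>T\<^esub> r = r' \<oplus>\<^bsub>T\<^esub> const f \<otimes>\<^bsub>T\<^esub> wp d" "r' \<in> W d" "f \<in> L"
      using W_shift[OF r] by auto
    have cl: "q \<in> carrier T" "r \<in> carrier T" "r' \<in> carrier T" "f \<in> carrier R"
      using q r r' W_closed by auto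
    have "wp (d + Suc n) = w \<otimes>\<^bsub>T\<^esub> (g \<otimes>\<^bsub>T\<^esub> (wp n \<oplus>\<^bsub>T\<^esub> q) \<oplus>\<^bsub>T\<^esub> r)"
      unfolding eq[symmetric] by (simp add: T.m_comm)
    also have "\<dots> = g \<otimes>\<^bsub>T\<^esub> (wp (Suc n) \<oplus>\<^bsub>T\<^esub> w \<otimes>\<^bsub>T\<^esub> q) \<oplus>\<^bsub>T\<^esub> w \<otimes>\<^bsub>T\<^esub> r"
      using cl gT by (simp add: T.r_distr T.m_ac)
    also have "\<dots> = g \<otimes>\<^bsub>T\<^esub> (wp (Suc n) \<oplus>\<^bsub>T\<^esub> w \<otimes>\<^bsub>T\<^esub> q) \<oplus>\<^bsub>T\<^esub> (r' \<oplus>\<^bsub>T\<^esub> const f \<otimes>\<^bsub>T\<^esub> (g \<oplus>\<^bsub>T\<^esub> \<ominus>\<^bsub>T\<^esub> g0))"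
      unfolding r'(1) wd ..
    also have "\<dots> = g \<otimes>\<^bsub>T\<^esub> (wp (Suc n) \<oplus>\<^bsub>T\<^esub> (w \<otimes>\<^bsub>T\<^esub> q \<oplus>\<^bsub>T\<^esub> const f)) \<oplus>\<^bsub>T\<^esub> (r' \<oplus>\<^bsub>T\<^esub> \<ominus>\<^bsub>T\<^esub> (const f \<otimes>\<^bsub>T\<^esub> g0))"
      using cl gT g0 by (simp add: T.r_distr T.m_ac T.a_ac T.r_minus T.l_minus del: T.nat_pow_Suc)
    finally show ?case
      using q r' W_shift W_const W_add W_neg W_scale g0(1) by (metis (no_types, lifting))
  qed
  obtain q r where q: "q \<in> W (p - d)" and r: "r \<in> W d"
    and eq: "wp p = g \<otimes>\<^bsub>T\<^esub> (wp (p - d) \<oplus>\<^bsub>T\<^esub> q) \<oplus>\<^bsub>T\<^esub> r"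
    using division[of "p - d"] dp by auto
  define H where "H = wp (p - d) \<oplus>\<^bsub>T\<^esub> q"
  have HT: "H \<in> carrier T" and rT: "r \<in> carrier T" using q r W_closed by (auto simp: H_def)
  have Hc: "H i \<in> carrier R" and gc: "g i \<in> carrier R" for i using HT gT by (auto simp: trunc_carrier)
  have wp: "wp p = const (c [^] p)" using tlin_pow[of c \<one> p 1] c by simp
  have cp: "c [^] p = r 0"
  proof -
    have "c [^] p = const (c [^] p) 0" using p_ge_2 by (simp add: tlin_def)
    also have "\<dots> = (g \<otimes>\<^bsub>T\<^esub> H) 0 \<oplus> r 0" using eq wp by (simp add: H_def trunc_simps(4))
    also have "(g \<otimes>\<^bsub>T\<^esub> H) 0 = \<zero>" using g_0 Hc p_ge_2 by (simp add: trunc_simps)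
    finally show ?thesis using rT by (simp add: trunc_carrier)
  qed
  \<comment> \<open>The remainder takes the value \<open>c^p\<close> at \<open>c\<close>. Its
    difference to the constant \<open>c^p\<close> is therefore a relation of degree below
    \<open>d\<close>, and minimality makes it zero.\<close>
  have "const (c [^] p) \<oplus>\<^bsub>T\<^esub> \<ominus>\<^bsub>T\<^esub> r = \<zero>\<^bsub>T\<^esub>"
  proof (rule min[of _ d])
    have "const (c [^] p) \<in> W d" using W_const[of "c [^] p" "d - 1"] c d0 by simp
    then show "const (c [^] p) \<oplus>\<^bsub>T\<^esub> \<ominus>\<^bsub>T\<^esub> r \<in> W d" using W_add W_neg[OF r] by blast
    interpret e: ring_hom_cring T R "\<lambda>f. f 0"
      using tcoeff0_hom p_ge_2 is_cring T.is_cring by (simp add: ring_hom_cring_of_hom)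
    have "(const (c [^] p) \<oplus>\<^bsub>T\<^esub> \<ominus>\<^bsub>T\<^esub> r) 0 = const (c [^] p) 0 \<oplus> (\<ominus>\<^bsub>T\<^esub> r) 0"
      by (rule e.hom_add) (use c rT in auto)
    also have "const (c [^] p) 0 = c [^] p" using p_ge_2 by (simp add: tlin_def)
    also have "(\<ominus>\<^bsub>T\<^esub> r) 0 = \<ominus> (c [^] p)" unfolding cp by (rule e.hom_a_inv[OF rT])
    finally show "(const (c [^] p) \<oplus>\<^bsub>T\<^esub> \<ominus>\<^bsub>T\<^esub> r) 0 = \<zero>" using c by (simp add: r_neg)
  qed (use d in simp)
  then have "const (c [^] p) \<ominus>\<^bsub>T\<^esub> r = \<zero>\<^bsub>T\<^esub>" by (simp only: T.minus_eq)
  then have "const (c [^] p) = r" using T.r_right_minus_eq[of "const (c [^] p)" r] c rT by blast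
  then have gH: "g \<otimes>\<^bsub>T\<^esub> H = \<zero>\<^bsub>T\<^esub>"
    using eq wp gT HT rT by (simp add: H_def[symmetric])
  have H_pd: "H (p - d) = \<one>"
    using W_coeff[OF q, of "p - d"] w_pow_coeff(2)[of "p - d"] d0 p_ge_2 by (simp add: H_def trunc_simps)
  define i where "i = (LEAST i. g i \<noteq> \<zero>)"
  define j where "j = (LEAST i. H i \<noteq> \<zero>)"
  have i: "g i \<noteq> \<zero>" "i \<le> d" "\<And>i'. i' < i \<Longrightarrow> g i' = \<zero>"
    unfolding i_def using LeastI[of "\<lambda>i. g i \<noteq> \<zero>" d] Least_le[of "\<lambda>i. g i \<noteq> \<zero>" d] g_d not_less_Least by auto
  have j: "H j \<noteq> \<zero>" "j \<le> p - d" "\<And>i'. i' < j \<Longrightarrow> H i' = \<zero>"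
    unfolding j_def using LeastI[of "\<lambda>i. H i \<noteq> \<zero>" "p - d"] Least_le[of "\<lambda>i. H i \<noteq> \<zero>" "p - d"] H_pd not_less_Least by auto
  \<comment> \<open>The orders of \<open>g\<close> and \<open>H\<close> are at most \<open>d\<close>
    and \<open>p - d\<close>. Over a field the lowest coefficients multiply to something nonzero, so
    \<open>g H = 0\<close> pushes the sum of the orders to \<open>p\<close> and both bounds are
    attained.\<close>
  have "\<not> i + j < p"
  proof
    assume "i + j < p"
    then have "(g \<otimes>\<^bsub>T\<^esub> H) (i + j) = g i \<otimes> H j"
      by (intro trunc_lowest_coeff gT HT i(3) j(3))
    then have "g i \<otimes> H j = \<zero>" using gH by (simp add: trunc_simps(3))
    then show False using i(1) j(1) integral[OF _ gc Hc] by blast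
  qed
  then have "i = d" using i j dp by linarith
  \<comment> \<open>Now the coefficient of \<open>\<epsilon>^(d-1)\<close> in \<open>g\<close> is
    computed a second time: \<open>f\<close> comes from \<open>g0\<close> and \<open>d c\<close>
    from \<open>w^d\<close>.\<close>
  then have "g (d - 1) = \<zero>" using i(3)[of "d - 1"] d0 by simp
  moreover obtain g1 f where g1: "g0 = g1 \<oplus>\<^bsub>T\<^esub> const f \<otimes>\<^bsub>T\<^esub> wp (d - 1)" "g1 \<in> W (d - 1)" "f \<in> L"
    using g0(1) d0 by (cases d) auto
  moreover have "g0 (d - 1) = f"
    using W_coeff[OF g1(2), of "d - 1"] w_pow_coeff(2)[of "d - 1"] dp g1 trunc_const_mult[of f "wp (d - 1)" p]
    by (simp add: trunc_simps(4))
  moreover have "(wp d) (d - 1) = add_pow R d c"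
    using w_pow_coeff(3)[of "d - 1"] d0 dp by simp
  ultimately have "f \<oplus> add_pow R d c = \<zero>" by (simp add: g_def trunc_simps(4))
  moreover have "add_pow R d c = add_pow R d \<one> \<otimes> c"
    using c by (simp add: add_pow_ldistr)
  ultimately have eq: "add_pow R d \<one> \<otimes> c = \<ominus> f"
    using c g1 minus_equality[of "add_pow R d \<one> \<otimes> c" f] by (simp add: a_comm)
  have dL: "add_pow R n \<one> \<in> L" for n :: nat
    by (induction n) (use subringE(2,3,7)[OF L] in \<open>simp_all add: add.nat_pow_Suc\<close>)
  have dnz: "add_pow R d \<one> \<noteq> \<zero>" using multiple_one_nonzero d0 dp by blast
  have "c = inv (add_pow R d \<one>) \<otimes> (add_pow R d \<one> \<otimes> c)"
    using c dnz field_Units by (simp add: m_assoc[symmetric])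
  also have "\<dots> \<in> L"
    unfolding eq using L_inv[OF dL dnz] subringE(5,6)[OF L] g1 by blast
  finally show False using c by blast
qed


text \<open>The given relation is the constant coefficient of \<open>Z p\<close>, so
  \<open>no_relation\<close> makes all of \<open>Z p\<close> vanish. Each \<open>w^n\<close> has
  leading term \<open>\<epsilon>^n\<close>, and the coefficients \<open>e i\<close> can be read off
  from the top.\<close>

lemma powers_independent:
  assumes e: "\<And>i. e i \<in> L" and rel: "(\<Oplus>i\<in>{..<p}. e i \<otimes> c [^] i) = \<zero>" and "i < p"
  shows "e i = \<zero>"
proof -
  define Z where "Z n = (\<Oplus>\<^bsub>T\<^esub>i\<in>{..<n}. const (e i) \<otimes>\<^bsub>T\<^esub> wp i)" for n :: nat
  have Z_Suc: "Z (Suc n) = Z n \<oplus>\<^bsub>T\<^esub> const (e n) \<otimes>\<^bsub>T\<^esub> wp n" for n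
    unfolding Z_def lessThan_Suc
    by (subst T.finsum_insert) (use e in \<open>auto intro!: T.a_comm T.finsum_closed\<close>)
  have ZW: "Z n \<in> W n" for n
  proof (induction n)
    case 0 show ?case by (simp add: Z_def)
  next
    case (Suc n) then show ?case unfolding Z_Suc by (intro W_SucI e)
  qed
  interpret h: ring_hom_cring T R "\<lambda>f. f 0"
    using tcoeff0_hom p_ge_2 is_cring T.is_cring by (simp add: ring_hom_cring_of_hom)
  have w0: "(wp n) 0 = c [^] n" for n :: nat
    using h.hom_pow[OF w_closed, of n] p_ge_2 by (simp add: tlin_def)
  have "Z n 0 = (\<Oplus>i\<in>{..<n}. e i \<otimes> c [^] i)" for n
  proof (induction n)
    case (Suc n)
    have "Z (Suc n) 0 = Z n 0 \<oplus> (const (e n) \<otimes>\<^bsub>T\<^esub> wp n) 0"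
      unfolding Z_Suc by (simp add: trunc_simps(4))
    also have "(const (e n) \<otimes>\<^bsub>T\<^esub> wp n) 0 = e n \<otimes> c [^] n"
      using e trunc_const_mult[of "e n" "wp n" p] by (simp add: w0)
    finally show ?case
      unfolding lessThan_Suc using Suc.IH e c
      by (subst finsum_insert) (auto intro!: a_comm finsum_closed)
  qed (simp add: Z_def trunc_simps)
  then have "Z p = \<zero>\<^bsub>T\<^esub>" using no_relation[OF ZW] rel by simp
  moreover have "Z n = \<zero>\<^bsub>T\<^esub> \<Longrightarrow> i < n \<Longrightarrow> n \<le> p \<Longrightarrow> e i = \<zero>" for n
  proof (induction n)
    case (Suc n)
    have "Z (Suc n) n = Z n n \<oplus> (const (e n) \<otimes>\<^bsub>T\<^esub> wp n) n"
      unfolding Z_Suc by (simp add: trunc_simps(4))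
    also have "Z n n = \<zero>" by (rule W_coeff[OF ZW order_refl])
    also have "(const (e n) \<otimes>\<^bsub>T\<^esub> wp n) n = e n"
      using e trunc_const_mult[of "e n" "wp n" p] w_pow_coeff(2)[of n] Suc.prems by simp
    finally have en: "e n = \<zero>" using Suc.prems(1) e by (simp add: trunc_simps(3))
    then have "Z n = \<zero>\<^bsub>T\<^esub>" using Z_Suc[of n] Suc.prems(1) W_closed[OF ZW] by simp
    then show ?case using Suc en by (cases "i = n") auto
  qed simp
  ultimately show ?thesis using \<open>i < p\<close> by blast
qed

end

lemma (in domain) pow_eq_zero:
  "x \<in> carrier R \<Longrightarrow> x [^] (n::nat) = \<zero> \<Longrightarrow> x = \<zero>"
  by (induction n) (auto simp: integral_iff)

lemma (in ring) subring_finsum_closed: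
  assumes S: "subring S R" and "finite F" "\<And>i. i \<in> F \<Longrightarrow> f i \<in> S"
  shows "(\<Oplus>i\<in>F. f i) \<in> S"
  using assms(2,3)
proof (induction F rule: finite_induct)
  case (insert i F)
  have "(\<Oplus>i\<in>insert i F. f i) = f i \<oplus> (\<Oplus>i\<in>F. f i)"
    by (rule finsum_insert) (use insert subringE(1)[OF S] in auto)
  then show ?case using insert subringE(7)[OF S] by simp
qed (use subringE(2)[OF S] in simp)

lemma (in cring) monomial_in_subring:
  assumes S: "subring S R" and \<alpha>: "{b. \<alpha> b \<noteq> 0} \<subseteq> S"
  shows "monomial R \<alpha> \<in> S"
proof (cases "finite {b. \<alpha> b \<noteq> 0}")
  case True
  have "finite T \<Longrightarrow> T \<subseteq> S \<Longrightarrow> finprod R (\<lambda>b. b [^] \<alpha> b) T \<in> S" for T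
  proof (induction T rule: finite_induct)
    case (insert b T)
    have pow: "b [^] n \<in> S" for n :: nat
      by (induction n) (use insert subringE(3,6)[OF S] in auto)
    have "finprod R (\<lambda>b. b [^] \<alpha> b) (insert b T) = b [^] \<alpha> b \<otimes> finprod R (\<lambda>b. b [^] \<alpha> b) T"
      by (rule finprod_insert) (use insert subringE(1)[OF S] in auto)
    then show ?case using pow insert subringE(6)[OF S] by auto
  qed (use subringE(3)[OF S] in simp)
  then show ?thesis using True \<alpha> by (simp add: monomial_def)
qed (use subringE(3)[OF S] in \<open>simp add: monomial_def\<close>)

section \<open>Independence modulo an ideal and in towers\<close>

context char_p_cring
begin

text \<open>For \<open>I = 0\<close>, and \<open>A\<close> a \<open>p\<close>-basis of \<open>k\<close>, this is linear disjointness of \<open>R\<^sup>p\<close> and \<open>k\<close> over \<open>k\<^sup>p\<close>.\<close>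

definition independent_mod :: "'a set \<Rightarrow> 'a set \<Rightarrow> bool" where
  "independent_mod A I \<longleftrightarrow> (\<forall>F c \<alpha>. F \<subseteq> p_exponents p A \<longrightarrow> finite F \<longrightarrow> c \<in> F \<rightarrow> carrier R \<longrightarrow>
     psum F c \<in> I \<longrightarrow> \<alpha> \<in> F \<longrightarrow> c \<alpha> \<in> I)"

lemma independent_modD:
  "\<lbrakk>independent_mod A I; F \<subseteq> p_exponents p A; finite F; c \<in> F \<rightarrow> carrier R;
    psum F c \<in> I; \<alpha> \<in> F\<rbrakk> \<Longrightarrow> c \<alpha> \<in> I"
  unfolding independent_mod_def by blast

text \<open>The tower argument. Grouping a relation by the \<open>B\<close>-part of its monomials
  leaves inner sums in \<open>S\<close>; independence of \<open>B\<close> over \<open>S\<close>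
  annihilates these, and independence of \<open>A\<close> then annihilates the coefficients. It
  serves both for enlarging a \<open>p\<close>-independent set of a field and for joining
  \<open>A\<close> and \<open>B\<close>.\<close>

lemma independent_join:
  assumes A: "A \<subseteq> carrier R" and B: "B \<subseteq> carrier R" and ind: "independent_mod A {\<zero>}"
    and S: "subring S R" and powS: "\<And>r. r \<in> carrier R \<Longrightarrow> r [^] p \<in> S" and AS: "A \<subseteq> S"
    and Bind: "lin_independent_family R S (p_exponents p B) (monomial R)"
  shows "independent_mod (A \<union> B) {\<zero>}"
  unfolding independent_mod_def
proof (intro allI impI)
  fix F c \<alpha>0
  assume F: "F \<subseteq> p_exponents p (A \<union> B)" "finite F" and c: "c \<in> F \<rightarrow> carrier R"
    and sum: "psum F c \<in> {\<zero>}" and \<alpha>0: "\<alpha>0 \<in> F"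
  \<comment> \<open>An element common to \<open>A\<close> and \<open>B\<close> is charged to
    \<open>A\<close> alone, so the two sets may overlap.\<close>
  define pa where "pa \<alpha> = (\<lambda>b. if b \<in> A then \<alpha> b else 0)" for \<alpha> :: "'a \<Rightarrow> nat"
  define pb where "pb \<alpha> = (\<lambda>b. if b \<in> A then 0 else \<alpha> b)" for \<alpha> :: "'a \<Rightarrow> nat"
  have pa: "pa \<alpha> \<in> p_exponents p A" and pb: "pb \<alpha> \<in> p_exponents p B" if "\<alpha> \<in> F" for \<alpha>
  proof -
    have *: "finite {b. \<alpha> b \<noteq> 0}" "{b. \<alpha> b \<noteq> 0} \<subseteq> A \<union> B" "\<And>b. \<alpha> b < p"
      using F that p_exponentsD[of \<alpha> p "A \<union> B"] by auto
    have "finite {b. pa \<alpha> b \<noteq> 0}" "finite {b. pb \<alpha> b \<noteq> 0}"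
      by (rule rev_finite_subset[OF *(1)], auto simp: pa_def pb_def)+
    then show "pa \<alpha> \<in> p_exponents p A" "pb \<alpha> \<in> p_exponents p B"
      using * p_ge_2 by (auto simp: p_exponents_def pa_def pb_def)
  qed
  have sum_ab: "(\<lambda>b. pa \<alpha> b + pb \<alpha> b) = \<alpha>" for \<alpha> by (auto simp: pa_def pb_def)
  have ma: "monomial R (pa \<alpha>) \<in> carrier R" and mb: "monomial R (pb \<alpha>) \<in> carrier R" if "\<alpha> \<in> F" for \<alpha>
    using monomial_in_carrier[OF pa[OF that] A] monomial_in_carrier[OF pb[OF that] B] by auto
  have split: "monomial R \<alpha> = monomial R (pa \<alpha>) \<otimes> monomial R (pb \<alpha>)" if "\<alpha> \<in> F" for \<alpha>
  proof -
    have "monomial R (\<lambda>b. pa \<alpha> b + pb \<alpha> b) = monomial R (pa \<alpha>) \<otimes> monomial R (pb \<alpha>)"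
      unfolding monomial_mval
    proof (rule mval_add)
      show "finite {b. pa \<alpha> b \<noteq> 0}" "finite {b. pb \<alpha> b \<noteq> 0}"
        using p_exponentsD(1) pa[OF that] pb[OF that] by blast+
      show "(\<lambda>b. b) \<in> {b. pa \<alpha> b \<noteq> 0} \<union> {b. pb \<alpha> b \<noteq> 0} \<rightarrow> carrier R"
        using p_exponentsD(2)[OF pa[OF that]] p_exponentsD(2)[OF pb[OF that]] A B by blast
    qed
    then show ?thesis by (simp only: sum_ab)
  qed
  have fc: "c \<alpha> \<in> carrier R" if "\<alpha> \<in> F" for \<alpha> using c that by blast
  define J where "J = pb ` F"
  define G where "G \<beta> = {\<alpha> \<in> F. pb \<alpha> = \<beta>}" for \<beta>
  have J: "finite J" "J \<subseteq> p_exponents p B" using F pb by (auto simp: J_def)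
  have G: "finite (G \<beta>)" for \<beta> using F by (simp add: G_def)
  have tc: "c \<alpha> \<in> carrier R" "monomial R (pa \<alpha>) \<in> carrier R" "\<alpha> \<in> F" "monomial R \<alpha> \<in> carrier R"
    if "\<alpha> \<in> G \<beta>" for \<alpha> \<beta>
    using that fc ma mb split by (auto simp: G_def)
  have Jm: "monomial R \<beta> \<in> carrier R" if "\<beta> \<in> J" for \<beta> using that mb by (auto simp: J_def)
  define e where "e \<beta> = (\<Oplus>\<alpha>\<in>G \<beta>. c \<alpha> [^] p \<otimes> monomial R (pa \<alpha>))" for \<beta>
  have e_S: "e \<beta> \<in> S" for \<beta>
    unfolding e_def
  proof (rule subring_finsum_closed[OF S G])
    fix \<alpha> assume "\<alpha> \<in> G \<beta>"
    then have "c \<alpha> [^] p \<in> S" "{b. pa \<alpha> b \<noteq> 0} \<subseteq> S"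
      using tc(1,3) powS p_exponentsD(2)[OF pa] AS by blast+
    then have "c \<alpha> [^] p \<in> S" "monomial R (pa \<alpha>) \<in> S"
      using monomial_in_subring[OF S] by blast+
    then show "c \<alpha> [^] p \<otimes> monomial R (pa \<alpha>) \<in> S" by (rule subringE(6)[OF S])
  qed
  have "(\<Oplus>\<beta>\<in>J. e \<beta> \<otimes> monomial R \<beta>) = (\<Oplus>\<beta>\<in>J. \<Oplus>\<alpha>\<in>G \<beta>. c \<alpha> [^] p \<otimes> monomial R \<alpha>)"
  proof (rule add.finprod_cong')
    fix \<beta> assume \<beta>: "\<beta> \<in> J"
    have "e \<beta> \<otimes> monomial R \<beta> = (\<Oplus>\<alpha>\<in>G \<beta>. (c \<alpha> [^] p \<otimes> monomial R (pa \<alpha>)) \<otimes> monomial R \<beta>)"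
      unfolding e_def by (rule finsum_ldistr) (use G tc Jm[OF \<beta>] in auto)
    also have "\<dots> = psum (G \<beta>) c"
    proof (rule add.finprod_cong')
      fix \<alpha> assume \<alpha>: "\<alpha> \<in> G \<beta>"
      then have "pb \<alpha> = \<beta>" by (simp add: G_def)
      then show "(c \<alpha> [^] p \<otimes> monomial R (pa \<alpha>)) \<otimes> monomial R \<beta> = c \<alpha> [^] p \<otimes> monomial R \<alpha>"
        using split[OF tc(3)[OF \<alpha>]] tc[OF \<alpha>] Jm[OF \<beta>] by (simp add: m_assoc)
    qed (use tc in auto)
    finally show "e \<beta> \<otimes> monomial R \<beta> = psum (G \<beta>) c" .
  qed (use tc in \<open>auto intro!: finsum_closed\<close>)
  also have "\<dots> = (\<Oplus>\<alpha>\<in>(\<Union>\<beta>\<in>J. G \<beta>). c \<alpha> [^] p \<otimes> monomial R \<alpha>)"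
  proof (rule add.finprod_UN_disjoint[symmetric, OF J(1) G])
    show "pairwise (\<lambda>i j. disjnt (G i) (G j)) J" by (auto simp: pairwise_def disjnt_def G_def)
  qed (use tc in auto)
  also have "(\<Union>\<beta>\<in>J. G \<beta>) = F" by (auto simp: G_def J_def)
  finally have rel: "(\<Oplus>\<beta>\<in>J. e \<beta> \<otimes> monomial R \<beta>) = \<zero>" using sum by simp
  let ?\<beta> = "pb \<alpha>0"
  have "e \<in> J \<rightarrow> S" "?\<beta> \<in> J" using e_S \<alpha>0 by (auto simp: J_def)
  then have ez: "e ?\<beta> = \<zero>"
    using Bind[unfolded lin_independent_family_def, THEN spec, THEN spec, THEN mp, THEN mp, THEN mp, THEN mp,
      OF J(2,1) _ rel] by blast
  \<comment> \<open>On the group with \<open>B\<close>-part \<open>?\<beta>\<close> the exponent is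
    recovered from its \<open>A\<close>-part; \<open>un\<close> is this inverse and allows
    reindexing by \<open>A\<close>-exponents.\<close>
  define un where "un \<gamma> = (\<lambda>b. \<gamma> b + ?\<beta> b)" for \<gamma>
  have un: "un (pa \<alpha>) = \<alpha>" if "\<alpha> \<in> G ?\<beta>" for \<alpha>
    using that sum_ab[of \<alpha>] by (simp add: un_def G_def)
  have "psum (pa ` G ?\<beta>) (\<lambda>\<gamma>. c (un \<gamma>))
      = (\<Oplus>\<alpha>\<in>G ?\<beta>. c (un (pa \<alpha>)) [^] p \<otimes> monomial R (pa \<alpha>))"
    by (rule add.finprod_reindex) (use un tc in \<open>auto intro!: inj_on_inverseI[of _ un]\<close>)
  also have "\<dots> = e ?\<beta>"
    unfolding e_def by (rule add.finprod_cong') (use un tc in auto)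
  finally have sum_a: "psum (pa ` G ?\<beta>) (\<lambda>\<gamma>. c (un \<gamma>)) \<in> {\<zero>}" using ez by simp
  have "pa ` G ?\<beta> \<subseteq> p_exponents p A" "finite (pa ` G ?\<beta>)" using pa G by (auto simp: G_def)
  moreover have "(\<lambda>\<gamma>. c (un \<gamma>)) \<in> pa ` G ?\<beta> \<rightarrow> carrier R" using un tc(1) by auto
  moreover have \<alpha>G: "\<alpha>0 \<in> G ?\<beta>" using \<alpha>0 by (simp add: G_def)
  ultimately have "c (un (pa \<alpha>0)) \<in> {\<zero>}"
    by (intro independent_modD[OF ind _ _ _ sum_a, where \<alpha> = "pa \<alpha>0"]) auto
  then show "c \<alpha>0 \<in> {\<zero>}" using un[OF \<alpha>G] by simp
qed

end

section \<open>Maximal \<open>p\<close>-independent sets\<close>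

context char_p_field
begin

definition p_independent :: "'a set \<Rightarrow> bool" where
  "p_independent A \<longleftrightarrow> A \<subseteq> carrier R \<and> independent_mod A {\<zero>}"

lemma p_independent_empty: "p_independent {}"
proof -
  have E: "p_exponents p {} = {\<lambda>_. 0}" using p_ge_2 by (auto simp: p_exponents_def)
  have "c \<alpha> = \<zero>"
    if "F \<subseteq> {\<lambda>_. 0}" "c \<in> F \<rightarrow> carrier R" "psum F c = \<zero>" "\<alpha> \<in> F"
    for F c \<alpha>
  proof -
    have F: "F = {\<lambda>_. 0}" "\<alpha> = (\<lambda>_. 0)" using that by auto
    then have c: "c \<alpha> \<in> carrier R" using that by auto
    have "c \<alpha> [^] p = \<zero>" using that(3) c unfolding F by (simp add: monomial_mval mval_0)
    then show ?thesis using pow_eq_zero[OF c] by blast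
  qed
  then show ?thesis unfolding p_independent_def independent_mod_def E by blast
qed

text \<open>A relation involves finitely many elements, and these lie in a single member of the
  chain.\<close>

lemma p_independent_Union_chain:
  assumes "C \<noteq> {}" "subset.chain {A. p_independent A} C"
  shows "p_independent (\<Union>C)"
  unfolding p_independent_def independent_mod_def
proof (intro conjI allI impI)
  have C: "A \<subseteq> carrier R" "independent_mod A {\<zero>}" if "A \<in> C" for A
    using assms(2) that by (auto simp: pred_on.chain_def p_independent_def)
  show "\<Union>C \<subseteq> carrier R" using C(1) by blast
  fix F c \<alpha>
  assume F: "F \<subseteq> p_exponents p (\<Union>C)" "finite F" and c: "c \<in> F \<rightarrow> carrier R"
    and 0: "psum F c \<in> {\<zero>}" and \<alpha>: "\<alpha> \<in> F"
  let ?S = "\<Union>\<alpha>\<in>F. {b. \<alpha> b \<noteq> 0}"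
  have "finite ?S" "?S \<subseteq> \<Union>C" using F by (auto simp: p_exponents_def)
  then obtain A where A: "A \<in> C" "?S \<subseteq> A"
    using finite_subset_Union_chain[of ?S C "{A. p_independent A}"] assms by (metis (no_types, lifting))
  then have "F \<subseteq> p_exponents p A" using F unfolding p_exponents_def by blast
  then show "c \<alpha> \<in> {\<zero>}" using independent_modD[OF C(2)[OF A(1)] _ F(2) c 0 \<alpha>] by blast
qed

text \<open>The ring \<open>L = R^p[A]\<close> is a field, because the inverse of \<open>x\<close>
  is \<open>x^(p-1)\<close> times the \<open>p\<close>-th power of that inverse. So the powers of
  \<open>c\<close> below \<open>p\<close> are independent over \<open>L\<close>, and the tower
  argument applies with \<open>B = {c}\<close>.\<close>

lemma p_independent_insert:
  assumes A: "p_independent A" and c: "c \<in> carrier R"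
    and cL: "c \<notin> generate_ring R ((\<lambda>r. r [^] p) ` carrier R \<union> A)"
  shows "p_independent (insert c A)"
proof -
  let ?H = "(\<lambda>r. r [^] p) ` carrier R \<union> A"
  define L where "L = generate_ring R ?H"
  have Ac: "A \<subseteq> carrier R" and indA: "independent_mod A {\<zero>}"
    using A by (auto simp: p_independent_def)
  have L: "subring L R" unfolding L_def by (rule generate_ring_is_subring) (use Ac in auto)
  have HL: "?H \<subseteq> L" unfolding L_def by (auto intro: generate_ring.incl)
  have Lc: "L \<subseteq> carrier R" using subringE(1)[OF L] .
  interpret purely_inseparable_step R p L c
  proof (intro purely_inseparable_step.intro purely_inseparable_step_axioms.intro)
    show "char_p_field R p" "subring L R" by (rule char_p_field_axioms, rule L)
  next
    fix x assume x: "x \<in> L" "x \<noteq> \<zero>"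
    then have xc: "x \<in> carrier R" "inv x \<in> carrier R" "x \<otimes> inv x = \<one>" using Lc field_Units by auto
    have pow: "x [^] n \<in> L" for n :: nat
      by (induction n) (use x subringE(3,6)[OF L] in auto)
    obtain n where n: "p = Suc n" using p_ge_2 by (cases p) auto
    have "inv x = (x \<otimes> inv x) [^] n \<otimes> inv x" using xc by simp
    also have "\<dots> = (x [^] n \<otimes> (inv x) [^] n) \<otimes> inv x" by (simp only: nat_pow_distrib[OF xc(1,2)])
    also have "\<dots> = x [^] n \<otimes> (inv x) [^] p" using xc unfolding n by (simp add: m_assoc)
    also have "\<dots> \<in> L" using pow xc HL by (intro subringE(6)[OF L]) auto
    finally show "inv x \<in> L" .
  qed (use c cL HL in \<open>auto simp: L_def\<close>)
  define \<epsilon> where "\<epsilon> i = (\<lambda>b. if b = c then i else 0)" for i :: nat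
  have \<epsilon>: "\<alpha> = \<epsilon> (\<alpha> c)" "\<alpha> c < p" if "\<alpha> \<in> p_exponents p {c}" for \<alpha>
    using that by (auto simp: \<epsilon>_def p_exponents_def fun_eq_iff)
  have "lin_independent_family R L (p_exponents p {c}) (monomial R)"
    unfolding lin_independent_family_def
  proof (intro allI impI ballI)
    fix F s \<alpha>
    assume F: "F \<subseteq> p_exponents p {c}" "finite F" and s: "s \<in> F \<rightarrow> L"
      and rel: "(\<Oplus>\<alpha>\<in>F. s \<alpha> \<otimes> monomial R \<alpha>) = \<zero>" and \<alpha>: "\<alpha> \<in> F"
    define e where "e i = (if \<epsilon> i \<in> F then s (\<epsilon> i) else \<zero>)" for i
    have eL: "e i \<in> L" for i using s subringE(2)[OF L] by (auto simp: e_def)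
    have inj: "inj_on (\<lambda>\<alpha>. \<alpha> c) F" using F \<epsilon>(1) by (intro inj_on_inverseI[of _ \<epsilon>]) auto
    have F_eq: "\<epsilon> (\<alpha> c) = \<alpha>" if "\<alpha> \<in> F" for \<alpha> using \<epsilon>(1) F that by (metis subsetD)
    have "(\<Oplus>i\<in>{..<p}. e i \<otimes> c [^] i) = (\<Oplus>i\<in>(\<lambda>\<alpha>. \<alpha> c) ` F. e i \<otimes> c [^] i)"
    proof (rule add.finprod_mono_neutral_cong_right)
      show "(\<lambda>\<alpha>. \<alpha> c) ` F \<subseteq> {..<p}" using \<epsilon>(2) F by auto
      show "e i \<otimes> c [^] i = \<zero>" if "i \<in> {..<p} - (\<lambda>\<alpha>. \<alpha> c) ` F" for i
      proof -
        have "\<epsilon> i c = i" by (simp add: \<epsilon>_def)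
        then have "\<epsilon> i \<notin> F" using that by (metis DiffD2 image_eqI)
        then show ?thesis using c by (simp add: e_def)
      qed
    qed (use eL c in auto)
    also have "\<dots> = (\<Oplus>\<alpha>\<in>F. e (\<alpha> c) \<otimes> c [^] \<alpha> c)"
      by (rule add.finprod_reindex) (use eL c inj in auto)
    also have "\<dots> = (\<Oplus>\<alpha>\<in>F. s \<alpha> \<otimes> monomial R \<alpha>)"
    proof (rule add.finprod_cong')
      fix \<alpha> assume "\<alpha> \<in> F"
      then have "monomial R \<alpha> = c [^] \<alpha> c" "e (\<alpha> c) = s \<alpha>"
        using mval_single[of "\<lambda>b. b" c "\<alpha> c"] c F_eq[of \<alpha>]
        by (simp_all add: monomial_mval e_def \<epsilon>_def[symmetric])
      then show "e (\<alpha> c) \<otimes> c [^] \<alpha> c = s \<alpha> \<otimes> monomial R \<alpha>" by simp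
    next
      have "s \<alpha> \<in> carrier R" "monomial R \<alpha> \<in> carrier R" if "\<alpha> \<in> F" for \<alpha>
        using that s Lc F c monomial_in_carrier[of \<alpha> p "{c}"] by blast+
      then show "(\<lambda>\<alpha>. s \<alpha> \<otimes> monomial R \<alpha>) \<in> F \<rightarrow> carrier R" by auto
    qed simp
    finally have rel': "(\<Oplus>i\<in>{..<p}. e i \<otimes> c [^] i) = \<zero>" using rel by simp
    have "\<alpha> c < p" using \<epsilon>(2) \<alpha> F by blast
    then have "e (\<alpha> c) = \<zero>" by (rule powers_independent[OF eL rel'])
    then show "s \<alpha> = \<zero>" using F_eq[OF \<alpha>] \<alpha> by (simp add: e_def)
  qed
  then have "independent_mod (A \<union> {c}) {\<zero>}"
    by (intro independent_join[OF Ac _ indA L]) (use c HL in auto)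
  then show ?thesis using Ac c by (simp add: p_independent_def)
qed

theorem abs_p_basis_exists: "\<exists>A. abs_p_basis R p A"
proof -
  have ne: "{A. p_independent A} \<noteq> {}" using p_independent_empty by blast
  have "\<exists>M\<in>{A. p_independent A}. \<forall>Y\<in>{A. p_independent A}. M \<subseteq> Y \<longrightarrow> Y = M"
    by (rule subset_Zorn_nonempty[OF ne]) (use p_independent_Union_chain in blast)
  then obtain A where A: "p_independent A" and max: "\<And>B. p_independent B \<Longrightarrow> A \<subseteq> B \<Longrightarrow> B = A"
    by blast
  have Ac: "A \<subseteq> carrier R" and indA: "independent_mod A {\<zero>}"
    using A by (auto simp: p_independent_def)
  have "generate_ring R ((\<lambda>r. r [^] p) ` carrier R \<union> A) = carrier R" (is "?L = _")
  proof
    show "?L \<subseteq> carrier R" by (rule generate_ring_incl) (use Ac in auto)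
    show "carrier R \<subseteq> ?L"
    proof
      fix c assume c: "c \<in> carrier R"
      show "c \<in> ?L"
      proof (rule ccontr)
        assume "c \<notin> ?L"
        then have "insert c A = A" using p_independent_insert[OF A c] max by blast
        then show False using \<open>c \<notin> ?L\<close> by (auto intro: generate_ring.incl)
      qed
    qed
  qed
  then have "abs_p_basis R p A"
    by unfold_locales (use Ac independent_modD[OF indA] in auto)
  then show ?thesis by blast
qed

end

section \<open>Formally etale extensions preserve \<open>p\<close>-independence\<close>

definition total_degree :: "('b \<Rightarrow> nat) \<Rightarrow> nat" where
  "total_degree \<alpha> = (\<Sum>b\<in>{b. \<alpha> b \<noteq> 0}. \<alpha> b)"

lemma total_degree_decr:
  assumes "finite {b. \<alpha> b \<noteq> 0}" "\<alpha> g \<noteq> 0"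
  shows "total_degree (\<alpha>(g := \<alpha> g - 1)) < total_degree \<alpha>"
proof -
  let ?\<beta> = "\<alpha>(g := \<alpha> g - 1)" and ?S = "{b. \<alpha> b \<noteq> 0}"
  have "total_degree ?\<beta> = (\<Sum>b\<in>?S. ?\<beta> b)"
    unfolding total_degree_def by (rule sum.mono_neutral_left) (use assms in auto)
  also have "\<dots> < (\<Sum>b\<in>?S. \<alpha> b)"
    by (rule sum_strict_mono_ex1) (use assms in auto)
  finally show ?thesis by (simp add: total_degree_def)
qed

lemma (in cring) trunc2_eq: "f \<in> carrier (trunc R 2) \<Longrightarrow> f = tlin R 2 (f 0) (f 1)"
proof
  fix i :: nat assume f: "f \<in> carrier (trunc R 2)"
  consider "i = 0" | "i = 1" | "i \<ge> 2" by linarith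
  then show "f i = tlin R 2 (f 0) (f 1) i"
    using f by cases (auto simp: trunc_carrier tlin_def)
qed

lemma (in cring) trunc2_ideal:
  "ideal {f \<in> carrier (trunc R 2). f 0 = \<zero>} (trunc R 2)"
proof -
  interpret T: cring "trunc R 2" by (rule trunc_cring)
  show ?thesis
    by (rule T.ideal_of_closed) (auto simp: trunc_simps trunc_carrier)
qed

text \<open>Here \<open>R\<close> is the base, in the application the field \<open>k\<close> with
  \<open>p\<close>-basis \<open>G\<close>, and \<open>K\<close> becomes the residue field.\<close>

locale etale_p_basis = abs_p_basis + K: field K for K (structure) +
  fixes \<iota>
  assumes etale: "formally_etale R K \<iota>"
begin

lemma \<iota>_hom: "\<iota> \<in> ring_hom R K"
  using etale by (simp add: formally_etale_def)

sublocale \<iota>: ring_hom_cring R K \<iota>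
  using \<iota>_hom is_cring K.is_cring by (simp add: ring_hom_cring_of_hom)

sublocale Kp: char_p_field K p
proof -
  interpret Kp: char_p_cring K p by (rule char_p_target[OF K.is_cring \<iota>_hom])
  show "char_p_field K p" by unfold_locales
qed

lemma \<iota>_generator: "a \<in> G \<Longrightarrow> \<iota> a \<in> carrier K"
  by (rule \<iota>.hom_closed) (use G in blast)

abbreviation T where "T \<equiv> trunc K 2"

sublocale T: cring T by (rule K.trunc_cring)

text \<open>The partial derivatives \<open>\<partial>/\<partial>g\<close> of the base field, written as homomorphisms to the
  dual numbers, lift along the formally etale map.\<close>

lemma lift_exists:
  assumes g: "g \<in> G"
  shows "\<exists>v\<in>ring_hom K T. (\<forall>a\<in>G. v (\<iota> a) = tlin K 2 (\<iota> a) (if a = g then \<one>\<^bsub>K\<^esub> else \<zero>\<^bsub>K\<^esub>)) \<and>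
    (\<forall>x\<in>carrier K. v (x [^]\<^bsub>K\<^esub> p) = tlin K 2 (x [^]\<^bsub>K\<^esub> p) \<zero>\<^bsub>K\<^esub>)"
proof -
  define f where "f a = tlin K 2 (\<iota> a) (if a = g then \<one>\<^bsub>K\<^esub> else \<zero>\<^bsub>K\<^esub>)" for a
  define N where "N = {f \<in> carrier T. f 0 = \<zero>\<^bsub>K\<^esub>}"
  have N: "ideal N T" unfolding N_def by (rule K.trunc2_ideal)
  interpret N: ideal N T by (rule N)
  interpret c: ring_hom_cring K T "\<lambda>x. tlin K 2 x \<zero>\<^bsub>K\<^esub>"
    using K.tconst_hom K.is_cring T.is_cring by (simp add: ring_hom_cring_of_hom)
  have e: "ring_hom_cring T K (\<lambda>f. f 0)"
    using K.tcoeff0_hom K.is_cring T.is_cring by (simp add: ring_hom_cring_of_hom)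
  have p2: "2 \<le> p ^ 1" using p_ge_2 by simp
  \<comment> \<open>The derivation exists on the base since the \<open>p\<close>-th power of
    \<open>f a\<close> forgets its \<open>\<epsilon>\<close>-part, which is the compatibility
    required by \<open>hom_extension\<close>.\<close>
  have "\<exists>v\<in>ring_hom R T. (\<forall>a\<in>G. v a = f a) \<and> (\<forall>r\<in>carrier R. v (r [^] p) = tlin K 2 (\<iota> r [^]\<^bsub>K\<^esub> p) \<zero>\<^bsub>K\<^esub>)"
  proof (rule hom_extension[OF T.is_cring])
    have "(\<lambda>x. tlin K 2 x \<zero>\<^bsub>K\<^esub>) \<circ> ((\<lambda>x. x [^]\<^bsub>K\<^esub> p) \<circ> \<iota>) \<in> ring_hom R T"
      by (intro ring_hom_trans[OF _ K.tconst_hom] ring_hom_trans[OF \<iota>_hom Kp.frobenius_hom])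
    then show "(\<lambda>r. tlin K 2 (\<iota> r [^]\<^bsub>K\<^esub> p) \<zero>\<^bsub>K\<^esub>) \<in> ring_hom R T" by (simp add: comp_def)
    show "f \<in> G \<rightarrow> carrier T" using \<iota>_generator by (auto simp: f_def intro!: K.tlin_closed)
    show "f a [^]\<^bsub>T\<^esub> p = tlin K 2 (\<iota> a [^]\<^bsub>K\<^esub> p) \<zero>\<^bsub>K\<^esub>" if "a \<in> G" for a
      using Kp.tlin_pow[OF \<iota>_generator[OF that] _ p2] by (simp add: f_def)
  qed
  then obtain w where w: "w \<in> ring_hom R T" "\<And>a. a \<in> G \<Longrightarrow> w a = f a"
    and wp: "\<And>r. r \<in> carrier R \<Longrightarrow> w (r [^] p) = tlin K 2 (\<iota> r [^]\<^bsub>K\<^esub> p) \<zero>\<^bsub>K\<^esub>" by blast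
  have w0: "w r 0 = \<iota> r" if "r \<in> carrier R" for r
  proof -
    have "((\<lambda>f. f 0) \<circ> w) r = \<iota> r"
      by (rule hom_eqI[OF K.is_cring ring_hom_trans[OF w(1) K.tcoeff0_hom] \<iota>_hom _ _ that, where N = 1])
        (use w(2) wp in \<open>auto simp: f_def tlin_def\<close>)
    then show ?thesis by simp
  qed
  have same: "N +>\<^bsub>T\<^esub> x = N +>\<^bsub>T\<^esub> y \<longleftrightarrow> x 0 = y 0" if xy: "x \<in> carrier T" "y \<in> carrier T" for x y
  proof -
    have "x \<ominus>\<^bsub>T\<^esub> y \<in> carrier T" using xy by simp
    moreover have "(x \<ominus>\<^bsub>T\<^esub> y) 0 = x 0 \<ominus>\<^bsub>K\<^esub> y 0"
      using ring_hom_cring.hom_a_inv[OF e xy(2)] by (simp add: T.minus_eq K.minus_eq trunc_simps(4))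
    moreover have "x 0 \<ominus>\<^bsub>K\<^esub> y 0 = \<zero>\<^bsub>K\<^esub> \<longleftrightarrow> x 0 = y 0"
      by (rule K.r_right_minus_eq) (use xy in \<open>simp_all add: trunc_carrier\<close>)
    ultimately have "x \<ominus>\<^bsub>T\<^esub> y \<in> N \<longleftrightarrow> x 0 = y 0"
      by (simp only: N_def mem_Collect_eq simp_thms)
    then show ?thesis using T.quotient_eq_iff_same_a_r_cos[OF N xy] by simp
  qed
  \<comment> \<open>The identity of \<open>K\<close>, viewed as a map to the dual numbers modulo
    \<open>\<epsilon>\<close>; its lift along \<open>w\<close> is the extended derivation.\<close>
  define u where "u = (\<lambda>x. N +>\<^bsub>T\<^esub> tlin K 2 x \<zero>\<^bsub>K\<^esub>)"
  have u: "u \<in> ring_hom K (T Quot N)"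
    using ring_hom_trans[OF K.tconst_hom N.rcos_ring_hom] by (simp add: u_def comp_def)
  have lifting: "unique_lifting R K \<iota> T"
    by (rule formally_etale_unique_lifting[OF etale]) (unfold_locales)
  have N2: "\<forall>x\<in>N. \<forall>y\<in>N. x \<otimes>\<^bsub>T\<^esub> y = \<zero>\<^bsub>T\<^esub>"
  proof (intro ballI ext)
    fix x y i assume xy: "x \<in> N" "y \<in> N"
    then have x: "x \<in> carrier T" "y \<in> carrier T" "x 0 = \<zero>\<^bsub>K\<^esub>" "y 0 = \<zero>\<^bsub>K\<^esub>"
      by (simp_all only: N_def mem_Collect_eq)
    show "(x \<otimes>\<^bsub>T\<^esub> y) i = \<zero>\<^bsub>T\<^esub> i"
    proof (cases "i < 2")
      case True
      have "(x \<otimes>\<^bsub>T\<^esub> y) i = \<zero>\<^bsub>K\<^esub>"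
        by (rule K.trunc_order_mult[OF x(1,2), where a = 1 and b = 1]) (use x True in auto)
      then show ?thesis by (simp add: trunc_simps(3))
    qed (simp add: trunc_simps(1,3))
  qed
  have uw: "\<forall>a\<in>carrier R. u (\<iota> a) = N +>\<^bsub>T\<^esub> w a"
    unfolding u_def
  proof (intro ballI same[THEN iffD2])
    fix a assume a: "a \<in> carrier R"
    show "tlin K 2 (\<iota> a) \<zero>\<^bsub>K\<^esub> \<in> carrier T" "w a \<in> carrier T"
      by (rule K.tlin_closed[OF \<iota>.hom_closed[OF a] K.zero_closed], rule ring_hom_closed[OF w(1) a])
    show "tlin K 2 (\<iota> a) \<zero>\<^bsub>K\<^esub> 0 = w a 0" using w0[OF a] by (simp add: tlin_def)
  qed
  note ex1 = lifting[unfolded unique_lifting_def, THEN spec, THEN spec, THEN spec, THEN mp, THEN mp,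
      THEN mp, THEN mp, THEN mp, OF N N2 w(1) u uw]
  obtain v where v: "v \<in> ring_hom K T" "\<And>a. a \<in> carrier R \<Longrightarrow> v (\<iota> a) = w a"
    "\<And>b. b \<in> carrier K \<Longrightarrow> N +>\<^bsub>T\<^esub> v b = u b"
    using ex1_implies_ex[OF ex1] by (elim exE conjE) (rule that, auto)
  have vc: "v x \<in> carrier T" if "x \<in> carrier K" for x using ring_hom_closed[OF v(1) that] .
  have v0: "v x 0 = x" if "x \<in> carrier K" for x
  proof -
    have "v x 0 = tlin K 2 x \<zero>\<^bsub>K\<^esub> 0"
      using v(3)[OF that] same[OF vc[OF that] c.hom_closed[OF that]] unfolding u_def by blast
    then show ?thesis by (simp add: tlin_def)
  qed
  interpret v: ring_hom_cring K T v
    using v(1) K.is_cring T.is_cring by (simp add: ring_hom_cring_of_hom)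
  \<comment> \<open>Any lift of the identity has the form
    \<open>x \<mapsto> x + d \<epsilon>\<close>, so it is constant on \<open>p\<close>-th
    powers.\<close>
  have "v (x [^]\<^bsub>K\<^esub> p) = tlin K 2 (x [^]\<^bsub>K\<^esub> p) \<zero>\<^bsub>K\<^esub>" if x: "x \<in> carrier K" for x
  proof -
    have "v (x [^]\<^bsub>K\<^esub> p) = (tlin K 2 x (v x 1)) [^]\<^bsub>T\<^esub> p"
      using v.hom_pow[OF x, of p] K.trunc2_eq[OF vc[OF x]] v0[OF x] by simp
    also have "\<dots> = tlin K 2 (x [^]\<^bsub>K\<^esub> p) \<zero>\<^bsub>K\<^esub>"
      using Kp.tlin_pow[OF x _ p2, of "v x 1"] vc[OF x] by (simp add: trunc_carrier)
    finally show ?thesis .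
  qed
  moreover have "v (\<iota> a) = f a" if "a \<in> G" for a using v(2)[of a] w(2) that G by auto
  ultimately show ?thesis using v(1) unfolding f_def by blast
qed

definition is_lift :: "'a \<Rightarrow> ('c \<Rightarrow> nat \<Rightarrow> 'c) \<Rightarrow> bool" where
  "is_lift g v \<longleftrightarrow> v \<in> ring_hom K T \<and>
     (\<forall>a\<in>G. v (\<iota> a) = tlin K 2 (\<iota> a) (if a = g then \<one>\<^bsub>K\<^esub> else \<zero>\<^bsub>K\<^esub>)) \<and>
     (\<forall>x\<in>carrier K. v (x [^]\<^bsub>K\<^esub> p) = tlin K 2 (x [^]\<^bsub>K\<^esub> p) \<zero>\<^bsub>K\<^esub>)"

text \<open>The common constants of all lifted derivations. Using them instead of \<open>K^p\<close>
  keeps the coefficients \<open>(\<alpha> g) s\<close> of a differentiated relation admissible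
  without extracting \<open>p\<close>-th roots of integers.\<close>

definition constants :: "'c set" where
  "constants = {s \<in> carrier K. \<forall>g v. is_lift g v \<longrightarrow> v s = tlin K 2 s \<zero>\<^bsub>K\<^esub>}"

lemma constants_closed: "s \<in> constants \<Longrightarrow> s \<in> carrier K"
  by (simp add: constants_def)

lemma constants_pow: "x \<in> carrier K \<Longrightarrow> x [^]\<^bsub>K\<^esub> p \<in> constants"
  by (simp add: constants_def is_lift_def)

lemma constants_multiple: "s \<in> constants \<Longrightarrow> add_pow K (n::nat) s \<in> constants"
proof (induction n)
  case 0
  show ?case using ring_hom_zero[OF _ K.ring_axioms T.ring_axioms]
    by (auto simp: constants_def is_lift_def tlin_def trunc_simps)
next
  case (Suc n)
  have s: "add_pow K n s \<in> constants" "s \<in> constants" using Suc by auto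
  note sc = constants_closed[OF s(1)] constants_closed[OF s(2)]
  have "v (add_pow K n s \<oplus>\<^bsub>K\<^esub> s) = tlin K 2 (add_pow K n s \<oplus>\<^bsub>K\<^esub> s) \<zero>\<^bsub>K\<^esub>" if v: "is_lift g v" for g v
  proof -
    have "v \<in> ring_hom K T" "v s = tlin K 2 s \<zero>\<^bsub>K\<^esub>" "v (add_pow K n s) = tlin K 2 (add_pow K n s) \<zero>\<^bsub>K\<^esub>"
      using v s by (auto simp: is_lift_def constants_def)
    then show ?thesis using ring_hom_add[OF _ sc] ring_hom_add[OF K.tconst_hom sc] by metis
  qed
  then show ?case using sc by (simp add: constants_def K.add.nat_pow_Suc)
qed

abbreviation mK where "mK \<equiv> mval K \<iota>"

lemma mK_closed: "\<alpha> \<in> E \<Longrightarrow> mK \<alpha> \<in> carrier K"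
  using p_exponentsD(2)[of \<alpha> p G] \<iota>_generator by (intro K.mval_closed) blast

lemma lin_pow_coeff:
  fixes n :: nat
  assumes "x \<in> carrier K"
  shows "(tlin K 2 x \<one>\<^bsub>K\<^esub> [^]\<^bsub>T\<^esub> n) 0 = x [^]\<^bsub>K\<^esub> n"
    "(tlin K 2 x \<one>\<^bsub>K\<^esub> [^]\<^bsub>T\<^esub> n) 1 = add_pow K n (x [^]\<^bsub>K\<^esub> (n - 1))"
proof -
  let ?w = "tlin K 2 x \<one>\<^bsub>K\<^esub>"
  have w: "?w \<in> carrier T" using assms by (simp add: K.tlin_closed)
  have pow_Suc: "?w [^]\<^bsub>T\<^esub> Suc n = ?w \<otimes>\<^bsub>T\<^esub> ?w [^]\<^bsub>T\<^esub> n" for n :: nat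
    using w by (simp add: T.m_comm)
  have cl: "?w [^]\<^bsub>T\<^esub> n \<in> carrier T" for n :: nat using w by simp
  have 0: "(?w [^]\<^bsub>T\<^esub> n) 0 = x [^]\<^bsub>K\<^esub> n" for n :: nat
  proof (induction n)
    case (Suc n)
    have "(?w [^]\<^bsub>T\<^esub> Suc n) 0 = x \<otimes>\<^bsub>K\<^esub> (?w [^]\<^bsub>T\<^esub> n) 0"
      unfolding pow_Suc by (rule K.trunc_lin_mult(1)[OF cl assms])
    also have "\<dots> = x [^]\<^bsub>K\<^esub> Suc n" unfolding Suc.IH using assms by (simp add: K.m_comm)
    finally show ?case .
  qed (simp add: trunc_simps)
  then show "(?w [^]\<^bsub>T\<^esub> n) 0 = x [^]\<^bsub>K\<^esub> n" .
  show "(?w [^]\<^bsub>T\<^esub> n) 1 = add_pow K n (x [^]\<^bsub>K\<^esub> (n - 1))"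
  proof (induction n)
    case (Suc n)
    have "(?w [^]\<^bsub>T\<^esub> Suc n) 1 = x \<otimes>\<^bsub>K\<^esub> add_pow K n (x [^]\<^bsub>K\<^esub> (n - 1)) \<oplus>\<^bsub>K\<^esub> x [^]\<^bsub>K\<^esub> n"
      unfolding pow_Suc using K.trunc_lin_mult(2)[OF cl assms, of 0] Suc.IH 0 by simp
    also have "x \<otimes>\<^bsub>K\<^esub> add_pow K n (x [^]\<^bsub>K\<^esub> (n - 1)) = add_pow K n (x [^]\<^bsub>K\<^esub> n)"
    proof (cases n)
      case (Suc j)
      then show ?thesis using assms by (simp add: K.add_pow_rdistr K.m_comm del: K.add.nat_pow_Suc)
    qed (use assms in simp)
    finally show ?case using assms by (simp add: K.add.nat_pow_Suc)
  qed (simp add: trunc_simps)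
qed

text \<open>Only the factor belonging to \<open>g\<close> varies, which leaves the power rule. If
  \<open>\<alpha> g = 0\<close>, the truncated difference \<open>\<alpha> g - 1\<close> does no harm
  because the multiple in front is zero.\<close>

lemma derivative_monomial:
  assumes v: "is_lift g v" and g: "g \<in> G" and \<alpha>: "\<alpha> \<in> E"
  shows "v (mK \<alpha>) 1 = add_pow K (\<alpha> g) (mK (\<alpha>(g := \<alpha> g - 1)))"
proof -
  let ?f = "\<lambda>a. v (\<iota> a)" and ?c = "\<lambda>x. tlin K 2 x \<zero>\<^bsub>K\<^esub>"
  have vh: "v \<in> ring_hom K T" and vG: "\<And>a. a \<in> G \<Longrightarrow> ?f a = tlin K 2 (\<iota> a) (if a = g then \<one>\<^bsub>K\<^esub> else \<zero>\<^bsub>K\<^esub>)"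
    using v by (auto simp: is_lift_def)
  note \<iota>G = \<iota>_generator
  have sub: "finite {b. \<alpha> b \<noteq> 0}" "{b. \<alpha> b \<noteq> 0} \<subseteq> G" using p_exponentsD(1,2)[OF \<alpha>] by blast+
  have E0: "\<alpha>(g := 0) \<in> E" and E1: "\<alpha>(g := \<alpha> g - 1) \<in> E"
    using upd_E[OF \<alpha> g] p_exponentsD(3)[OF \<alpha>, of g] p_ge_2 by auto
  have sub0: "{b. (\<alpha>(g := 0)) b \<noteq> 0} \<subseteq> G - {g}" using sub by auto
  have fT: "?f a \<in> carrier T" if "a \<in> G" for a using ring_hom_closed[OF vh \<iota>G[OF that]] .
  have "v (mK \<alpha>) = mval T ?f \<alpha>"
    by (rule K.mval_hom[OF T.is_cring vh]) (use sub \<iota>G in auto)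
  also have "\<dots> = ?f g [^]\<^bsub>T\<^esub> \<alpha> g \<otimes>\<^bsub>T\<^esub> mval T ?f (\<alpha>(g := 0))"
    by (rule T.mval_split) (use sub fT g in auto)
  also have "mval T ?f (\<alpha>(g := 0)) = ?c (mK (\<alpha>(g := 0)))"
  proof (rule K.mval_hom[OF T.is_cring K.tconst_hom, symmetric])
    show "\<iota> \<in> {b. (\<alpha>(g := 0)) b \<noteq> 0} \<rightarrow> carrier K" using sub0 \<iota>G by blast
    fix b assume "(\<alpha>(g := 0)) b \<noteq> 0"
    then have "b \<in> G" "b \<noteq> g" using sub0 by blast+
    then show "?f b = ?c (\<iota> b)" by (simp add: vG)
  qed
  finally have "v (mK \<alpha>) = ?c (mK (\<alpha>(g := 0))) \<otimes>\<^bsub>T\<^esub> ?f g [^]\<^bsub>T\<^esub> \<alpha> g"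
    using T.m_comm[of "?f g [^]\<^bsub>T\<^esub> \<alpha> g" "?c (mK (\<alpha>(g := 0)))"] fT[OF g] mK_closed[OF E0]
    by (simp add: K.tlin_closed)
  then have "v (mK \<alpha>) 1 = (?c (mK (\<alpha>(g := 0))) \<otimes>\<^bsub>T\<^esub> ?f g [^]\<^bsub>T\<^esub> \<alpha> g) 1"
    by (rule arg_cong)
  also have "\<dots> = mK (\<alpha>(g := 0)) \<otimes>\<^bsub>K\<^esub> (?f g [^]\<^bsub>T\<^esub> \<alpha> g) 1"
    using K.trunc_const_mult[OF mK_closed[OF E0], of "?f g [^]\<^bsub>T\<^esub> \<alpha> g" 2] fT[OF g] by simp
  also have "?f g = tlin K 2 (\<iota> g) \<one>\<^bsub>K\<^esub>" using vG[OF g] by simp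
  also have "(tlin K 2 (\<iota> g) \<one>\<^bsub>K\<^esub> [^]\<^bsub>T\<^esub> \<alpha> g) 1 = add_pow K (\<alpha> g) (\<iota> g [^]\<^bsub>K\<^esub> (\<alpha> g - 1))"
    by (rule lin_pow_coeff(2)[OF \<iota>G[OF g]])
  finally have "v (mK \<alpha>) 1 = mK (\<alpha>(g := 0)) \<otimes>\<^bsub>K\<^esub> add_pow K (\<alpha> g) (\<iota> g [^]\<^bsub>K\<^esub> (\<alpha> g - 1))" .
  also have "\<dots> = add_pow K (\<alpha> g) (\<iota> g [^]\<^bsub>K\<^esub> (\<alpha> g - 1) \<otimes>\<^bsub>K\<^esub> mK (\<alpha>(g := 0)))"
    using mK_closed[OF E0] \<iota>G[OF g] by (simp add: K.add_pow_rdistr K.m_comm)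
  also have "\<iota> g [^]\<^bsub>K\<^esub> (\<alpha> g - 1) \<otimes>\<^bsub>K\<^esub> mK (\<alpha>(g := 0)) = mK (\<alpha>(g := \<alpha> g - 1))"
  proof -
    have "\<iota> \<in> {b. (\<alpha>(g := \<alpha> g - 1)) b \<noteq> 0} \<rightarrow> carrier K"
      using p_exponentsD(2)[OF E1] \<iota>G by blast
    from K.mval_split[OF p_exponentsD(1)[OF E1] this \<iota>G[OF g]] show ?thesis
      by (simp only: fun_upd_same fun_upd_upd)
  qed
  finally show ?thesis .
qed

text \<open>Differentiating along \<open>g\<close> lowers the total degree, so by induction
  \<open>(\<beta> g) s \<beta>\<close> vanishes; \<open>0 < \<beta> g < p\<close> makes the integer
  invertible. Only the trivial monomial can remain, and then its coefficient is the whole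
  relation.\<close>

lemma independent_over_constants:
  assumes "F \<subseteq> E" "finite F" "s \<in> F \<rightarrow> constants" "\<And>\<alpha>. \<alpha> \<in> F \<Longrightarrow> total_degree \<alpha> \<le> N"
    "(\<Oplus>\<^bsub>K\<^esub>\<alpha>\<in>F. s \<alpha> \<otimes>\<^bsub>K\<^esub> mK \<alpha>) = \<zero>\<^bsub>K\<^esub>" "\<alpha> \<in> F"
  shows "s \<alpha> = \<zero>\<^bsub>K\<^esub>"
  using assms
proof (induction N arbitrary: F s \<alpha> rule: less_induct)
  case (less N)
  note FE = less.prems(1) and F = less.prems(2)
  have s: "s \<beta> \<in> constants" "s \<beta> \<in> carrier K" "mK \<beta> \<in> carrier K" if "\<beta> \<in> F" for \<beta>
    using less.prems(3) that FE constants_closed mK_closed by auto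
  have nonzero: "s \<beta> = \<zero>\<^bsub>K\<^esub>" if \<beta>: "\<beta> \<in> F" and g: "\<beta> g \<noteq> 0" for \<beta> g
  proof -
    have gG: "g \<in> G" using \<beta> g FE by (auto simp: p_exponents_def)
    obtain v where v: "is_lift g v" using lift_exists[OF gG] by (auto simp: is_lift_def)
    then have vh: "v \<in> ring_hom K T" by (simp add: is_lift_def)
    interpret v: ring_hom_cring K T v
      using vh K.is_cring T.is_cring by (simp add: ring_hom_cring_of_hom)
    define dd where "dd x = v x 1" for x
    have ddc: "dd x \<in> carrier K" if "x \<in> carrier K" for x
      using v.hom_closed[OF that] by (simp add: dd_def trunc_carrier)
    have dd_add: "dd (x \<oplus>\<^bsub>K\<^esub> y) = dd x \<oplus>\<^bsub>K\<^esub> dd y" if "x \<in> carrier K" "y \<in> carrier K" for x y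
      using v.hom_add[OF that] by (simp add: dd_def trunc_simps(4))
    have dd_zero: "dd \<zero>\<^bsub>K\<^esub> = \<zero>\<^bsub>K\<^esub>" using v.hom_zero by (simp add: dd_def trunc_simps(3))
    have dd_scale: "dd (c \<otimes>\<^bsub>K\<^esub> x) = c \<otimes>\<^bsub>K\<^esub> dd x" if "c \<in> constants" "x \<in> carrier K" for c x
    proof -
      have "v c = tlin K 2 c \<zero>\<^bsub>K\<^esub>" using that v by (auto simp: constants_def)
      then show ?thesis
        using v.hom_mult[OF constants_closed[OF that(1)] that(2)] v.hom_closed[OF that(2)]
          K.trunc_const_mult[OF constants_closed[OF that(1)], of "v x" 2] by (simp add: dd_def)
    qed
    have dd_sum: "finite S \<Longrightarrow> S \<subseteq> F \<Longrightarrow> dd (\<Oplus>\<^bsub>K\<^esub>\<alpha>\<in>S. s \<alpha> \<otimes>\<^bsub>K\<^esub> mK \<alpha>) = (\<Oplus>\<^bsub>K\<^esub>\<alpha>\<in>S. s \<alpha> \<otimes>\<^bsub>K\<^esub> dd (mK \<alpha>))" for S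
    proof (induction S rule: finite_induct)
      case (insert \<alpha> S)
      have "(\<Oplus>\<^bsub>K\<^esub>\<alpha>\<in>S. s \<alpha> \<otimes>\<^bsub>K\<^esub> mK \<alpha>) \<in> carrier K"
        by (rule K.finsum_closed) (use insert s in auto)
      moreover have "(\<Oplus>\<^bsub>K\<^esub>\<alpha>\<in>insert \<alpha> S. s \<alpha> \<otimes>\<^bsub>K\<^esub> mK \<alpha>) = s \<alpha> \<otimes>\<^bsub>K\<^esub> mK \<alpha> \<oplus>\<^bsub>K\<^esub> (\<Oplus>\<^bsub>K\<^esub>\<alpha>\<in>S. s \<alpha> \<otimes>\<^bsub>K\<^esub> mK \<alpha>)"
        by (rule K.finsum_insert) (use insert s in auto)
      moreover have "(\<Oplus>\<^bsub>K\<^esub>\<alpha>\<in>insert \<alpha> S. s \<alpha> \<otimes>\<^bsub>K\<^esub> dd (mK \<alpha>)) = s \<alpha> \<otimes>\<^bsub>K\<^esub> dd (mK \<alpha>) \<oplus>\<^bsub>K\<^esub> (\<Oplus>\<^bsub>K\<^esub>\<alpha>\<in>S. s \<alpha> \<otimes>\<^bsub>K\<^esub> dd (mK \<alpha>))"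
        by (rule K.finsum_insert) (use insert s ddc in auto)
      ultimately show ?case using insert s by (simp add: dd_add dd_scale)
    qed (simp add: dd_zero)
    define F' where "F' = {\<alpha> \<in> F. \<alpha> g \<noteq> 0}"
    have F': "F' \<subseteq> F" "finite F'" using F by (auto simp: F'_def)
    define d where "d \<alpha> = \<alpha>(g := \<alpha> g - 1)" for \<alpha> :: "'a \<Rightarrow> nat"
    define r where "r \<alpha> = \<alpha>(g := Suc (\<alpha> g))" for \<alpha> :: "'a \<Rightarrow> nat"
    have rd: "r (d \<alpha>) = \<alpha>" if "\<alpha> \<in> F'" for \<alpha> using that by (auto simp: r_def d_def F'_def)
    have dE: "d \<alpha> \<in> E" if "\<alpha> \<in> F" for \<alpha>
      using upd_E[of \<alpha> g "\<alpha> g - 1"] that FE gG p_exponentsD(3)[of \<alpha> p G g] by (auto simp: d_def)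
    have ddm: "dd (mK \<alpha>) = add_pow K (\<alpha> g) (mK (d \<alpha>))" if "\<alpha> \<in> F" for \<alpha>
      using derivative_monomial[OF v gG, of \<alpha>] that FE by (auto simp: dd_def d_def)
    define t where "t \<alpha> = add_pow K (\<alpha> g) (s \<alpha>)" for \<alpha>
    have t: "t \<alpha> \<in> constants" "t \<alpha> \<in> carrier K" if "\<alpha> \<in> F" for \<alpha>
      using constants_multiple[OF s(1)[OF that]] constants_closed by (auto simp: t_def)
    have "\<zero>\<^bsub>K\<^esub> = (\<Oplus>\<^bsub>K\<^esub>\<alpha>\<in>F. s \<alpha> \<otimes>\<^bsub>K\<^esub> dd (mK \<alpha>))"
      using dd_sum[OF F subset_refl] less.prems(5) dd_zero by simp
    also have "\<dots> = (\<Oplus>\<^bsub>K\<^esub>\<alpha>\<in>F'. t \<alpha> \<otimes>\<^bsub>K\<^esub> mK (d \<alpha>))"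
    proof (rule K.add.finprod_mono_neutral_cong_right[OF F F'(1)])
      show "s \<alpha> \<otimes>\<^bsub>K\<^esub> dd (mK \<alpha>) = t \<alpha> \<otimes>\<^bsub>K\<^esub> mK (d \<alpha>)" if "\<alpha> \<in> F'" for \<alpha>
        using that F' s mK_closed[OF dE] by (auto simp: ddm t_def K.add_pow_rdistr K.add_pow_ldistr)
      show "s \<alpha> \<otimes>\<^bsub>K\<^esub> dd (mK \<alpha>) = \<zero>\<^bsub>K\<^esub>" if "\<alpha> \<in> F - F'" for \<alpha>
        using that s by (auto simp: ddm F'_def)
    qed (use s ddc in auto)
    also have "\<dots> = (\<Oplus>\<^bsub>K\<^esub>\<beta>\<in>d ` F'. t (r \<beta>) \<otimes>\<^bsub>K\<^esub> mK \<beta>)"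
    proof -
      have "(\<Oplus>\<^bsub>K\<^esub>\<beta>\<in>d ` F'. t (r \<beta>) \<otimes>\<^bsub>K\<^esub> mK \<beta>) = (\<Oplus>\<^bsub>K\<^esub>\<alpha>\<in>F'. t (r (d \<alpha>)) \<otimes>\<^bsub>K\<^esub> mK (d \<alpha>))"
        by (rule K.add.finprod_reindex) (use rd t F' mK_closed[OF dE] in \<open>auto intro!: inj_on_inverseI[of _ r]\<close>)
      also have "\<dots> = (\<Oplus>\<^bsub>K\<^esub>\<alpha>\<in>F'. t \<alpha> \<otimes>\<^bsub>K\<^esub> mK (d \<alpha>))"
        by (rule K.add.finprod_cong') (use rd t F' mK_closed[OF dE] in auto)
      finally show ?thesis by simp
    qed
    finally have rel: "(\<Oplus>\<^bsub>K\<^esub>\<beta>\<in>d ` F'. t (r \<beta>) \<otimes>\<^bsub>K\<^esub> mK \<beta>) = \<zero>\<^bsub>K\<^esub>" by simp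
    have deg: "total_degree (d \<alpha>) < total_degree \<alpha>" if "\<alpha> \<in> F'" for \<alpha>
      unfolding d_def by (rule total_degree_decr) (use that FE F'_def in \<open>auto simp: p_exponents_def\<close>)
    have \<beta>': "\<beta> \<in> F'" using \<beta> g by (simp add: F'_def)
    have N0: "N \<noteq> 0" using deg[OF \<beta>'] less.prems(4)[OF \<beta>] by simp
    have "t (r (d \<beta>)) = \<zero>\<^bsub>K\<^esub>"
    proof (rule less.IH[of "N - 1" "d ` F'" "\<lambda>\<beta>. t (r \<beta>)"])
      show "N - 1 < N" using N0 by simp
      show "d ` F' \<subseteq> E" using dE F' by blast
      show "finite (d ` F')" using F' by simp
      show "(\<lambda>\<beta>. t (r \<beta>)) \<in> d ` F' \<rightarrow> constants" using rd t F' by auto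
      show "total_degree \<gamma> \<le> N - 1" if \<gamma>: "\<gamma> \<in> d ` F'" for \<gamma>
      proof -
        obtain \<alpha> where "\<alpha> \<in> F'" "\<gamma> = d \<alpha>" using \<gamma> by blast
        then show ?thesis using deg[of \<alpha>] less.prems(4)[of \<alpha>] F' by auto
      qed
      show "d \<beta> \<in> d ` F'" using \<beta>' by blast
    qed (rule rel)
    then have "add_pow K (\<beta> g) (s \<beta>) = \<zero>\<^bsub>K\<^esub>" using rd[OF \<beta>'] by (simp add: t_def)
    then have "add_pow K (\<beta> g) \<one>\<^bsub>K\<^esub> \<otimes>\<^bsub>K\<^esub> s \<beta> = \<zero>\<^bsub>K\<^esub>"
      using s[OF \<beta>] by (simp add: K.add_pow_ldistr)
    moreover have "add_pow K (\<beta> g) \<one>\<^bsub>K\<^esub> \<noteq> \<zero>\<^bsub>K\<^esub>"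
      using Kp.multiple_one_nonzero[of "\<beta> g"] g p_exponentsD(3)[of \<beta> p G g] \<beta> FE by auto
    ultimately show ?thesis using s[OF \<beta>] by (simp add: K.integral_iff)
  qed
  show ?case
  proof (cases "\<alpha> = (\<lambda>_. 0)")
    case True
    have "(\<Oplus>\<^bsub>K\<^esub>\<beta>\<in>F. s \<beta> \<otimes>\<^bsub>K\<^esub> mK \<beta>) = (\<Oplus>\<^bsub>K\<^esub>\<beta>\<in>{\<alpha>}. s \<beta> \<otimes>\<^bsub>K\<^esub> mK \<beta>)"
    proof (rule K.add.finprod_mono_neutral_cong_right[OF F])
      show "s \<beta> \<otimes>\<^bsub>K\<^esub> mK \<beta> = \<zero>\<^bsub>K\<^esub>" if "\<beta> \<in> F - {\<alpha>}" for \<beta>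
      proof -
        have "\<beta> \<noteq> (\<lambda>_. 0)" using that True by auto
        then obtain g where "\<beta> g \<noteq> 0" by (auto simp: fun_eq_iff)
        then show ?thesis using nonzero that s by simp
      qed
    qed (use less.prems(6) s in auto)
    also have "\<dots> = s \<alpha> \<otimes>\<^bsub>K\<^esub> mK \<alpha>"
      using s[OF less.prems(6)] by simp
    also have "mK \<alpha> = \<one>\<^bsub>K\<^esub>" unfolding True by (rule K.mval_0)
    finally show ?thesis using less.prems(5) s(2)[OF less.prems(6)] by simp
  next
    case False
    then obtain g where "\<alpha> g \<noteq> 0" by (auto simp: fun_eq_iff)
    then show ?thesis using nonzero less.prems(6) by blast
  qed
qed

theorem independent_in_extension:
  assumes "F \<subseteq> E" "finite F" "c \<in> F \<rightarrow> carrier K"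
    "(\<Oplus>\<^bsub>K\<^esub>\<alpha>\<in>F. c \<alpha> [^]\<^bsub>K\<^esub> p \<otimes>\<^bsub>K\<^esub> mK \<alpha>) = \<zero>\<^bsub>K\<^esub>" "\<alpha> \<in> F"
  shows "c \<alpha> = \<zero>\<^bsub>K\<^esub>"
proof -
  have "c \<alpha> [^]\<^bsub>K\<^esub> p = \<zero>\<^bsub>K\<^esub>"
  proof (rule independent_over_constants[OF assms(1,2) _ _ assms(4,5)])
    show "(\<lambda>\<alpha>. c \<alpha> [^]\<^bsub>K\<^esub> p) \<in> F \<rightarrow> constants" using assms(3) constants_pow by auto
    show "total_degree \<beta> \<le> Max (total_degree ` F)" if "\<beta> \<in> F" for \<beta>
      using that assms(2) by simp
  qed
  then show ?thesis using assms(3,5) K.pow_eq_zero by blast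
qed

end

section \<open>The \<open>p\<close>-basis of a regular local ring\<close>

lemma (in cring) ideal_finsum_closed:
  assumes "ideal I R" "finite F" "\<And>i. i \<in> F \<Longrightarrow> f i \<in> I"
  shows "(\<Oplus>i\<in>F. f i) \<in> I"
  using assms(2,3)
proof (induction F rule: finite_induct)
  case (insert i F)
  have "(\<Oplus>i\<in>insert i F. f i) = f i \<oplus> (\<Oplus>i\<in>F. f i)"
    by (rule finsum_insert) (use insert ideal_simps(1)[OF assms(1)] in auto)
  then show ?case using insert ideal_simps(3)[OF assms(1)] by simp
qed (use ideal_simps(2)[OF assms(1)] in simp)

section \<open>From the residue field up to \<open>R\<close>\<close>

locale local_noetherian_char_p = local_noetherian_cring + char_p_cring
begin

lemma independent_mod_descend:
  assumes A: "A \<subseteq> carrier R" and I: "primeideal I R" and x: "x \<in> m" "x \<notin> I"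
    and ind: "independent_mod A (adjoin I x)"
  shows "independent_mod A I"
  unfolding independent_mod_def
proof (intro allI impI)
  fix F c0 \<alpha>0
  assume F: "F \<subseteq> p_exponents p A" "finite F" and c0: "c0 \<in> F \<rightarrow> carrier R"
    and sum0: "psum F c0 \<in> I" and \<alpha>0: "\<alpha>0 \<in> F"
  note iI = primeideal.axioms(1)[OF I]
  have xc: "x \<in> carrier R" using ideal_simps(1)[OF m_ideal x(1)] .
  define S where "S c = psum F c" for c
  have mon: "monomial R \<alpha> \<in> carrier R" if "\<alpha> \<in> F" for \<alpha> using that F A monomial_in_carrier by blast
  have S_closed: "S c \<in> carrier R" if "c \<in> F \<rightarrow> carrier R" for c
    unfolding S_def by (rule finsum_closed) (use that mon in auto)
  have S_add: "S (\<lambda>\<alpha>. c \<alpha> \<oplus> d \<alpha>) = S c \<oplus> S d" if "c \<in> F \<rightarrow> carrier R" "d \<in> F \<rightarrow> carrier R" for c d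
    unfolding S_def by (rule psum_add[OF F(1) A that])
  have S_scale: "S (\<lambda>\<alpha>. r \<otimes> c \<alpha>) = r [^] p \<otimes> S c" if "c \<in> F \<rightarrow> carrier R" "r \<in> carrier R" for c r
    unfolding S_def by (rule psum_scale[OF F A that])
  have S_ideal: "S c \<in> I" if "\<And>\<alpha>. \<alpha> \<in> F \<Longrightarrow> c \<alpha> \<in> I" for c
  proof -
    obtain l where l: "p = Suc l" using p_ge_2 by (cases p) auto
    have "c \<alpha> [^] p \<otimes> monomial R \<alpha> \<in> I" if "\<alpha> \<in> F" for \<alpha>
    proof -
      have "c \<alpha> \<in> I" "c \<alpha> \<in> carrier R" using that \<open>\<And>\<alpha>. \<alpha> \<in> F \<Longrightarrow> c \<alpha> \<in> I\<close> ideal_simps(1)[OF iI] by auto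
      then have "c \<alpha> [^] p \<in> I" unfolding l using ideal_simps(6)[OF iI] by simp
      then show ?thesis using mon[OF that] ideal_simps(7)[OF iI] by simp
    qed
    then show ?thesis unfolding S_def by (intro ideal_finsum_closed iI F)
  qed
  \<comment> \<open>All values at \<open>\<alpha>0\<close> of coefficient families that are
    relations modulo \<open>I\<close>. They form an ideal since scaling a family by \<open>r\<close>
    multiplies its sum by \<open>r^p\<close>, so Nakayama can be applied to
    \<open>M = (M \<inter> I) + x M\<close>.\<close>
  define M where "M = {c \<alpha>0 | c. c \<in> F \<rightarrow> carrier R \<and> S c \<in> I}"
  have M: "ideal M R"
  proof (rule ideal_of_closed)
    show "M \<subseteq> carrier R" using \<alpha>0 by (auto simp: M_def)
    have "S (\<lambda>_. \<zero>) \<in> I" by (rule S_ideal) (rule ideal_simps(2)[OF iI])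
    then show "\<zero> \<in> M" unfolding M_def by force
  next
    fix a b assume "a \<in> M" "b \<in> M"
    then obtain c d where "a = c \<alpha>0" "b = d \<alpha>0" "c \<in> F \<rightarrow> carrier R" "d \<in> F \<rightarrow> carrier R" "S c \<in> I" "S d \<in> I"
      by (auto simp: M_def)
    then show "a \<oplus> b \<in> M"
      unfolding M_def using S_add[of c d] ideal_simps(3)[OF iI]
      by (intro CollectI exI[of _ "\<lambda>\<alpha>. c \<alpha> \<oplus> d \<alpha>"]) auto
  next
    fix r a assume r: "r \<in> carrier R" and "a \<in> M"
    then obtain c where "a = c \<alpha>0" "c \<in> F \<rightarrow> carrier R" "S c \<in> I"
      by (auto simp: M_def)
    then show "r \<otimes> a \<in> M"
      unfolding M_def using S_scale[of c r] r ideal_simps(6)[OF iI]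
      by (intro CollectI exI[of _ "\<lambda>\<alpha>. r \<otimes> c \<alpha>"]) auto
  qed
  have "M \<subseteq> I"
  proof (rule Nakayama_local[OF iI M x(1)])
    fix a assume "a \<in> M"
    then obtain c where c: "a = c \<alpha>0" "c \<in> F \<rightarrow> carrier R" "S c \<in> I" by (auto simp: M_def)
    have "S c \<in> adjoin I x" using c(3) adjoin_incl(1)[OF iI xc] by blast
    then have "c \<alpha> \<in> adjoin I x" if "\<alpha> \<in> F" for \<alpha>
      using ind F c(2) that unfolding independent_mod_def S_def by blast
    then have "\<forall>\<alpha>\<in>F. \<exists>d r. c \<alpha> = d \<oplus> x \<otimes> r \<and> d \<in> I \<and> r \<in> carrier R"
      using xc by (metis adjoinE m_comm)
    then obtain d r where dr: "\<And>\<alpha>. \<alpha> \<in> F \<Longrightarrow> c \<alpha> = d \<alpha> \<oplus> x \<otimes> r \<alpha>" "\<And>\<alpha>. \<alpha> \<in> F \<Longrightarrow> d \<alpha> \<in> I"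
      "\<And>\<alpha>. \<alpha> \<in> F \<Longrightarrow> r \<alpha> \<in> carrier R" by metis
    have dc: "d \<in> F \<rightarrow> carrier R" using dr(2) ideal_simps(1)[OF iI] by blast
    have rc: "r \<in> F \<rightarrow> carrier R" using dr(3) by blast
    have "S c = S (\<lambda>\<alpha>. d \<alpha> \<oplus> x \<otimes> r \<alpha>)"
      unfolding S_def by (rule add.finprod_cong') (use dr mon ideal_simps(1)[OF iI dr(2)] xc in auto)
    also have "\<dots> = S d \<oplus> S (\<lambda>\<alpha>. x \<otimes> r \<alpha>)" by (rule S_add) (use dc rc xc in auto)
    also have "S (\<lambda>\<alpha>. x \<otimes> r \<alpha>) = x [^] p \<otimes> S r" by (rule S_scale[OF rc xc])
    finally have "x [^] p \<otimes> S r \<oplus> S d \<in> I"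
      using c(3) S_closed[OF dc] S_closed[OF rc] xc by (simp add: a_comm)
    then have "x [^] p \<otimes> S r \<in> I"
      by (rule ideal_cancel_add[OF iI]) (use S_closed[OF rc] xc S_ideal dr(2) in auto)
    moreover have "x [^] n \<notin> I" for n :: nat
    proof (induction n)
      case 0 show ?case using prime_one_notin[OF I] by simp
    next
      case (Suc n) then show ?case using prime_mult_notin[OF I, of "x [^] n" x] x xc by simp
    qed
    ultimately have "S r \<in> I"
      using primeideal.I_prime[OF I, of "x [^] p" "S r"] S_closed[OF rc] xc by auto
    then have "r \<alpha>0 \<in> M" unfolding M_def using rc by blast
    then show "\<exists>c\<in>I. \<exists>b\<in>M. a = c \<oplus> x \<otimes> b" using dr(1,2)[OF \<alpha>0] c(1) by blast
  qed
  moreover have "c0 \<alpha>0 \<in> M" unfolding M_def S_def using c0 sum0 by blast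
  ultimately show "c0 \<alpha>0 \<in> I" by blast
qed

text \<open>The start of the climb, where the quasi-coefficient hypothesis enters: a relation modulo
  \<open>m\<close> becomes one in the field \<open>R Quot m\<close>, which is formally etale over
  \<open>k\<close>.\<close>

lemma independent_mod_maximal:
  assumes k: "k \<subseteq> carrier R" and A: "abs_p_basis (R\<lparr>carrier := k\<rparr>) p A"
    and etale: "formally_etale (R\<lparr>carrier := k\<rparr>) (R Quot m) (\<lambda>c. m +> c)"
  shows "independent_mod A m"
  unfolding independent_mod_def
proof (intro allI impI)
  fix F c \<alpha>
  assume F: "F \<subseteq> p_exponents p A" "finite F" and c: "c \<in> F \<rightarrow> carrier R"
    and sum: "psum F c \<in> m" and \<alpha>: "\<alpha> \<in> F"
  let ?K = "R Quot m" and ?\<pi> = "\<lambda>c. m +> c"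
  have zero: "\<zero>\<^bsub>?K\<^esub> = m" by (simp add: FactRing_def)
  interpret K: field ?K by (rule maximalideal.quotient_is_field[OF maximal is_cring])
  have Ac: "A \<subseteq> carrier R" using abs_p_basis.G[OF A] k by simp
  have E: "etale_p_basis (R\<lparr>carrier := k\<rparr>) p A ?K ?\<pi>"
    by (intro etale_p_basis.intro etale_p_basis_axioms.intro A K.field_axioms etale)
  have \<pi>: "?\<pi> \<in> ring_hom R ?K" by (rule ideal.rcos_ring_hom[OF m_ideal])
  interpret \<pi>: ring_hom_cring R ?K ?\<pi>
    using \<pi> is_cring K.is_cring by (simp add: ring_hom_cring_of_hom)
  have mon: "monomial R \<beta> \<in> carrier R" if "\<beta> \<in> F" for \<beta> using that F Ac monomial_in_carrier by blast
  have \<pi>m: "?\<pi> (monomial R \<beta>) = mval ?K ?\<pi> \<beta>" if "\<beta> \<in> F" for \<beta>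
    unfolding monomial_mval
    by (rule mval_hom[OF K.is_cring \<pi>]) (use that F Ac in \<open>auto simp: p_exponents_def\<close>)
  have fc: "c \<beta> \<in> carrier R" if "\<beta> \<in> F" for \<beta> using c that by blast
  have image: "?\<pi> (c \<beta>) [^]\<^bsub>?K\<^esub> p \<otimes>\<^bsub>?K\<^esub> mval ?K ?\<pi> \<beta> = ?\<pi> (c \<beta> [^] p \<otimes> monomial R \<beta>)"
    if "\<beta> \<in> F" for \<beta>
    unfolding \<pi>m[OF that, symmetric] using fc[OF that] mon[OF that] by simp
  have "(\<Oplus>\<^bsub>?K\<^esub>\<beta>\<in>F. ?\<pi> (c \<beta>) [^]\<^bsub>?K\<^esub> p \<otimes>\<^bsub>?K\<^esub> mval ?K ?\<pi> \<beta>)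
      = (\<Oplus>\<^bsub>?K\<^esub>\<beta>\<in>F. ?\<pi> (c \<beta> [^] p \<otimes> monomial R \<beta>))"
    by (rule K.add.finprod_cong') (use fc mon image in auto)
  also have "\<dots> = ?\<pi> (psum F c)"
    using \<pi>.hom_finsum[of "\<lambda>\<beta>. c \<beta> [^] p \<otimes> monomial R \<beta>" F] c mon by (simp add: Pi_def comp_def)
  also have "\<dots> = \<zero>\<^bsub>?K\<^esub>" unfolding zero by (rule a_rcos_zero[OF m_ideal sum])
  finally have "?\<pi> (c \<alpha>) = \<zero>\<^bsub>?K\<^esub>"
    by (intro etale_p_basis.independent_in_extension[OF E F(1,2) _ _ \<alpha>, where c = "\<lambda>\<beta>. ?\<pi> (c \<beta>)"])
      (use c \<pi>.hom_closed in auto)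
  then show "c \<alpha> \<in> m"
    unfolding zero using ideal.rcos_const_imp_mem[OF m_ideal] c \<alpha> by auto
qed

end

context char_p_cring
begin

text \<open>Generation holds because \<open>k = k^p[A]\<close> lies in \<open>R^p[A, B]\<close>.
  Independence is the tower argument over \<open>R^p[k]\<close>, which contains \<open>A\<close> and
  all \<open>p\<close>-th powers.\<close>

theorem abs_p_basis_join:
  assumes k: "subring k R" and A: "abs_p_basis (R\<lparr>carrier := k\<rparr>) p A"
    and ind: "independent_mod A {\<zero>}" and B: "p_basis R p k B"
  shows "abs_p_basis R p (A \<union> B)"
proof -
  interpret k: abs_p_basis "R\<lparr>carrier := k\<rparr>" p A by (rule A)
  let ?P = "(\<lambda>r. r [^] p) ` carrier R"
  have kc: "k \<subseteq> carrier R" using subringE(1)[OF k] .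
  have Ac: "A \<subseteq> carrier R" "A \<subseteq> k" using k.G kc by auto
  have Bc: "B \<subseteq> carrier R" and Bgen: "generate_ring R (Rpk R p k \<union> B) = carrier R"
    and Bind: "lin_independent_family R (Rpk R p k) (p_exponents p B) (monomial R)"
    using B by (auto simp: p_basis_def)
  define L where "L = generate_ring R (?P \<union> (A \<union> B))"
  have Hc: "?P \<union> (A \<union> B) \<subseteq> carrier R" using Ac Bc by auto
  have L: "subring L R" unfolding L_def by (rule generate_ring_is_subring[OF Hc])
  have HL: "?P \<union> (A \<union> B) \<subseteq> L" unfolding L_def by (auto intro: generate_ring.incl)
  let ?H = "(\<lambda>r. r [^]\<^bsub>R\<lparr>carrier := k\<rparr>\<^esub> p) ` k \<union> A"
  have k_eq: "generate_ring (R\<lparr>carrier := k\<rparr>) ?H = k" using k.gen by simp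
  have Hk: "?H \<subseteq> k" using Ac k.nat_pow_closed by auto
  have Hk': "?H \<subseteq> L" using HL kc by (auto simp: nat_pow_subset)
  have "generate_ring (R\<lparr>carrier := k\<rparr>) ?H \<subseteq> generate_ring (R\<lparr>carrier := L\<rparr>) ?H"
    by (rule subring_gen_incl[OF L k Hk' Hk])
  also have "\<dots> \<subseteq> L"
    using ring.generate_ring_incl[OF subring_is_ring[OF L], of ?H] Hk' by simp
  finally have "k \<subseteq> L" using k_eq by simp
  then have "Rpk R p k \<subseteq> L"
    unfolding Rpk_def by (intro generate_ring_min_subring1 L) (use HL kc in auto)
  then have "carrier R \<subseteq> L"
    unfolding Bgen[symmetric]
    by (intro generate_ring_min_subring1 L) (use HL Bc generate_ring_incl[of "?P \<union> k"] kc in \<open>auto simp: Rpk_def\<close>)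
  then have gen: "L = carrier R" using subringE(1)[OF L] by blast
  have Rpk: "subring (Rpk R p k) R" unfolding Rpk_def by (rule generate_ring_is_subring) (use kc in auto)
  have RpkH: "?P \<union> k \<subseteq> Rpk R p k" unfolding Rpk_def by (auto intro: generate_ring.incl)
  have AR: "A \<subseteq> Rpk R p k" using Ac(2) RpkH by blast
  have indAB: "independent_mod (A \<union> B) {\<zero>}"
    by (rule independent_join[OF Ac(1) Bc ind Rpk _ AR Bind]) (use RpkH in blast)
  show ?thesis
  proof unfold_locales
    show "A \<union> B \<subseteq> carrier R" using Ac Bc by blast
    show "generate_ring R (?P \<union> (A \<union> B)) = carrier R" using gen by (simp add: L_def)
  qed (use independent_modD[OF indAB] in blast)
qed

end

text \<open>A finite supremum is attained: for \<open>d = Suc e\<close> some chain is longer than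
  \<open>e\<close> and can be shortened to \<open>d\<close>, while for \<open>d = 0\<close> the
  prime \<open>m\<close> alone is a chain.\<close>

lemma regular_local_chain:
  assumes "maximalideal m R" "cring R" "enat d = krull_dim R"
  obtains P where "prime_chain R d P"
proof (cases d)
  case 0
  have "primeideal m R" using cring.maximalideal_prime assms by blast
  then have "prime_chain R d (\<lambda>_. m)" using 0 by (simp add: prime_chain_def)
  then show ?thesis by (rule that)
next
  case (Suc e)
  have "enat e < krull_dim R" using assms(3) Suc by (metis enat_ord_simps(2) lessI)
  then obtain n P where "enat e < enat n" "(\<forall>i\<le>n. primeideal (P i) R) \<and> (\<forall>i<n. P i \<subset> P (Suc i))"
    unfolding krull_dim_def less_Sup_iff by blast
  then have "prime_chain R n P" "d \<le> n" using Suc by (auto simp: prime_chain_def)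
  then have "prime_chain R d P" by (rule prime_chain_shorter)
  then show ?thesis by (rule that)
qed

theorem corollary4p7:
  fixes R :: "('a, 'r) ring_scheme" and m k :: "'a set" and p :: nat
  assumes "regular_local_ring R m"
    and "Factorial_Ring.prime p" and "has_characteristic R p"
    and "quasi_coefficient_field R m k"
    and "\<exists>B. p_basis R p k B"
  shows "Der R k = IDer R k"
proof
  show "IDer R k \<subseteq> Der R k" by (auto simp: IDer_def)
  obtain B where B: "p_basis R p k B" using assms(5) by blast
  have nl: "cring R" "noetherian_ring R" "maximalideal m R" "\<And>J. maximalideal J R \<Longrightarrow> J = m"
    using assms(1) by (auto simp: regular_local_ring_def noetherian_local_ring_def)
  obtain S where S: "S \<subseteq> carrier R" "finite S" "genideal R S = m" "enat (card S) = krull_dim R"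
    using assms(1) by (auto simp: regular_local_ring_def)
  have char: "add_pow R p \<one>\<^bsub>R\<^esub> = \<zero>\<^bsub>R\<^esub>" using assms(3) by (simp add: has_characteristic_def)
  interpret local_noetherian_char_p R m p
    by (intro local_noetherian_char_p.intro local_noetherian_cring.intro noetherian_cring.intro
        local_noetherian_cring_axioms.intro char_p_cring.intro char_p_cring_axioms.intro
        nl assms(2) char)
  have k: "subfield k R" and etale: "formally_etale (R\<lparr>carrier := k\<rparr>) (R Quot m) (\<lambda>c. m +>\<^bsub>R\<^esub> c)"
    using assms(4) unfolding quasi_coefficient_field_def by blast+
  note k_subring = subfieldE(1)[OF k]
  have kc: "k \<subseteq> carrier R" using subringE(1)[OF k_subring] .
  interpret k: field "R\<lparr>carrier := k\<rparr>" by (rule subfield_iff(2)[OF k])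
  interpret k: char_p_field "R\<lparr>carrier := k\<rparr>" p
  proof unfold_locales
    have "add_pow (R\<lparr>carrier := k\<rparr>) n x = add_pow R n x" for n :: nat and x
      by (simp add: add_pow_def nat_pow_def)
    then show "add_pow (R\<lparr>carrier := k\<rparr>) p \<one>\<^bsub>R\<lparr>carrier := k\<rparr>\<^esub> = \<zero>\<^bsub>R\<lparr>carrier := k\<rparr>\<^esub>"
      using char by simp
  qed (rule assms(2))
  obtain A where A: "abs_p_basis (R\<lparr>carrier := k\<rparr>) p A" using k.abs_p_basis_exists by blast
  have Ac: "A \<subseteq> carrier R" using abs_p_basis.G[OF A] kc by simp
  obtain P where P: "prime_chain R (card S) P" using regular_local_chain[OF nl(3,1) S(4)] by blast
  then have "primeideal (P 0) R" by (simp add: prime_chain_def)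
  then have "{\<zero>\<^bsub>R\<^esub>} \<subseteq> P 0" using ideal_simps(2) primeideal.axioms(1) by blast
  moreover have "Idl\<^bsub>R\<^esub> ({\<zero>\<^bsub>R\<^esub>} \<union> S) = m"
  proof -
    have c: "{\<zero>\<^bsub>R\<^esub>} \<union> S \<subseteq> carrier R" using S(1) by simp
    have "Idl\<^bsub>R\<^esub> ({\<zero>\<^bsub>R\<^esub>} \<union> S) = Idl\<^bsub>R\<^esub> S"
    proof
      show "Idl\<^bsub>R\<^esub> ({\<zero>\<^bsub>R\<^esub>} \<union> S) \<subseteq> Idl\<^bsub>R\<^esub> S"
        using genideal_ideal[OF S(1)] genideal_self[OF S(1)]
        by (intro genideal_minimal Un_least) (auto intro: ideal_simps(2))
      show "Idl\<^bsub>R\<^esub> S \<subseteq> Idl\<^bsub>R\<^esub> ({\<zero>\<^bsub>R\<^esub>} \<union> S)" using c by (intro subset_Idl_subset) auto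
    qed
    then show ?thesis using S(3) by simp
  qed
  \<comment> \<open>Regularity enters here: the chain \<open>P\<close> is as long as the number of
    generators \<open>S\<close>, so the induction along the parameters ends at the zero
    ideal.\<close>
  ultimately have "primeideal {\<zero>\<^bsub>R\<^esub>} R \<and> independent_mod A {\<zero>\<^bsub>R\<^esub>}"
    using independent_mod_maximal[OF kc A etale] independent_mod_descend[OF Ac]
    by (intro regular_sequence_induct[OF _ _ zeroideal S(2,1) _ P]) auto
  then have "abs_p_basis R p (A \<union> B)"
    using abs_p_basis_join[OF k_subring A _ B] by blast
  then interpret abs_p_basis R p "A \<union> B" .
  show "Der R k \<subseteq> IDer R k"
    using derivation_integrable[OF kc _ A] by blast
qed

end
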